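(* Let $(X,\|\cdot\|)$ be a complex Banach space with open unit ball $B$, let $h\in\mathrm{Hol}(B,X)$ and $\omega\in\mathbb{R}$. The following statements are equivalent: (i) $h$ is $\omega$-dissipative. (ii) $L(h)\le\omega$. (iii) $h$ has unit radius of boundedness and it is $\omega$-pseudo-contractive. Moreover, for all $x\in B$, $$\lim_{\alpha\to0^+}\Phi_\alpha(x)=x,\qquad \lim_{\alpha\to0^+}\frac{\Phi_\alpha(x)-x}{\alpha}=h(x)-\omega x,$$ where the convergence is pointwise in the norm topology of $X$. (iv) $h$ has unit radius of boundedness and $\Phi_\alpha\in\mathrm{Hol}(B)$ for each $\alpha\in Q_\omega$, where $Q_\omega=[0,1/\omega)$ if $\omega>0$, $Q_0=[0,+\infty)$, and $Q_\omega=(-\infty,1/\omega)\cup[0,+\infty)$ if $\omega<0$.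
   Context: $X$ is a complex Banach space, $X^*$ its dual, $\langle x,x^*\rangle$ the value of $x^*\in X^*$ at $x\in X$, $B=\{x\in X:\|x\|<1\}$, $\partial B$ its boundary, and $J(x)=\{x^*\in X^*:\|x\|^2=\langle x,x^*\rangle=\|x^*\|^2\}$. For a domain $V\subset X$ and $W\subseteq X$, $\mathrm{Hol}(V,W)$ is the set of holomorphic (i.e. complex Fréchet differentiable at each point) maps $V\to W$, and $\mathrm{Hol}(V)=\mathrm{Hol}(V,V)$. $h$ is $\omega$-dissipative if there are $\varepsilon>0$ and $\varsigma\in\mathbb{R}$ such that for each $x\in B$ with $1-\varepsilon<\|x\|<1$ and all $x^*\in J(x)$: $\mathrm{Re}\langle h(x),x^*\rangle\le\omega\|x\|^2+\varsigma(1-\|x\|^2)$. For $s\in(0,1)$ put $h_s(x)=h(sx)$. The numerical radius is $$L(h)=\limsup_{s\to1^-}\ \sup\{\mathrm{Re}\langle h_s(x),x^*\rangle: x\in\partial B,\ x^*\in J(x)\}.$$ $h$ has unit radius of boundedness if $\sup_{\|x\|\le r}\|h(x)\|<\infty$ for each $r\in(0,1)$. Abel average: for real $\alpha$ with $\alpha\omega\ne1$, $\Phi_\alpha=(I-\alpha h)^{-1}\circ[(1-\alpha\omega)I]$, $\Phi_0=I$ (the identity). That is, $\Phi_\alpha(x)$ is the unique $y\in B$ with $y-\alpha h(y)=(1-\alpha\omega)x$; "$\Phi_\alpha\in\mathrm{Hol}(B)$" means that such a unique $y\in B$ exists for every $x\in B$ and that $x\mapsto y$ is holomorphic. $h$ is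 $\omega$-pseudo-contractive if there exists $\delta>0$ such that $\Phi_\alpha\in\mathrm{Hol}(B)$ for each $\alpha\in(0,\delta)$. *)

theory Defs
  imports "HOL-Analysis.Analysis"
begin

(* The library has no complex normed spaces: a complex Banach space is a real Banach space
   with a complex scalar multiplication that extends the real one and for which the given norm
   is homogeneous. *)
class complex_banach = banach +
  fixes scaleC :: "complex \<Rightarrow> 'a \<Rightarrow> 'a"  (infixr "*\<^sub>C" 75)
  assumes scaleC_add_right: "a *\<^sub>C (x + y) = a *\<^sub>C x + a *\<^sub>C y"
    and scaleC_add_left: "(a + b) *\<^sub>C x = a *\<^sub>C x + b *\<^sub>C x"
    and scaleC_scaleC: "a *\<^sub>C (b *\<^sub>C x) = (a * b) *\<^sub>C x"
    and scaleC_one: "1 *\<^sub>C x = x"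
    and scaleR_scaleC: "r *\<^sub>R x = complex_of_real r *\<^sub>C x"
    and norm_scaleC: "norm (a *\<^sub>C x) = cmod a * norm x"

instantiation complex :: complex_banach
begin

definition scaleC_complex :: "complex \<Rightarrow> complex \<Rightarrow> complex"
  where "scaleC_complex a x = a * x"

instance
  by standard (auto simp: scaleC_complex_def algebra_simps norm_mult scaleR_conv_of_real)

end

definition bounded_clinear :: "('a::complex_banach \<Rightarrow> 'b::complex_banach) \<Rightarrow> bool"
  where "bounded_clinear f \<longleftrightarrow> bounded_linear f \<and> (\<forall>c x. f (c *\<^sub>C x) = c *\<^sub>C f x)"

definition cfrechet_differentiable_at ::
    "('a::complex_banach \<Rightarrow> 'b::complex_banach) \<Rightarrow> 'a \<Rightarrow> bool"
  where "cfrechet_differentiable_at f x \<longleftrightarrow>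
    (\<exists>D. bounded_clinear D \<and> (f has_derivative D) (at x))"

(* Used for open V only; maps are total, so their values outside V are irrelevant. *)
definition Hol :: "'a::complex_banach set \<Rightarrow> 'b::complex_banach set \<Rightarrow> ('a \<Rightarrow> 'b) set"
  where "Hol V W = {f. (\<forall>x\<in>V. cfrechet_differentiable_at f x) \<and> f ` V \<subseteq> W}"

abbreviation unit_ball :: "'a::complex_banach set"
  where "unit_ball \<equiv> ball 0 1"

(* Elements of the dual space are the bounded complex-linear functionals;
   onorm is the dual norm. *)
definition duality_map :: "'a::complex_banach \<Rightarrow> ('a \<Rightarrow> complex) set"
  where "duality_map x =
    {\<phi>. bounded_clinear \<phi> \<and> complex_of_real ((norm x)\<^sup>2) = \<phi> x \<and> (norm x)\<^sup>2 = (onorm \<phi>)\<^sup>2}"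

definition dissipative :: "real \<Rightarrow> ('a::complex_banach \<Rightarrow> 'a) \<Rightarrow> bool"
  where "dissipative \<omega> h \<longleftrightarrow>
    (\<exists>\<epsilon>>0. \<exists>\<sigma>::real. \<forall>x\<in>unit_ball. 1 - \<epsilon> < norm x \<and> norm x < 1 \<longrightarrow>
      (\<forall>\<phi>\<in>duality_map x. Re (\<phi> (h x)) \<le> \<omega> * (norm x)\<^sup>2 + \<sigma> * (1 - (norm x)\<^sup>2)))"

(* Extended-real valued, since the suprema and the upper limit may be infinite. *)
definition numerical_radius :: "('a::complex_banach \<Rightarrow> 'a) \<Rightarrow> ereal"
  where "numerical_radius h =
    Limsup (at_left (1::real))
      (\<lambda>s. Sup {ereal (Re (\<phi> (h (s *\<^sub>R x)))) | x \<phi>.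
               x \<in> frontier unit_ball \<and> \<phi> \<in> duality_map x})"

definition unit_radius_of_boundedness :: "('a::complex_banach \<Rightarrow> 'a) \<Rightarrow> bool"
  where "unit_radius_of_boundedness h \<longleftrightarrow>
    (\<forall>r\<in>{0<..<1}. bdd_above ((\<lambda>x. norm (h x)) ` cball 0 r))"

definition abel_solution :: "real \<Rightarrow> ('a::complex_banach \<Rightarrow> 'a) \<Rightarrow> real \<Rightarrow> 'a \<Rightarrow> 'a \<Rightarrow> bool"
  where "abel_solution \<omega> h \<alpha> x y \<longleftrightarrow> y \<in> unit_ball \<and> y - \<alpha> *\<^sub>R h y = (1 - \<alpha> * \<omega>) *\<^sub>R x"

(* For \<alpha> = 0 and x in the unit ball the unique solution is x itself, so the convention that
   the Abel average at 0 is the identity needs no separate case. *)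
definition abel_average :: "real \<Rightarrow> ('a::complex_banach \<Rightarrow> 'a) \<Rightarrow> real \<Rightarrow> 'a \<Rightarrow> 'a"
  where "abel_average \<omega> h \<alpha> x = (THE y. abel_solution \<omega> h \<alpha> x y)"

(* The Abel average is only defined for \<alpha> * \<omega> \<noteq> 1, and the definite description is only
   meaningful under unique solvability, so both are part of the condition. *)
definition abel_average_in_Hol :: "real \<Rightarrow> ('a::complex_banach \<Rightarrow> 'a) \<Rightarrow> real \<Rightarrow> bool"
  where "abel_average_in_Hol \<omega> h \<alpha> \<longleftrightarrow>
    \<alpha> * \<omega> \<noteq> 1 \<and>
    (\<forall>x\<in>unit_ball. \<exists>!y. abel_solution \<omega> h \<alpha> x y) \<and>
    abel_average \<omega> h \<alpha> \<in> Hol unit_ball unit_ball"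

definition pseudo_contractive :: "real \<Rightarrow> ('a::complex_banach \<Rightarrow> 'a) \<Rightarrow> bool"
  where "pseudo_contractive \<omega> h \<longleftrightarrow> (\<exists>\<delta>>0. \<forall>\<alpha>\<in>{0<..<\<delta>}. abel_average_in_Hol \<omega> h \<alpha>)"

definition Q :: "real \<Rightarrow> real set"
  where "Q \<omega> = (if \<omega> > 0 then {0..<1/\<omega>}
                else if \<omega> = 0 then {0..}
                else {..<1/\<omega>} \<union> {0..})"

end

theory Submission
  imports Defs "HOL-Complex_Analysis.Complex_Analysis"
begin

text \<open>For a norming functional \<open>\<phi>\<close> at a unit vector \<open>u\<close> put \<open>f \<zeta> = \<phi> (h (\<zeta> u))\<close>. The maximum
  principle for \<open>(f \<zeta> - f 0) / \<zeta> + cnj (f 0) \<zeta>\<close> turns the asymptotic bound \<open>L(h) \<le> \<omega>\<close> into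
  \<open>Re (\<phi> (h (s u))) \<le> \<omega> s + \<parallel>h 0\<parallel> (1 - s\<^sup>2)\<close> for every \<open>0 < s < 1\<close>, which is dissipativity.

  The Abel equation asks for a zero of a map that points inwards on spheres near the unit sphere.
  For small \<open>\<alpha>\<close> the resolvent \<open>(I - \<alpha> F)\<^sup>-\<^sup>1\<close> of such a map \<open>F\<close> sends the ball strictly inside itself,
  so by Earle--Hamilton it has a unique fixed point, depending holomorphically on parameters.
  This requires \<open>h\<close> to be bounded on smaller balls. By Borel--Caratheodory the Taylor polynomials
  \<open>P\<^sub>n\<close> of \<open>h\<close> have numerical radius of subexponential growth, and the same resolvent argument for
  the multiples of \<open>P\<^sub>n\<close>, which are bounded on balls, carries this growth over to their norms.

  Conversely, \<open>(\<Phi>\<^sub>\<alpha> - I) / \<alpha>\<close> satisfies the displayed estimate with \<open>\<omega> = 0\<close> because \<open>\<Phi>\<^sub>\<alpha>\<close> is a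
  self-map of the ball, and it converges to \<open>h - \<omega> I\<close>.\<close>

subsection \<open>Norming functionals\<close>

text \<open>The obstacle is boundedness: in infinite dimensions a holomorphic map on the ball may be
  unbounded on smaller balls, and the numerical range sees \<open>h\<close> at a multiple of
  \<open>u\<close> only through functionals norming \<open>u\<close>, whereas a norm bound must
  control all functionals. Homogeneous polynomials escape this: each one is bounded on balls because
  \<open>h\<close> is bounded near 0, and the resolvent argument then yields a norm bound that
  depends only on its numerical range, not on the bound it started from. Two losses occur,
  \<open>q^-n\<close> from Cauchy's inequality on the circle of radius \<open>q\<close> and another
  \<open>q^-n\<close> from the resolvent, so the Taylor series is controlled at radii
  \<open>r < q^2\<close>, and \<open>q < 1\<close> is free. A resolvent enters because an
  inward-pointing \<open>F\<close> is not a self-map of the ball; rewriting \<open>F y = z\<close>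
  as \<open>y = S (y - \<alpha> z)\<close> gives a fixed point equation for a strict self-map. In
  the auxiliary function, subtracting \<open>f 0 / \<zeta>\<close> removes the pole, and
  \<open>cnj (f 0) * \<zeta>\<close> restores its real part: the two are conjugate when
  \<open>cmod \<zeta> = 1\<close>.\<close>

definition sublinear :: "('a::real_vector \<Rightarrow> real) \<Rightarrow> bool"
  where "sublinear p \<longleftrightarrow> (\<forall>x y. p (x + y) \<le> p x + p y) \<and> (\<forall>t>0. \<forall>x. p (t *\<^sub>R x) = t * p x)"

lemma sublinearD:
  assumes "sublinear p"
  shows "p (x + y) \<le> p x + p y" "t > 0 \<Longrightarrow> p (t *\<^sub>R x) = t * p x"
  using assms unfolding sublinear_def by auto

lemma sublinear_zero:
  assumes "sublinear p"
  shows "p 0 = 0"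
  using sublinearD(2)[OF assms, of 2 0] by simp

lemma sublinear_lower:
  assumes "sublinear p"
  shows "- p (- x) \<le> p x"
  using sublinearD(1)[OF assms, of x "- x"] sublinear_zero[OF assms] by simp

text \<open>Supplies lower bounds of chains for Zorn's lemma. Subadditivity survives the infimum
  because two members, nearly optimal at \<open>x\<close> and at \<open>y\<close>, can be replaced
  by a single one below both.\<close>

lemma sublinear_Inf:
  fixes C :: "('a::real_vector \<Rightarrow> real) set"
  assumes ne: "C \<noteq> {}" and sub: "\<And>p. p \<in> C \<Longrightarrow> sublinear p"
    and dir: "\<And>p q. p \<in> C \<Longrightarrow> q \<in> C \<Longrightarrow> \<exists>r\<in>C. \<forall>x. r x \<le> p x \<and> r x \<le> q x"
    and bdd: "\<And>x. bdd_below ((\<lambda>p. p x) ` C)"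
  shows "sublinear (\<lambda>x. INF p\<in>C. p x)"
  unfolding sublinear_def
proof (intro conjI allI impI)
  fix x y :: 'a
  show "(INF p\<in>C. p (x + y)) \<le> (INF p\<in>C. p x) + (INF p\<in>C. p y)"
  proof -
    have *: "(INF p\<in>C. p (x + y)) \<le> p x + q y" if pq: "p \<in> C" "q \<in> C" for p q
    proof -
      obtain r where r: "r \<in> C" "\<forall>x. r x \<le> p x \<and> r x \<le> q x" using dir[OF pq] by blast
      have "(INF p\<in>C. p (x + y)) \<le> r (x + y)" by (rule cINF_lower[OF bdd r(1)])
      also have "\<dots> \<le> r x + r y" by (rule sublinearD(1)[OF sub[OF r(1)]])
      also have "\<dots> \<le> p x + q y" using r(2) by (simp add: add_mono)
      finally show ?thesis .
    qed
    have "(INF p\<in>C. p (x + y)) - q y \<le> (INF p\<in>C. p x)" if "q \<in> C" for q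
      using *[OF _ that] by (intro cINF_greatest[OF ne]) (auto simp: algebra_simps)
    then have "(INF p\<in>C. p (x + y)) - (INF p\<in>C. p x) \<le> (INF q\<in>C. q y)"
      by (intro cINF_greatest[OF ne]) (auto simp: algebra_simps)
    then show ?thesis by simp
  qed
next
  fix t :: real and x :: 'a
  assume t: "t > 0"
  have le: "(INF p\<in>C. p (s *\<^sub>R y)) \<le> s * (INF p\<in>C. p y)" if "s > 0" for s y
  proof -
    have "(INF p\<in>C. p (s *\<^sub>R y)) / s \<le> (INF p\<in>C. p y)"
    proof (rule cINF_greatest[OF ne])
      fix p assume p: "p \<in> C"
      have "(INF p\<in>C. p (s *\<^sub>R y)) \<le> p (s *\<^sub>R y)" by (rule cINF_lower[OF bdd p])
      then show "(INF p\<in>C. p (s *\<^sub>R y)) / s \<le> p y"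
        using sublinearD(2)[OF sub[OF p] that] that by (simp add: field_simps)
    qed
    then show ?thesis using that by (simp add: field_simps)
  qed
  have "(INF p\<in>C. p x) \<le> (1 / t) * (INF p\<in>C. p (t *\<^sub>R x))"
    using le[of "1/t" "t *\<^sub>R x"] t by simp
  then show "(INF p\<in>C. p (t *\<^sub>R x)) = t * (INF p\<in>C. p x)"
    using le[OF t, of x] t by (simp add: field_simps)
qed

text \<open>The infimum over \<open>t \<ge> 0\<close> of \<open>p (x + t a) - t p a\<close> lowers
  \<open>p\<close> in the direction \<open>- a\<close>; subadditivity keeps it above
  \<open>- p (- x)\<close>. A minimal sublinear functional must agree with this refinement, which
  makes it odd.\<close>

lemma sublinear_refine:
  fixes p :: "'a::real_vector \<Rightarrow> real"
  assumes p: "sublinear p"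
  shows "\<exists>q. sublinear q \<and> (\<forall>x. q x \<le> p x) \<and> q (- a) \<le> - p a"
proof -
  define f where "f x t = p (x + t *\<^sub>R a) - t * p a" for x t
  define q where "q x = (INF t\<in>{0..}. f x t)" for x
  have pt: "p (t *\<^sub>R y) = t * p y" if "t \<ge> 0" for t y
    using sublinearD(2)[OF p] sublinear_zero[OF p] that by (cases "t = 0") auto
  have bdd: "bdd_below (f x ` {0..})" for x
  proof (rule bdd_belowI2)
    fix t :: real assume "t \<in> {0..}"
    then have "t * p a = p ((x + t *\<^sub>R a) + (- x))" using pt by simp
    also have "\<dots> \<le> p (x + t *\<^sub>R a) + p (- x)" by (rule sublinearD(1)[OF p])
    finally show "- p (- x) \<le> f x t" by (simp add: f_def)
  qed
  have low: "q x \<le> f x t" if "t \<ge> 0" for x t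
    unfolding q_def using that by (intro cINF_lower[OF bdd]) auto
  have great: "b \<le> q x" if "\<And>t. t \<ge> 0 \<Longrightarrow> b \<le> f x t" for b x
    unfolding q_def using that by (intro cINF_greatest) auto
  have "q (x + y) \<le> q x + q y" for x y
  proof -
    have *: "q (x + y) \<le> f x s + f y t" if "s \<ge> 0" "t \<ge> 0" for s t
    proof -
      have "q (x + y) \<le> f (x + y) (s + t)" using low that by simp
      also have "\<dots> \<le> f x s + f y t"
        using sublinearD(1)[OF p, of "x + s *\<^sub>R a" "y + t *\<^sub>R a"]
        by (simp add: f_def algebra_simps)
      finally show ?thesis .
    qed
    have "q (x + y) - f y t \<le> q x" if "t \<ge> 0" for t
      using *[OF _ that] by (intro great) (simp add: algebra_simps)
    then have "q (x + y) - q x \<le> q y" by (intro great) (simp add: algebra_simps)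
    then show ?thesis by simp
  qed
  moreover have "q (t *\<^sub>R x) = t * q x" if t: "t > 0" for t x
  proof -
    have le: "q (s *\<^sub>R y) \<le> s * q y" if "s > 0" for s y
    proof -
      have "q (s *\<^sub>R y) / s \<le> q y"
      proof (rule great)
        fix r :: real assume "r \<ge> 0"
        then have "q (s *\<^sub>R y) \<le> f (s *\<^sub>R y) (s * r)" using low that by simp
        also have "\<dots> = s * f y r"
          using sublinearD(2)[OF p that, of "y + r *\<^sub>R a"] by (simp add: f_def algebra_simps)
        finally show "q (s *\<^sub>R y) / s \<le> f y r" using that by (simp add: field_simps)
      qed
      then show ?thesis using that by (simp add: field_simps)
    qed
    have "q x \<le> (1 / t) * q (t *\<^sub>R x)"
      using le[of "1/t" "t *\<^sub>R x"] t by simp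
    then show ?thesis using le[OF t, of x] t by (simp add: field_simps)
  qed
  ultimately have "sublinear q" unfolding sublinear_def by blast
  moreover have "q x \<le> p x" for x using low[of 0 x] by (simp add: f_def)
  moreover have "q (- a) \<le> - p a" using low[of 1 "- a"] sublinear_zero[OF p] by (simp add: f_def)
  ultimately show ?thesis by blast
qed

text \<open>A sublinear functional that is minimal below \<open>p\<close> is odd, hence linear.\<close>

lemma hahn_banach_sublinear:
  fixes p :: "'a::real_vector \<Rightarrow> real"
  assumes p: "sublinear p"
  shows "\<exists>u. linear u \<and> (\<forall>x. u x \<le> p x)"
proof -
  define A where "A = {q. sublinear q \<and> (\<forall>x. q x \<le> p x)}"
  \<comment> \<open>The order is reversed: Zorn's lemma yields maximal elements for
    \<open>le\<close>, that is, pointwise minimal functionals.\<close>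
  define le where "le f g \<longleftrightarrow> (\<forall>x. g x \<le> f x)" for f g :: "'a \<Rightarrow> real"
  have "\<exists>m\<in>A. \<forall>a\<in>A. le m a \<longrightarrow> a = m"
  proof (rule predicate_Zorn)
    show "partial_order_on A (relation_of le A)"
      by (rule partial_order_on_relation_ofI) (auto simp: le_def fun_eq_iff intro: order_trans antisym)
  next
    fix C assume C: "C \<in> Chains (relation_of le A)"
    then have CA: "C \<subseteq> A" and ch: "\<And>f g. f \<in> C \<Longrightarrow> g \<in> C \<Longrightarrow> le f g \<or> le g f"
      unfolding Chains_def relation_of_def by auto
    show "\<exists>u\<in>A. \<forall>a\<in>C. le a u"
    proof (cases "C = {}")
      case True
      then show ?thesis using p A_def by auto
    next
      case False
      have bdd: "bdd_below ((\<lambda>q. q x) ` C)" for x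
      proof (rule bdd_belowI2)
        fix q assume "q \<in> C"
        then have "sublinear q" "q (- x) \<le> p (- x)" using CA A_def by auto
        then show "- p (- x) \<le> q x" using sublinear_lower[of q x] by linarith
      qed
      let ?u = "\<lambda>x. INF q\<in>C. q x"
      have "sublinear ?u"
      proof (rule sublinear_Inf[OF False _ _ bdd])
        show "sublinear q" if "q \<in> C" for q using that CA A_def by auto
        show "\<exists>r\<in>C. \<forall>x. r x \<le> q x \<and> r x \<le> q' x" if "q \<in> C" "q' \<in> C" for q q'
          using ch[OF that] that unfolding le_def by blast
      qed
      moreover have low: "?u x \<le> q x" if "q \<in> C" for q x by (rule cINF_lower[OF bdd that])
      moreover have "?u x \<le> p x" for x
      proof -
        obtain q where "q \<in> C" using False by blast
        then show ?thesis using low[of q x] CA A_def by (force intro: order_trans)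
      qed
      ultimately have "?u \<in> A" "\<forall>a\<in>C. le a ?u" unfolding A_def le_def by auto
      then show ?thesis by blast
    qed
  qed
  then obtain u where u: "sublinear u" "\<And>x. u x \<le> p x"
    and min: "\<And>q. sublinear q \<Longrightarrow> (\<And>x. q x \<le> u x) \<Longrightarrow> q = u"
  proof -
    assume m: "\<exists>m\<in>A. \<forall>a\<in>A. le m a \<longrightarrow> a = m"
      and *: "\<And>u. \<lbrakk>sublinear u; \<And>x. u x \<le> p x; \<And>q. \<lbrakk>sublinear q; \<And>x. q x \<le> u x\<rbrakk> \<Longrightarrow> q = u\<rbrakk> \<Longrightarrow> thesis"
    obtain m where m: "m \<in> A" "\<And>a. a \<in> A \<Longrightarrow> le m a \<Longrightarrow> a = m" using m by blast
    show thesis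
    proof (rule *[of m])
      show "sublinear m" "m x \<le> p x" for x using m(1) by (auto simp: A_def)
      fix q assume "sublinear q" "\<And>x. q x \<le> m x"
      then show "q = m" using m(1) by (intro m(2)) (auto simp: A_def le_def intro: order_trans)
    qed
  qed
  have odd: "u (- a) = - u a" for a
  proof -
    obtain q where "sublinear q" "\<forall>x. q x \<le> u x" "q (- a) \<le> - u a"
      using sublinear_refine[OF u(1)] by blast
    then have "u (- a) \<le> - u a" using min[of q] by auto
    then show ?thesis using sublinear_lower[OF u(1), of a] by simp
  qed
  have "linear u"
  proof (rule linearI)
    fix x y
    have "u x \<le> u (x + y) + u (- y)" using sublinearD(1)[OF u(1), of "x + y" "- y"] by simp
    then show "u (x + y) = u x + u y" using sublinearD(1)[OF u(1), of x y] odd by simp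
  next
    fix r :: real and x
    consider "r > 0" | "r = 0" | "r < 0" by linarith
    then show "u (r *\<^sub>R x) = r *\<^sub>R u x"
    proof cases
      case 3
      then show ?thesis using sublinearD(2)[OF u(1), of "- r" x] odd[of "r *\<^sub>R x"] by simp
    qed (use sublinearD(2)[OF u(1)] sublinear_zero[OF u(1)] in auto)
  qed
  then show ?thesis using u(2) by blast
qed

text \<open>Refining the norm at \<open>x\<close> before the linear minorant is taken forces
  equality at \<open>x\<close>, so no functional has to be extended from a subspace.\<close>

lemma hahn_banach_norm:
  fixes x :: "'a::real_normed_vector"
  shows "\<exists>u. linear u \<and> (\<forall>y. u y \<le> norm y) \<and> u x = norm x"
proof -
  have "sublinear (norm :: 'a \<Rightarrow> real)" by (auto simp: sublinear_def norm_triangle_ineq)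
  then obtain p where p: "sublinear p" "\<forall>y. p y \<le> norm y" "p (- x) \<le> - norm x"
    using sublinear_refine by blast
  obtain u where u: "linear u" "\<forall>y. u y \<le> p y" using hahn_banach_sublinear[OF p(1)] by blast
  have "- u x \<le> - norm x" using u p(3) linear_neg[OF u(1), of x] by (smt (verit))
  then show ?thesis using u p(2) by (metis antisym neg_le_iff_le order_trans)
qed

section \<open>Complex scalars, the dual unit ball and the duality map\<close>

lemma scaleC_zero_right [simp]: "c *\<^sub>C (0::'a::complex_banach) = 0"
  by (metis norm_eq_zero norm_scaleC mult_zero_right norm_zero)

lemma scaleC_zero_left [simp]: "0 *\<^sub>C (x::'a::complex_banach) = 0"
  by (metis norm_eq_zero norm_scaleC mult_zero_left norm_zero)

lemma scaleC_minus_right: "c *\<^sub>C (- x) = - (c *\<^sub>C (x::'a::complex_banach))"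
  by (metis add.right_inverse minus_unique scaleC_add_right scaleC_zero_right)

lemma scaleC_diff_right: "c *\<^sub>C (x - y) = c *\<^sub>C x - c *\<^sub>C (y::'a::complex_banach)"
  by (metis diff_conv_add_uminus scaleC_add_right scaleC_minus_right)

lemma scaleC_scaleR: "c *\<^sub>C (r *\<^sub>R x) = r *\<^sub>R (c *\<^sub>C (x::'a::complex_banach))"
  by (simp add: scaleR_scaleC scaleC_scaleC mult.commute)

lemma bounded_clinear_imp_linear: "bounded_clinear f \<Longrightarrow> bounded_linear f"
  by (simp add: bounded_clinear_def)

lemma bounded_clinear_scaleC_eq: "bounded_clinear f \<Longrightarrow> f (c *\<^sub>C x) = c *\<^sub>C f x"
  by (simp add: bounded_clinear_def)

lemma functional_scaleC:
  fixes \<phi> :: "'a::complex_banach \<Rightarrow> complex"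
  shows "bounded_clinear \<phi> \<Longrightarrow> \<phi> (c *\<^sub>C x) = c * \<phi> x"
  by (simp add: bounded_clinear_def scaleC_complex_def)

text \<open>The bound is stated pointwise rather than through \<open>onorm\<close>, which is the
  form every estimate consumes; \<open>duality_map_unit_sphere\<close> reconciles the two.\<close>

definition dual_ball :: "('a::complex_banach \<Rightarrow> complex) set"
  where "dual_ball = {\<phi>. bounded_clinear \<phi> \<and> (\<forall>y. cmod (\<phi> y) \<le> norm y)}"

lemma dual_ball_clinear: "\<phi> \<in> dual_ball \<Longrightarrow> bounded_clinear \<phi>"
  and dual_ball_linear: "\<phi> \<in> dual_ball \<Longrightarrow> bounded_linear \<phi>"
  and dual_ball_norm: "\<phi> \<in> dual_ball \<Longrightarrow> cmod (\<phi> y) \<le> norm y"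
  by (auto simp: dual_ball_def bounded_clinear_def)

text \<open>If \<open>\<phi>\<close> norms \<open>u\<close> and \<open>e\<close> is unimodular, then
  \<open>cnj e\<close> times \<open>\<phi>\<close> norms the rotated vector. This carries bounds at
  real radii over to whole circles.\<close>

lemma dual_ball_rotate:
  assumes "\<phi> \<in> dual_ball" "cmod c \<le> 1"
  shows "(\<lambda>y. c * \<phi> y) \<in> dual_ball"
proof -
  have "bounded_linear (\<lambda>y. c * \<phi> y)"
    by (intro bounded_linear_const_mult dual_ball_linear assms)
  moreover have "cmod c * cmod (\<phi> y) \<le> norm y" for y
    using mult_mono[OF assms(2) dual_ball_norm[OF assms(1)]] by simp
  ultimately show ?thesis using assms
    by (auto simp: dual_ball_def bounded_clinear_def scaleC_complex_def norm_mult)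
qed

lemma exists_norming_functional:
  fixes x :: "'a::complex_banach"
  shows "\<exists>\<phi>\<in>dual_ball. \<phi> x = complex_of_real (norm x)"
proof -
  obtain u where u: "linear u" "\<And>y. u y \<le> norm y" "u x = norm x"
    using hahn_banach_norm[of x] by blast
  \<comment> \<open>A complex-linear functional is determined by its real part: the imaginary part
    at \<open>y\<close> is minus the real part at \<open>\<i> y\<close>.\<close>
  define \<phi> where "\<phi> y = Complex (u y) (- u (\<i> *\<^sub>C y))" for y
  have lin: "linear \<phi>"
    by (rule linearI)
      (auto simp: \<phi>_def complex_eq_iff linear_add[OF u(1)] linear_scale[OF u(1)]
        scaleC_add_right scaleC_scaleR)
  have "(- 1) *\<^sub>C y = - y" for y :: 'a
    using scaleR_scaleC[of "-1" y] by simp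
  then have phi_i: "\<phi> (\<i> *\<^sub>C y) = \<i> * \<phi> y" for y
    by (simp add: \<phi>_def complex_eq_iff scaleC_scaleC linear_neg[OF u(1)])
  have phi_c: "\<phi> (c *\<^sub>C y) = c * \<phi> y" for c y
  proof -
    have "c *\<^sub>C y = Re c *\<^sub>R y + Im c *\<^sub>R (\<i> *\<^sub>C y)"
      by (simp add: scaleR_scaleC scaleC_scaleC scaleC_add_left[symmetric] complex_eq_iff
          complex_eq[of c, symmetric] mult.commute)
    then have "\<phi> (c *\<^sub>C y) = Re c *\<^sub>R \<phi> y + Im c *\<^sub>R (\<i> * \<phi> y)"
      by (simp add: linear_add[OF lin] linear_scale[OF lin] phi_i)
    also have "\<dots> = c * \<phi> y" by (simp add: complex_eq_iff)
    finally show ?thesis .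
  qed
  have bound: "cmod (\<phi> y) \<le> norm y" for y
  proof (cases "\<phi> y = 0")
    case False
    \<comment> \<open>Rotating \<open>y\<close> makes the value of \<open>\<phi>\<close> real and
      nonnegative, where it coincides with \<open>u\<close> and inherits its bound.\<close>
    define c where "c = cnj (\<phi> y) / cmod (\<phi> y)"
    have c: "cmod c = 1" using False by (simp add: c_def norm_divide)
    have "\<phi> (c *\<^sub>C y) = cmod (\<phi> y)"
      using False unfolding phi_c c_def
      by (simp add: complex_norm_square[symmetric] power2_eq_square divide_simps mult.commute)
    then have "cmod (\<phi> y) = u (c *\<^sub>C y)"
      by (metis Re_complex_of_real \<phi>_def complex.sel(1))
    then show ?thesis using u(2)[of "c *\<^sub>C y"] c by (simp add: norm_scaleC)
  qed simp
  have "bounded_linear \<phi>"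
    using bound lin by (intro bounded_linear_intro[where K=1])
      (auto simp: linear_add linear_scale)
  then have "\<phi> \<in> dual_ball" using bound phi_c
    by (simp add: dual_ball_def bounded_clinear_def scaleC_complex_def)
  moreover have "\<phi> x = complex_of_real (norm x)"
  proof -
    have "Re (\<phi> x) = norm x" using u(3) by (simp add: \<phi>_def)
    \<comment> \<open>The real part already exhausts the permitted modulus, so nothing is left for
      the imaginary part.\<close>
    moreover have "(Im (\<phi> x))\<^sup>2 \<le> 0"
      using bound[of x] calculation power_mono[OF bound[of x], of 2]
      by (simp add: cmod_power2)
    ultimately show ?thesis by (simp add: complex_eq_iff)
  qed
  ultimately show ?thesis by blast
qed

text \<open>Testing with functionals reduces vector-valued estimates to one-variable complex
  analysis.\<close>

lemma norm_le_dual_ball: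
  fixes x :: "'a::complex_banach"
  assumes "\<And>\<phi>. \<phi> \<in> dual_ball \<Longrightarrow> cmod (\<phi> x) \<le> K"
  shows "norm x \<le> K"
proof -
  obtain \<phi> where "\<phi> \<in> dual_ball" "\<phi> x = complex_of_real (norm x)"
    using exists_norming_functional by blast
  then show ?thesis using assms[of \<phi>] by simp
qed

text \<open>The duality map is homogeneous under positive scaling. Hence every condition can be
  phrased with a unit vector and a norming functional in \<open>dual_ball\<close>, the radius
  entering only as a factor.\<close>

lemma duality_map_unit_sphere:
  fixes x :: "'a::complex_banach"
  assumes x: "norm x = 1" and r: "r > 0"
  shows "\<phi> \<in> duality_map (r *\<^sub>R x) \<longleftrightarrow> (\<exists>\<psi>\<in>dual_ball. \<psi> x = 1 \<and> \<phi> = (\<lambda>y. r *\<^sub>R \<psi> y))"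
proof
  have nr: "norm (r *\<^sub>R x) = r" using x r by simp
  assume "\<phi> \<in> duality_map (r *\<^sub>R x)"
  then have cl: "bounded_clinear \<phi>" and val: "complex_of_real (r\<^sup>2) = \<phi> (r *\<^sub>R x)"
    and on: "r\<^sup>2 = (onorm \<phi>)\<^sup>2"
    using x r unfolding duality_map_def mem_Collect_eq nr by blast+
  have bl: "bounded_linear \<phi>" using cl by (rule bounded_clinear_imp_linear)
  have "onorm \<phi> = r" using on onorm_pos_le[OF bl] r by (simp add: power2_eq_iff_nonneg)
  then have bd: "cmod (\<phi> y) \<le> r * norm y" for y using onorm[OF bl, of y] by simp
  define \<psi> where "\<psi> y = (1 / r) *\<^sub>R \<phi> y" for y
  have "bounded_linear \<psi>" unfolding \<psi>_def by (intro bounded_linear_scaleR_right[THEN bounded_linear_compose] bl)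
  then have "\<psi> \<in> dual_ball"
    using bd r functional_scaleC[OF cl]
    by (auto simp: dual_ball_def bounded_clinear_def \<psi>_def scaleC_complex_def field_simps)
  moreover have "\<psi> x = 1"
  proof -
    have "\<phi> (r *\<^sub>R x) = r *\<^sub>R \<phi> x" using bl by (simp add: linear_simps)
    then have "complex_of_real r * complex_of_real r = of_real r * \<phi> x" using val
      by (simp add: power2_eq_square scaleR_conv_of_real)
    then have "\<phi> x = complex_of_real r" using r by simp
    then show ?thesis using r by (simp add: \<psi>_def scaleR_conv_of_real)
  qed
  moreover have "\<phi> = (\<lambda>y. r *\<^sub>R \<psi> y)" using r by (simp add: \<psi>_def)
  ultimately show "\<exists>\<psi>\<in>dual_ball. \<psi> x = 1 \<and> \<phi> = (\<lambda>y. r *\<^sub>R \<psi> y)" by blast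
next
  assume "\<exists>\<psi>\<in>dual_ball. \<psi> x = 1 \<and> \<phi> = (\<lambda>y. r *\<^sub>R \<psi> y)"
  then obtain \<psi> where \<psi>: "\<psi> \<in> dual_ball" "\<psi> x = 1" and \<phi>: "\<phi> = (\<lambda>y. r *\<^sub>R \<psi> y)" by blast
  note bl = dual_ball_linear[OF \<psi>(1)]
  have "onorm \<psi> \<le> 1" using dual_ball_norm[OF \<psi>(1)] by (intro onorm_bound) auto
  moreover have "1 \<le> onorm \<psi>" using onorm[OF bl, of x] \<psi>(2) x by simp
  ultimately have "onorm \<psi> = 1" by simp
  then have "onorm \<phi> = r" unfolding \<phi> using r onorm_scaleR[OF bl] by simp
  moreover have "bounded_linear \<phi>" unfolding \<phi>
    by (intro bounded_linear_scaleR_right[THEN bounded_linear_compose] bl)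
  moreover have "\<phi> (c *\<^sub>C y) = c *\<^sub>C \<phi> y" for c y
    unfolding \<phi> by (simp add: functional_scaleC[OF dual_ball_clinear[OF \<psi>(1)]] scaleC_complex_def)
  moreover have "\<phi> (r *\<^sub>R x) = complex_of_real (r\<^sup>2)"
    unfolding \<phi> using \<psi>(2) bl by (simp add: linear_simps scaleR_conv_of_real power2_eq_square)
  ultimately show "\<phi> \<in> duality_map (r *\<^sub>R x)"
    using x r by (auto simp: duality_map_def bounded_clinear_def)
qed

subsection \<open>Holomorphic maps between complex Banach spaces\<close>

lemma bounded_clinear_compose:
  assumes "bounded_clinear f" "bounded_clinear g"
  shows "bounded_clinear (\<lambda>x. g (f x))"
  using assms bounded_linear_compose[of g f] by (auto simp: bounded_clinear_def)

lemma bounded_clinear_add: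
  assumes "bounded_clinear f" "bounded_clinear g"
  shows "bounded_clinear (\<lambda>x. f x + g x)"
  using assms by (auto simp: bounded_clinear_def scaleC_add_right intro: bounded_linear_add)

lemma bounded_clinear_ident: "bounded_clinear (\<lambda>x. x)"
  by (auto simp: bounded_clinear_def)

lemma bounded_clinear_zero: "bounded_clinear (\<lambda>x. 0)"
  by (auto simp: bounded_clinear_def)

lemma bounded_clinear_scaleC_right: "bounded_clinear (\<lambda>x. c *\<^sub>C x)"
proof -
  have "bounded_linear (\<lambda>x. c *\<^sub>C x)"
    by (rule bounded_linear_intro[where K="cmod c"])
      (auto simp: scaleC_add_right scaleC_scaleR norm_scaleC)
  then show ?thesis by (simp add: bounded_clinear_def scaleC_scaleC mult.commute)
qed

lemma bounded_clinear_scaleR: "bounded_clinear (\<lambda>x. r *\<^sub>R x)"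
  unfolding scaleR_scaleC by (rule bounded_clinear_scaleC_right)

lemma bounded_clinear_scaleC_left: "bounded_clinear (\<lambda>c. c *\<^sub>C x)"
proof -
  have "bounded_linear (\<lambda>c. c *\<^sub>C x)"
    by (rule bounded_linear_intro[where K="norm x"])
      (auto simp: scaleC_add_left scaleR_conv_of_real scaleC_scaleC[symmetric]
        scaleR_scaleC norm_scaleC)
  then show ?thesis by (simp add: bounded_clinear_def scaleC_scaleC scaleC_complex_def)
qed

lemma cfrechet_differentiableE:
  assumes "cfrechet_differentiable_at f x"
  obtains D where "bounded_clinear D" "(f has_derivative D) (at x)"
  using assms unfolding cfrechet_differentiable_at_def by blast

lemma cfrechet_differentiableI:
  "(f has_derivative D) (at x) \<Longrightarrow> bounded_clinear D \<Longrightarrow> cfrechet_differentiable_at f x"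
  unfolding cfrechet_differentiable_at_def by blast

lemma cfrechet_differentiable_bounded_clinear:
  "bounded_clinear f \<Longrightarrow> cfrechet_differentiable_at f x"
  unfolding cfrechet_differentiable_at_def
  by (meson bounded_clinear_imp_linear bounded_linear_imp_has_derivative)

lemma cfrechet_differentiable_const: "cfrechet_differentiable_at (\<lambda>x. c) x"
  unfolding cfrechet_differentiable_at_def
  by (rule exI[of _ "\<lambda>x. 0"]) (simp add: bounded_clinear_zero)

lemma cfrechet_differentiable_add:
  assumes "cfrechet_differentiable_at f x" "cfrechet_differentiable_at g x"
  shows "cfrechet_differentiable_at (\<lambda>x. f x + g x) x"
  using assms
  by (elim cfrechet_differentiableE)
    (rule cfrechet_differentiableI[OF has_derivative_add bounded_clinear_add])

lemma cfrechet_differentiable_compose: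
  assumes "cfrechet_differentiable_at f x" "cfrechet_differentiable_at g (f x)"
  shows "cfrechet_differentiable_at (\<lambda>x. g (f x)) x"
  using assms
  by (elim cfrechet_differentiableE)
    (rule cfrechet_differentiableI[OF has_derivative_compose bounded_clinear_compose])

lemma cfrechet_differentiable_scaleC:
  "cfrechet_differentiable_at f x \<Longrightarrow> cfrechet_differentiable_at (\<lambda>x. c *\<^sub>C f x) x"
  by (rule cfrechet_differentiable_compose)
    (auto intro: cfrechet_differentiable_bounded_clinear bounded_clinear_scaleC_right)

lemma cfrechet_differentiable_scaleR:
  "cfrechet_differentiable_at f x \<Longrightarrow> cfrechet_differentiable_at (\<lambda>x. r *\<^sub>R f x) x"
  unfolding scaleR_scaleC by (rule cfrechet_differentiable_scaleC)

lemma cfrechet_differentiable_diff: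
  assumes "cfrechet_differentiable_at f x" "cfrechet_differentiable_at g x"
  shows "cfrechet_differentiable_at (\<lambda>x. f x - g x) x"
  using cfrechet_differentiable_add[OF assms(1) cfrechet_differentiable_scaleR[OF assms(2), of "-1"]]
  by simp

lemma cfrechet_differentiable_ident: "cfrechet_differentiable_at (\<lambda>x. x) x"
  by (intro cfrechet_differentiable_bounded_clinear bounded_clinear_ident)

lemma cfrechet_differentiable_sum:
  assumes "\<And>i. i \<in> I \<Longrightarrow> cfrechet_differentiable_at (f i) x"
  shows "cfrechet_differentiable_at (\<lambda>x. \<Sum>i\<in>I. f i x) x"
  using assms
  by (induction I rule: infinite_finite_induct)
    (auto intro: cfrechet_differentiable_const cfrechet_differentiable_add)

lemmas cfrechet_differentiable_intros =
  cfrechet_differentiable_const cfrechet_differentiable_ident cfrechet_differentiable_add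
  cfrechet_differentiable_diff cfrechet_differentiable_scaleR cfrechet_differentiable_scaleC
  cfrechet_differentiable_sum

lemma cfrechet_differentiable_imp_isCont:
  "cfrechet_differentiable_at f x \<Longrightarrow> isCont f x"
  by (meson cfrechet_differentiableE has_derivative_continuous)

lemma cfrechet_differentiable_cong:
  assumes "cfrechet_differentiable_at f x" "open U" "x \<in> U" "\<And>y. y \<in> U \<Longrightarrow> f y = g y"
  shows "cfrechet_differentiable_at g x"
  using assms unfolding cfrechet_differentiable_at_def
  by (meson has_derivative_transform_within_open)

lemma HolD: "f \<in> Hol V W \<Longrightarrow> x \<in> V \<Longrightarrow> cfrechet_differentiable_at f x"
  by (simp add: Hol_def)

lemma Hol_mem: "f \<in> Hol V W \<Longrightarrow> x \<in> V \<Longrightarrow> f x \<in> W"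
  by (auto simp: Hol_def)

lemma HolI:
  "(\<And>x. x \<in> V \<Longrightarrow> cfrechet_differentiable_at f x) \<Longrightarrow> (\<And>x. x \<in> V \<Longrightarrow> f x \<in> W) \<Longrightarrow> f \<in> Hol V W"
  by (auto simp: Hol_def)

lemma Hol_compose:
  assumes f: "f \<in> Hol U V" and g: "g \<in> Hol V W"
  shows "(\<lambda>x. g (f x)) \<in> Hol U W"
proof (rule HolI)
  fix x assume x: "x \<in> U"
  show "cfrechet_differentiable_at (\<lambda>x. g (f x)) x"
    by (rule cfrechet_differentiable_compose[OF HolD[OF f x] HolD[OF g Hol_mem[OF f x]]])
  show "g (f x) \<in> W" by (rule Hol_mem[OF g Hol_mem[OF f x]])
qed

lemma has_field_derivative_along_line:
  assumes f: "(f has_derivative D) (at (a + \<zeta> *\<^sub>C v))" "bounded_clinear D"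
    and \<phi>: "bounded_clinear \<phi>"
  shows "((\<lambda>\<zeta>. \<phi> (f (a + \<zeta> *\<^sub>C v))) has_field_derivative \<phi> (D v)) (at \<zeta>)"
proof -
  have "((\<lambda>\<zeta>. a + \<zeta> *\<^sub>C v) has_derivative (\<lambda>\<eta>. \<eta> *\<^sub>C v)) (at \<zeta>)"
    using has_derivative_add[OF has_derivative_const bounded_linear_imp_has_derivative
        [OF bounded_clinear_imp_linear[OF bounded_clinear_scaleC_left[of v]]]]
    by simp
  then have "((\<lambda>\<zeta>. f (a + \<zeta> *\<^sub>C v)) has_derivative (\<lambda>\<eta>. D (\<eta> *\<^sub>C v))) (at \<zeta>)"
    using f(1) by (rule has_derivative_compose)
  then have "((\<lambda>\<zeta>. \<phi> (f (a + \<zeta> *\<^sub>C v))) has_derivative (\<lambda>\<eta>. \<phi> (D (\<eta> *\<^sub>C v)))) (at \<zeta>)"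
    by (rule bounded_linear.has_derivative[OF bounded_clinear_imp_linear[OF \<phi>]])
  moreover have "(\<lambda>\<eta>. \<phi> (D (\<eta> *\<^sub>C v))) = (*) (\<phi> (D v))"
    using f(2) functional_scaleC[OF \<phi>] by (auto simp: bounded_clinear_def mult.commute)
  ultimately show ?thesis by (simp add: has_field_derivative_def)
qed

lemma holomorphic_along_line:
  assumes f: "\<And>\<zeta>. \<zeta> \<in> S \<Longrightarrow> cfrechet_differentiable_at f (a + \<zeta> *\<^sub>C v)"
    and \<phi>: "bounded_clinear \<phi>"
  shows "(\<lambda>\<zeta>. \<phi> (f (a + \<zeta> *\<^sub>C v))) holomorphic_on S"
  unfolding holomorphic_on_def field_differentiable_def
proof
  fix \<zeta> assume "\<zeta> \<in> S"
  then obtain D where "(f has_derivative D) (at (a + \<zeta> *\<^sub>C v))" "bounded_clinear D"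
    using f cfrechet_differentiableE by blast
  then show "\<exists>f'. ((\<lambda>\<zeta>. \<phi> (f (a + \<zeta> *\<^sub>C v))) has_field_derivative f') (at \<zeta> within S)"
    using has_field_derivative_at_within[OF has_field_derivative_along_line[OF _ _ \<phi>]] by blast
qed

lemma holomorphic_along_ray:
  assumes "\<And>\<zeta>. \<zeta> \<in> S \<Longrightarrow> cfrechet_differentiable_at f (\<zeta> *\<^sub>C v)" "bounded_clinear \<phi>"
  shows "(\<lambda>\<zeta>. \<phi> (f (\<zeta> *\<^sub>C v))) holomorphic_on S"
  using holomorphic_along_line[of S f 0 v \<phi>] assms by simp

text \<open>After composition with a functional and restriction to the line through \<open>a\<close>
  in direction \<open>v\<close>, this is Cauchy's inequality for the first derivative in one
  variable.\<close>

lemma Cauchy_estimate: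
  fixes f :: "'a::complex_banach \<Rightarrow> 'b::complex_banach"
  assumes f: "\<And>x. x \<in> ball a r \<Longrightarrow> cfrechet_differentiable_at f x"
    and M: "\<And>x. x \<in> ball a r \<Longrightarrow> norm (f x) \<le> M"
    and D: "(f has_derivative D) (at a)" "bounded_clinear D" and r: "r > 0"
  shows "norm (D v) \<le> M / r * norm v"
proof (cases "v = 0")
  case True
  then show ?thesis using D(1) by (simp add: has_derivative_bounded_linear linear_simps)
next
  case False
  have M0: "M \<ge> 0" using M[of a] r by (auto intro: order_trans[OF norm_ge_zero])
  show ?thesis
  proof (rule norm_le_dual_ball)
    fix \<phi> :: "'b \<Rightarrow> complex" assume \<phi>: "\<phi> \<in> dual_ball"
    define g where "g \<zeta> = \<phi> (f (a + \<zeta> *\<^sub>C v))" for \<zeta>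
    have bound: "cmod (\<phi> (D v)) * \<rho> \<le> M" if \<rho>: "0 < \<rho>" "\<rho> < r / norm v" for \<rho>
    proof -
      have in_ball: "a + \<zeta> *\<^sub>C v \<in> ball a r" if "\<zeta> \<in> cball 0 \<rho>" for \<zeta>
      proof -
        have "norm (\<zeta> *\<^sub>C v) \<le> \<rho> * norm v" using that by (simp add: norm_scaleC mult_right_mono)
        also have "\<dots> < r" using \<rho> False by (simp add: field_simps)
        finally show ?thesis by (simp add: dist_norm)
      qed
      have hol: "g holomorphic_on cball 0 \<rho>"
        unfolding g_def using in_ball f dual_ball_clinear[OF \<phi>] by (intro holomorphic_along_line) auto
      have "(g has_field_derivative \<phi> (D v)) (at 0)"
        unfolding g_def using D dual_ball_clinear[OF \<phi>] by (intro has_field_derivative_along_line) auto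
      then have "deriv g 0 = \<phi> (D v)" by (rule DERIV_imp_deriv)
      moreover have "cmod ((deriv ^^ 1) g 0) \<le> fact 1 * M / \<rho> ^ 1"
      proof (rule Cauchy_inequality)
        show "g holomorphic_on ball 0 \<rho>" using hol by (rule holomorphic_on_subset) auto
        show "continuous_on (cball 0 \<rho>) g" using hol by (rule holomorphic_on_imp_continuous_on)
        show "norm (g x) \<le> M" if "norm (0 - x) = \<rho>" for x
          unfolding g_def using that in_ball[of x] M dual_ball_norm[OF \<phi>]
          by (metis mem_cball_0 norm_minus_cancel diff_0 order_refl order_trans)
      qed (use \<rho> in auto)
      ultimately show ?thesis using \<rho> by (simp add: field_simps)
    qed
    \<comment> \<open>The circle of radius \<open>r / norm v\<close> itself may leave the open ball,
      so the bound is obtained by letting \<open>\<rho>\<close> increase to it.\<close>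
    have "cmod (\<phi> (D v)) * (r / norm v) \<le> M"
    proof (rule tendsto_upperbound)
      show "((\<lambda>\<rho>. cmod (\<phi> (D v)) * \<rho>) \<longlongrightarrow> cmod (\<phi> (D v)) * (r / norm v)) (at_left (r / norm v))"
        by (intro tendsto_intros)
      have "r / norm v > 0" using r False by simp
      then show "\<forall>\<^sub>F \<rho> in at_left (r / norm v). cmod (\<phi> (D v)) * \<rho> \<le> M"
        using bound by (auto simp: eventually_at_left[of 0])
    qed simp
    then show "cmod (\<phi> (D v)) \<le> M / r * norm v" using r False by (simp add: field_simps)
  qed
qed

text \<open>The Cauchy estimate on balls of the fixed radius \<open>r\<close> bounds the derivative
  on \<open>S\<close>, and the mean value inequality on the convex set turns this into a Lipschitz
  bound.\<close>

lemma holomorphic_bounded_imp_lipschitz: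
  fixes f :: "'a::complex_banach \<Rightarrow> 'b::complex_banach"
  assumes f: "\<And>x. x \<in> U \<Longrightarrow> cfrechet_differentiable_at f x"
    and M: "\<And>x. x \<in> U \<Longrightarrow> norm (f x) \<le> M"
    and S: "convex S" "\<And>x. x \<in> S \<Longrightarrow> ball x r \<subseteq> U" and r: "r > 0"
    and xy: "x \<in> S" "y \<in> S"
  shows "norm (f x - f y) \<le> M / r * norm (x - y)"
proof -
  have SU: "x \<in> U" if "x \<in> S" for x using S(2)[OF that] r by auto
  then have "\<forall>x\<in>S. \<exists>D. bounded_clinear D \<and> (f has_derivative D) (at x)"
    using f unfolding cfrechet_differentiable_at_def by blast
  then obtain D where D: "\<And>x. x \<in> S \<Longrightarrow> bounded_clinear (D x)"
    "\<And>x. x \<in> S \<Longrightarrow> (f has_derivative D x) (at x)" by metis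
  show ?thesis
  proof (rule differentiable_bound[OF S(1) _ _ xy])
    fix z assume z: "z \<in> S"
    show "(f has_derivative D z) (at z within S)"
      by (rule has_derivative_at_withinI[OF D(2)[OF z]])
    have "norm (D z v) \<le> M / r * norm v" for v
      by (rule Cauchy_estimate[OF _ _ D(2)[OF z] D(1)[OF z] r]) (use f M S(2)[OF z] in auto)
    moreover have "M \<ge> 0" using M[OF SU[OF z]] norm_ge_zero order_trans by blast
    ultimately show "onorm (D z) \<le> M / r" using r by (intro onorm_bound) auto
  qed
qed

lemma holomorphic_ball_lipschitz:
  fixes f :: "'a::complex_banach \<Rightarrow> 'b::complex_banach"
  assumes f: "\<And>x. x \<in> ball 0 R \<Longrightarrow> cfrechet_differentiable_at f x"
    and M: "\<And>x. x \<in> ball 0 R \<Longrightarrow> norm (f x) \<le> M"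
    and s: "s < R" and xy: "x \<in> cball 0 s" "y \<in> cball 0 s"
  shows "norm (f x - f y) \<le> M / (R - s) * norm (x - y)"
proof (rule holomorphic_bounded_imp_lipschitz[OF f M])
  fix z :: 'a assume "z \<in> cball 0 s"
  then show "ball z (R - s) \<subseteq> ball 0 R"
    by (auto simp: dist_norm) (smt (verit) norm_minus_commute norm_triangle_ineq4 norm_triangle_sub)
qed (use s xy in auto)

text \<open>Weierstrass' theorem. The Cauchy estimate applied to differences makes the derivatives
  uniformly Cauchy near \<open>a\<close>, so that the limit may be differentiated termwise.\<close>

lemma holomorphic_uniform_limit:
  fixes f :: "nat \<Rightarrow> 'a::complex_banach \<Rightarrow> 'b::complex_banach"
  assumes U: "open U" and f: "\<And>n x. x \<in> U \<Longrightarrow> cfrechet_differentiable_at (f n) x"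
    and lim: "uniform_limit U f g sequentially" and a: "a \<in> U"
  shows "cfrechet_differentiable_at g a"
proof -
  obtain r' where r': "r' > 0" "ball a r' \<subseteq> U" using U a open_contains_ball by blast
  \<comment> \<open>Half the radius, so that every point of \<open>S\<close> keeps a ball of radius
    \<open>r\<close> inside \<open>U\<close> and one Cauchy constant serves all of them.\<close>
  define r where "r = r' / 2"
  have r: "r > 0" using r' by (simp add: r_def)
  define S where "S = ball a r"
  have sub: "ball x r \<subseteq> U" if "x \<in> S" for x
  proof -
    have "ball x r \<subseteq> ball a r'" using that
      by (auto simp: S_def r_def dist_norm) (smt (verit) dist_norm dist_triangle field_sum_of_halves)
    then show ?thesis using r' by blast
  qed
  have SU: "S \<subseteq> U" using sub r by fastforce
  have "\<forall>n. \<forall>x\<in>S. \<exists>D. bounded_clinear D \<and> (f n has_derivative D) (at x)"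
    using f SU unfolding cfrechet_differentiable_at_def by blast
  then obtain D where D: "\<And>n x. x \<in> S \<Longrightarrow> bounded_clinear (D n x)"
    "\<And>n x. x \<in> S \<Longrightarrow> (f n has_derivative D n x) (at x)" by metis
  have close: "\<exists>N. \<forall>m\<ge>N. \<forall>n\<ge>N. \<forall>x\<in>S. \<forall>v. norm (D m x v - D n x v) \<le> e * norm v"
    if e: "e > 0" for e
  proof -
    have "e * r / 2 > 0" using e r by simp
    then obtain N where N: "\<And>n x. n \<ge> N \<Longrightarrow> x \<in> U \<Longrightarrow> dist (f n x) (g x) < e * r / 2"
      using lim unfolding uniform_limit_iff eventually_sequentially by meson
    show ?thesis
    proof (intro exI[of _ N] allI ballI impI)
      fix m n x v assume mn: "m \<ge> N" "n \<ge> N" and x: "x \<in> S"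
      have "norm (D m x v - D n x v) \<le> (e * r) / r * norm v"
      proof (rule Cauchy_estimate[where f="\<lambda>x. f m x - f n x" and a=x])
        show "norm (f m y - f n y) \<le> e * r" if "y \<in> ball x r" for y
        proof -
          have "y \<in> U" using sub[OF x] that by blast
          then have "dist (f m y) (f n y) < e * r" 
            using N[OF mn(1), of y] N[OF mn(2), of y] dist_triangle2[of "f m y" "f n y" "g y"] by linarith
          then show ?thesis by (simp add: dist_norm)
        qed
        show "((\<lambda>x. f m x - f n x) has_derivative (\<lambda>v. D m x v - D n x v)) (at x)"
          using D(2)[OF x] by (intro has_derivative_diff)
        show "bounded_clinear (\<lambda>v. D m x v - D n x v)"
          using D(1)[OF x] by (auto simp: bounded_clinear_def scaleC_diff_right intro: bounded_linear_sub)
      qed (use sub[OF x] f r in \<open>auto intro!: cfrechet_differentiable_diff\<close>)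
      then show "norm (D m x v - D n x v) \<le> e * norm v" using r by simp
    qed
  qed
  have conv: "convergent (\<lambda>n. D n x v)" if x: "x \<in> S" for x v
    unfolding Cauchy_convergent_iff[symmetric] Cauchy_iff
  proof (intro allI impI)
    fix e :: real assume e: "e > 0"
    have "e / (norm v + 1) > 0" using e by (simp add: add_nonneg_pos)
    then obtain N where "\<forall>m\<ge>N. \<forall>n\<ge>N. norm (D m x v - D n x v) \<le> e / (norm v + 1) * norm v"
      using close x by meson
    moreover have "e / (norm v + 1) * norm v < e"
      using e by (simp add: divide_less_eq add_nonneg_pos)
    ultimately show "\<exists>M. \<forall>m\<ge>M. \<forall>n\<ge>M. norm (D m x v - D n x v) < e"
      by (meson le_less_trans)
  qed
  define D' where "D' x v = lim (\<lambda>n. D n x v)" for x v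
  have D': "(\<lambda>n. D n x v) \<longlonglongrightarrow> D' x v" if "x \<in> S" for x v
    unfolding D'_def using conv[OF that] by (simp add: convergent_LIMSEQ_iff)
  have nle: "\<forall>\<^sub>F n in sequentially. \<forall>x\<in>S. \<forall>v. norm (D n x v - D' x v) \<le> e * norm v"
    if e: "e > 0" for e
  proof -
    obtain N where N: "\<forall>m\<ge>N. \<forall>n\<ge>N. \<forall>x\<in>S. \<forall>v. norm (D m x v - D n x v) \<le> e * norm v"
      using close[OF e] by blast
    have "norm (D n x v - D' x v) \<le> e * norm v" if n: "n \<ge> N" and x: "x \<in> S" for n x v
    proof (rule tendsto_upperbound)
      show "(\<lambda>m. norm (D n x v - D m x v)) \<longlonglongrightarrow> norm (D n x v - D' x v)"
        by (intro tendsto_intros D' x)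
      show "\<forall>\<^sub>F m in sequentially. norm (D n x v - D m x v) \<le> e * norm v"
        unfolding eventually_sequentially using N n x by blast
    qed simp
    then show ?thesis unfolding eventually_sequentially by blast
  qed
  have lim_pt: "(\<lambda>n. f n x) \<longlonglongrightarrow> g x" if "x \<in> S" for x
    using tendsto_uniform_limitI[OF lim] that SU by blast
  have aS: "a \<in> S" using r by (simp add: S_def)
  have "\<exists>g'. \<forall>x\<in>S. (\<lambda>n. f n x) \<longlonglongrightarrow> g' x \<and> (g' has_derivative D' x) (at x within S)"
    by (rule has_derivative_sequence[OF _ has_derivative_at_withinI[OF D(2)] nle aS lim_pt[OF aS]])
      (auto simp: S_def)
  then obtain g' where g': "\<And>x. x \<in> S \<Longrightarrow> (\<lambda>n. f n x) \<longlonglongrightarrow> g' x"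
    "\<And>x. x \<in> S \<Longrightarrow> (g' has_derivative D' x) (at x within S)" by blast
  have "g' x = g x" if "x \<in> S" for x using LIMSEQ_unique[OF g'(1) lim_pt] that by blast
  then have "(g has_derivative D' a) (at a within S)"
    using g'(2)[OF aS] aS by (metis has_derivative_transform)
  then have der: "(g has_derivative D' a) (at a)"
    using aS by (simp add: S_def at_within_open[of a "ball a r"])
  have "D' a (c *\<^sub>C v) = c *\<^sub>C D' a v" for c v
  proof (rule LIMSEQ_unique[OF D'[OF aS]])
    show "(\<lambda>n. D n a (c *\<^sub>C v)) \<longlonglongrightarrow> c *\<^sub>C D' a v"
      unfolding bounded_clinear_scaleC_eq[OF D(1)[OF aS]]
      by (rule bounded_linear.tendsto[OF bounded_clinear_imp_linear[OF bounded_clinear_scaleC_right] D'[OF aS]])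
  qed
  then have "bounded_clinear (D' a)"
    using has_derivative_bounded_linear[OF der] by (simp add: bounded_clinear_def)
  then show ?thesis by (rule cfrechet_differentiableI[OF der])
qed

subsection \<open>The Earle--Hamilton theorem on a ball\<close>

lemma funpow_closed: "(\<And>x. x \<in> S \<Longrightarrow> f x \<in> S) \<Longrightarrow> p \<in> S \<Longrightarrow> (f ^^ n) p \<in> S"
  by (induction n) auto

text \<open>The map \<open>f x + k (f x - f q)\<close> still maps the ball into itself and multiplies the derivative
  at \<open>q\<close> by \<open>1 + k\<close>; composing such maps along an orbit and applying the Cauchy estimate shows that
  the derivatives of the iterates of \<open>f\<close> decay like \<open>(1 + k)\<^sup>-\<^sup>n\<close>.\<close>

lemma inflated_iterate:
  fixes f :: "'a::complex_banach \<Rightarrow> 'a"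
  assumes f: "f \<in> Hol (ball 0 s) (cball 0 \<theta>)" and \<theta>: "0 \<le> \<theta>" "\<theta> < s"
    and k: "k = (s - \<theta>) / (2 * s)" and p: "p \<in> ball 0 s"
  shows "\<exists>g D. g \<in> Hol (ball 0 s) (ball 0 s) \<and> bounded_clinear D
    \<and> ((f ^^ n) has_derivative D) (at p) \<and> g p = (f ^^ n) p
    \<and> (g has_derivative (\<lambda>v. (1 + k) ^ n *\<^sub>R D v)) (at p)"
proof (induction n)
  case 0
  have "(\<lambda>x. x) \<in> Hol (ball 0 s) (ball (0::'a) s)"
    by (intro HolI cfrechet_differentiable_ident)
  moreover have "((\<lambda>x. x) has_derivative (\<lambda>v. v)) (at p)" by (rule has_derivative_ident)
  ultimately show ?case using bounded_clinear_ident
    by (intro exI[of _ "\<lambda>x. x"]) (auto simp: id_def)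
next
  case (Suc n)
  then obtain g D where g: "g \<in> Hol (ball 0 s) (ball 0 s)" "g p = (f ^^ n) p"
    and D: "bounded_clinear D" "((f ^^ n) has_derivative D) (at p)"
    and gD: "(g has_derivative (\<lambda>v. (1 + k) ^ n *\<^sub>R D v)) (at p)" by blast
  have f_in: "f x \<in> ball 0 s" if "x \<in> ball 0 s" for x
    using Hol_mem[OF f that] \<theta> by auto
  define q where "q = (f ^^ n) p"
  have q: "q \<in> ball 0 s" unfolding q_def using f_in p by (rule funpow_closed)
  obtain E where E: "bounded_clinear E" "(f has_derivative E) (at q)"
    using HolD[OF f q] by (rule cfrechet_differentiableE)
  define F where "F x = f x + k *\<^sub>R (f x - f q)" for x
  have k0: "k \<ge> 0" using \<theta> k by simp
  \<comment> \<open>This inequality dictates \<open>k\<close>: both \<open>f x\<close> and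
    \<open>f q\<close> have norm at most \<open>\<theta>\<close>, so the left side bounds the norm
    of \<open>F x\<close>.\<close>
  have "\<theta> + k * (2 * \<theta>) < s"
  proof -
    have "k * (2 * \<theta>) = (s - \<theta>) * (\<theta> / s)" using k by simp
    also have "\<dots> < (s - \<theta>) * 1" using \<theta> by (intro mult_strict_left_mono) auto
    finally show ?thesis by simp
  qed
  have "F \<in> Hol (ball 0 s) (ball 0 s)"
  proof (rule HolI)
    fix x :: 'a assume x: "x \<in> ball 0 s"
    show "cfrechet_differentiable_at F x"
      unfolding F_def by (intro cfrechet_differentiable_intros HolD[OF f x])
    have "norm (F x) \<le> norm (f x) + k * norm (f x - f q)"
      unfolding F_def using norm_triangle_ineq[of "f x" "k *\<^sub>R (f x - f q)"] k0 by simp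
    also have "\<dots> \<le> \<theta> + k * (2 * \<theta>)"
      using Hol_mem[OF f x] Hol_mem[OF f q] norm_triangle_ineq4[of "f x" "f q"] k0
      by (intro add_mono mult_left_mono) auto
    finally show "F x \<in> ball 0 s" using \<open>\<theta> + k * (2 * \<theta>) < s\<close> by simp
  qed
  then have "(\<lambda>x. F (g x)) \<in> Hol (ball 0 s) (ball 0 s)" by (rule Hol_compose[OF g(1)])
  moreover have "bounded_clinear (\<lambda>v. E (D v))" by (rule bounded_clinear_compose[OF D(1) E(1)])
  moreover have "((\<lambda>x. f ((f ^^ n) x)) has_derivative (\<lambda>v. E (D v))) (at p)"
    using D(2) E(2) unfolding q_def by (rule has_derivative_compose)
  then have "((f ^^ Suc n) has_derivative (\<lambda>v. E (D v))) (at p)"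
    by (simp add: o_def)
  moreover have "F (g p) = (f ^^ Suc n) p" by (simp add: F_def g(2) q_def)
  moreover have "((\<lambda>x. F (g x)) has_derivative (\<lambda>v. (1 + k) ^ Suc n *\<^sub>R E (D v))) (at p)"
  proof -
    have "(F has_derivative (\<lambda>v. E v + k *\<^sub>R (E v - 0))) (at q)"
      unfolding F_def by (intro derivative_intros E(2))
    then have FE: "(F has_derivative (\<lambda>v. (1 + k) *\<^sub>R E v)) (at (g p))"
      by (simp add: scaleR_add_left g(2) q_def)
    have "((\<lambda>x. F (g x)) has_derivative (\<lambda>v. (1 + k) *\<^sub>R E ((1 + k) ^ n *\<^sub>R D v))) (at p)"
      using gD FE by (rule has_derivative_compose)
    then show ?thesis
      using bounded_clinear_imp_linear[OF E(1)] by (simp add: linear_simps)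
  qed
  ultimately show ?case by blast
qed

text \<open>The inflated iterate stays in \<open>ball 0 s\<close>, so on balls of radius
  \<open>s - m\<close> Cauchy's estimate bounds its derivative by \<open>s / (s - m)\<close>. That
  derivative is \<open>(1 + k) ^ n\<close> times the derivative of the n-th iterate of
  \<open>f\<close>.\<close>

lemma Earle_Hamilton_contraction:
  fixes f :: "'a::complex_banach \<Rightarrow> 'a"
  assumes f: "f \<in> Hol (ball 0 s) (cball 0 \<theta>)" and \<theta>: "0 \<le> \<theta>" "\<theta> < s"
    and k: "k = (s - \<theta>) / (2 * s)" and m: "m < s" and pq: "p \<in> cball 0 m" "q \<in> cball 0 m"
  shows "norm ((f ^^ n) p - (f ^^ n) q) \<le> s / (s - m) / (1 + k) ^ n * norm (p - q)"
proof -
  have k0: "1 + k > 0" using \<theta> k by (simp add: add_pos_nonneg)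
  have sub: "cball 0 m \<subseteq> ball (0::'a) s" using m by auto
  have "\<forall>x\<in>cball 0 m. \<exists>g D. g \<in> Hol (ball 0 s) (ball 0 s) \<and> bounded_clinear D
    \<and> ((f ^^ n) has_derivative D) (at x) \<and> (g has_derivative (\<lambda>v. (1 + k) ^ n *\<^sub>R D v)) (at x)"
    using inflated_iterate[OF f \<theta> k] sub by (meson subsetD)
  then obtain g D where g: "\<And>x. x \<in> cball 0 m \<Longrightarrow> g x \<in> Hol (ball 0 s) (ball 0 s)"
    and D: "\<And>x. x \<in> cball 0 m \<Longrightarrow> bounded_clinear (D x)"
      "\<And>x. x \<in> cball 0 m \<Longrightarrow> ((f ^^ n) has_derivative D x) (at x)"
    and gD: "\<And>x. x \<in> cball 0 m \<Longrightarrow> (g x has_derivative (\<lambda>v. (1 + k) ^ n *\<^sub>R D x v)) (at x)"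
    by metis
  show ?thesis
  proof (rule differentiable_bound[OF _ _ _ pq])
    fix x :: 'a assume x: "x \<in> cball 0 m"
    show "((f ^^ n) has_derivative D x) (at x within cball 0 m)"
      by (rule has_derivative_at_withinI[OF D(2)[OF x]])
    have ball: "ball x (s - m) \<subseteq> ball 0 s" using x
      by (auto simp: dist_norm) (smt (verit) norm_minus_commute norm_triangle_sub)
    have "norm ((1 + k) ^ n *\<^sub>R D x v) \<le> s / (s - m) * norm v" for v
    proof (rule Cauchy_estimate[OF _ _ gD[OF x]])
      show "cfrechet_differentiable_at (g x) y" "norm (g x y) \<le> s" if "y \<in> ball x (s - m)" for y
        using HolD[OF g[OF x]] Hol_mem[OF g[OF x]] that ball by (auto simp: less_imp_le subset_iff)
      show "bounded_clinear (\<lambda>v. (1 + k) ^ n *\<^sub>R D x v)"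
        by (rule bounded_clinear_compose[OF D(1)[OF x] bounded_clinear_scaleR])
    qed (use m in auto)
    then have "(1 + k) ^ n * norm (D x v) \<le> s / (s - m) * norm v" for v
      using k0 by simp
    then have "norm (D x v) \<le> (s / (s - m) * norm v) / (1 + k) ^ n" for v
      using k0 by (simp only: pos_le_divide_eq[OF zero_less_power[OF k0]] mult.commute)
    then have "norm (D x v) \<le> s / (s - m) / (1 + k) ^ n * norm v" for v
      by simp
    then show "onorm (D x) \<le> s / (s - m) / (1 + k) ^ n"
      using m k0 \<theta> by (intro onorm_bound) auto
  qed simp
qed

text \<open>The factor \<open>s / (s - \<theta>)\<close> may spoil contractivity of early iterates,
  so Banach's theorem is applied to a high iterate \<open>N\<close> on
  \<open>cball 0 \<theta>\<close>.\<close>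

lemma Earle_Hamilton:
  fixes f :: "'a::complex_banach \<Rightarrow> 'a"
  assumes f: "f \<in> Hol (ball 0 s) (cball 0 \<theta>)" and \<theta>: "0 \<le> \<theta>" "\<theta> < s"
  shows "\<exists>!y. y \<in> ball 0 s \<and> f y = y"
proof -
  define k where "k = (s - \<theta>) / (2 * s)"
  note contr = Earle_Hamilton_contraction[OF f \<theta> k_def]
  have k0: "1 + k > 1" using \<theta> by (simp add: k_def)
  have null: "(\<lambda>n. C / (1 + k) ^ n) \<longlonglongrightarrow> 0" for C
    using k0 LIMSEQ_divide_realpow_zero by blast
  have sub: "cball 0 \<theta> \<subseteq> ball (0::'a) s" using \<theta> by auto
  have "\<forall>\<^sub>F n in sequentially. s / (s - \<theta>) / (1 + k) ^ n < 1"
    by (rule order_tendstoD(2)[OF null]) simp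
  then obtain N where N: "s / (s - \<theta>) / (1 + k) ^ N < 1" by (meson eventually_sequentially order_refl)
  have maps: "(f ^^ n) x \<in> cball 0 \<theta>" if "x \<in> cball 0 \<theta>" for n x
    using that Hol_mem[OF f] sub by (intro funpow_closed) auto
  have "\<exists>!y\<in>cball 0 \<theta>. (f ^^ N) y = y"
  proof (rule Banach_fix[OF _ _ _ N])
    show "complete (cball (0::'a) \<theta>)" by (simp add: complete_eq_closed)
    show "cball (0::'a) \<theta> \<noteq> {}" using \<theta> by auto
    show "(f ^^ N) ` cball 0 \<theta> \<subseteq> cball 0 \<theta>" using maps by blast
    show "0 \<le> s / (s - \<theta>) / (1 + k) ^ N" using \<theta> k0 by simp
  qed (use contr[OF \<theta>(2)] in \<open>auto simp: dist_norm\<close>)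
  then obtain y where y: "y \<in> cball 0 \<theta>" "(f ^^ N) y = y"
    and uniq: "\<And>z. z \<in> cball 0 \<theta> \<Longrightarrow> (f ^^ N) z = z \<Longrightarrow> z = y" by blast
  \<comment> \<open>The point \<open>f y\<close> is again fixed by the \<open>N\<close>-th iterate,
    so uniqueness makes \<open>y\<close> a fixed point of \<open>f\<close> itself.\<close>
  have "(f ^^ N) (f y) = f y" using y(2) funpow_swap1[of f N y] by simp
  moreover have "f y \<in> cball 0 \<theta>" using maps[of y 1] y(1) by simp
  ultimately have "f y = y" by (rule uniq[rotated])
  \<comment> \<open>Two fixed points of \<open>f\<close> are fixed by all iterates, whose
    contraction constants tend to 0.\<close>
  moreover have "z = w" if "z \<in> ball 0 s" "f z = z" "w \<in> ball 0 s" "f w = w" for z w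
  proof -
    have fp: "(f ^^ n) z = z" "(f ^^ n) w = w" for n
      using that by (induction n) auto
    define m where "m = max (norm z) (norm w)"
    have "norm (z - w) \<le> s / (s - m) * norm (z - w) / (1 + k) ^ n" for n
      using contr[of m z w n] that unfolding fp by (auto simp: m_def)
    then have "norm (z - w) \<le> 0"
      by (intro LIMSEQ_le_const[OF null[of "s / (s - m) * norm (z - w)"]]) auto
    then show ?thesis by simp
  qed
  ultimately show ?thesis using y(1) sub by blast
qed

subsection \<open>Inverting a map that points inwards on a sphere\<close>

text \<open>A map \<open>F\<close> that points inwards on a sphere has a resolvent \<open>(I - \<alpha> F)\<^sup>-\<^sup>1\<close> for small \<open>\<alpha>\<close>,
  obtained by Picard iteration, and the resolvent maps the ball strictly into itself.\<close>

lemma inward_resolvent: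
  fixes F :: "'a::complex_banach \<Rightarrow> 'a"
  assumes F: "\<And>x. x \<in> ball 0 R \<Longrightarrow> cfrechet_differentiable_at F x"
    and M: "\<And>x. x \<in> ball 0 R \<Longrightarrow> norm (F x) \<le> M"
    and s: "0 < s" "s < R" and c: "c > 0"
    and inward: "\<And>u \<phi>. norm u = 1 \<Longrightarrow> \<phi> \<in> dual_ball \<Longrightarrow> \<phi> u = 1 \<Longrightarrow> Re (\<phi> (F (s *\<^sub>R u))) \<le> - c"
  shows "\<exists>\<alpha> S. \<alpha> > 0 \<and> S \<in> Hol (ball 0 (s + \<alpha> * c)) (ball 0 s)
    \<and> (\<forall>v\<in>ball 0 (s + \<alpha> * c). norm (S v) \<le> max 0 (s - (s + \<alpha> * c - norm v) / 2)
      \<and> (\<forall>w\<in>ball 0 s. w - \<alpha> *\<^sub>R F w = v \<longleftrightarrow> w = S v))"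
proof -
  have M0: "M \<ge> 0" using M[of 0] s by (auto intro: order_trans[OF norm_ge_zero])
  \<comment> \<open>Picard iteration runs on \<open>cball 0 s'\<close>: the gap to \<open>R\<close>
    provides a Lipschitz constant, the gap to \<open>s\<close> leaves room for right-hand sides
    \<open>v\<close> of norm slightly above \<open>s\<close>.\<close>
  define s' where "s' = (s + R) / 2"
  have s': "s < s'" "s' < R" using s by (auto simp: s'_def)
  define L where "L = M / (R - s')"
  have L0: "L \<ge> 0" using M0 s' by (simp add: L_def)
  have lip: "norm (F x - F y) \<le> L * norm (x - y)" if "x \<in> cball 0 s'" "y \<in> cball 0 s'" for x y
    unfolding L_def by (rule holomorphic_ball_lipschitz[OF F M s'(2) that])
  \<comment> \<open>The first bound makes \<open>T v\<close> a contraction with factor 1/2, the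
    second keeps its values in \<open>cball 0 s'\<close>.\<close>
  define \<alpha> where "\<alpha> = min (1 / (2 * (L + 1))) ((s' - s) / (c + M))"
  have \<alpha>: "\<alpha> > 0" using L0 M0 c s' by (simp add: \<alpha>_def add_nonneg_pos add_pos_nonneg)
  have "\<alpha> \<le> 1 / (2 * (L + 1))" by (simp add: \<alpha>_def)
  then have "\<alpha> * (2 * (L + 1)) \<le> 1" using L0 by (simp add: pos_le_divide_eq)
  then have \<alpha>L: "\<alpha> * L \<le> 1 / 2" using \<alpha> by (simp add: algebra_simps)
  have "\<alpha> \<le> (s' - s) / (c + M)" by (simp add: \<alpha>_def)
  then have \<alpha>M: "s + \<alpha> * c + \<alpha> * M \<le> s'" using c M0 by (simp add: pos_le_divide_eq algebra_simps)
  define V where "V = ball (0::'a) (s + \<alpha> * c)"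
  have V: "norm v < s + \<alpha> * c" if "v \<in> V" for v using that by (simp add: V_def)
  define T where "T v w = v + \<alpha> *\<^sub>R F w" for v w
  have T_in: "T v w \<in> cball 0 s'" if "v \<in> V" "w \<in> cball 0 s'" for v w
  proof -
    have "norm (T v w) \<le> norm v + \<alpha> * norm (F w)"
      unfolding T_def using norm_triangle_ineq[of v "\<alpha> *\<^sub>R F w"] \<alpha> by simp
    also have "\<dots> \<le> s + \<alpha> * c + \<alpha> * M"
      using V[OF that(1)] M[of w] that(2) s' \<alpha> by (intro add_mono mult_left_mono) auto
    finally show ?thesis using \<alpha>M by simp
  qed
  have T_lip: "dist (T v w) (T v w') \<le> 1 / 2 * dist w w'" if "w \<in> cball 0 s'" "w' \<in> cball 0 s'" for v w w'
  proof -
    have "dist (T v w) (T v w') = \<alpha> * norm (F w - F w')"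
      using \<alpha> by (simp add: T_def dist_norm scaleR_diff_right[symmetric])
    also have "\<dots> \<le> \<alpha> * (L * norm (w - w'))" using lip[OF that] \<alpha> by simp
    also have "\<dots> \<le> 1 / 2 * norm (w - w')" using mult_right_mono[OF \<alpha>L, of "norm (w - w')"] by simp
    finally show ?thesis by (simp add: dist_norm)
  qed
  have "\<exists>!w\<in>cball 0 s'. T v w = w" if v: "v \<in> V" for v
  proof (rule Banach_fix[where c="1/2"])
    show "complete (cball (0::'a) s')" by (simp add: complete_eq_closed)
    show "T v ` cball 0 s' \<subseteq> cball 0 s'" using T_in[OF v] by blast
  qed (use s s' T_lip in auto)
  then have "\<forall>v\<in>V. \<exists>w\<in>cball 0 s'. T v w = w \<and> (\<forall>w'\<in>cball 0 s'. T v w' = w' \<longrightarrow> w' = w)" by (metis (full_types))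
  then obtain S where S: "\<And>v. v \<in> V \<Longrightarrow> S v \<in> cball 0 s'" "\<And>v. v \<in> V \<Longrightarrow> T v (S v) = S v"
    and uniq: "\<And>v w. v \<in> V \<Longrightarrow> w \<in> cball 0 s' \<Longrightarrow> T v w = w \<Longrightarrow> w = S v" by metis
  \<comment> \<open>A functional norming \<open>w\<close> is applied to
    \<open>v = w - \<alpha> F w\<close>. The inward condition, known only at norm \<open>s\<close>,
    is moved radially to \<open>w\<close> at a cost of at most half the distance, since
    \<open>\<alpha> * L \<le> 1 / 2\<close>. The maximum with 0 only accommodates
    \<open>w = 0\<close>.\<close>
  have small: "norm w \<le> max 0 (s - (s + \<alpha> * c - norm v) / 2)"
    if w: "w \<in> cball 0 s'" and v: "v \<in> V" and eq: "T v w = w" for v w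
  proof (cases "w = 0")
    case False
    define u where "u = (1 / norm w) *\<^sub>R w"
    have u: "norm u = 1" "w = norm w *\<^sub>R u" using False by (auto simp: u_def)
    obtain \<phi> where \<phi>: "\<phi> \<in> dual_ball" "\<phi> u = 1" using exists_norming_functional[of u] u(1) by auto
    note bl = dual_ball_linear[OF \<phi>(1)]
    have "\<phi> w = norm w" using u(2) \<phi>(2) bl
      by (metis linear_scale bounded_linear.linear scaleR_conv_of_real mult.right_neutral)
    moreover have "v = w - \<alpha> *\<^sub>R F w" using eq by (simp add: T_def algebra_simps)
    ultimately have "\<phi> v = norm w - \<alpha> *\<^sub>R \<phi> (F w)" using bl by (simp add: linear_simps)
    then have 1: "Re (\<phi> v) = norm w - \<alpha> * Re (\<phi> (F w))" by simp
    have "Re (\<phi> (F w)) - Re (\<phi> (F (s *\<^sub>R u))) \<le> cmod (\<phi> (F w - F (s *\<^sub>R u)))"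
      using complex_Re_le_cmod[of "\<phi> (F w - F (s *\<^sub>R u))"] bl by (simp add: linear_simps)
    also have "\<dots> \<le> norm (F w - F (s *\<^sub>R u))" by (rule dual_ball_norm[OF \<phi>(1)])
    also have "\<dots> \<le> L * norm (w - s *\<^sub>R u)" using w u s s' by (intro lip) auto
    also have "w - s *\<^sub>R u = (norm w - s) *\<^sub>R u" using u(2) by (simp add: scaleR_diff_left)
    also have "norm \<dots> = \<bar>norm w - s\<bar>" using u(1) by simp
    finally have "Re (\<phi> (F w)) \<le> - c + L * \<bar>norm w - s\<bar>" using inward[OF u(1) \<phi>] by simp
    then have "\<alpha> * Re (\<phi> (F w)) \<le> \<alpha> * (- c + L * \<bar>norm w - s\<bar>)" using \<alpha> by simp
    also have "\<dots> = - (\<alpha> * c) + (\<alpha> * L) * \<bar>norm w - s\<bar>" by (simp add: algebra_simps)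
    also have "\<dots> \<le> - (\<alpha> * c) + 1 / 2 * \<bar>norm w - s\<bar>"
      using mult_right_mono[OF \<alpha>L, of "\<bar>norm w - s\<bar>"] by simp
    finally have "norm w + \<alpha> * c - 1 / 2 * \<bar>norm w - s\<bar> \<le> Re (\<phi> v)" using 1 by simp
    also have "\<dots> \<le> norm v" using complex_Re_le_cmod dual_ball_norm[OF \<phi>(1)] order_trans by blast
    finally have "norm w + \<alpha> * c - 1 / 2 * \<bar>norm w - s\<bar> \<le> norm v" .
    \<comment> \<open>If \<open>norm w \<ge> s\<close>, the preceding inequality would give
      \<open>s + \<alpha> * c \<le> norm v\<close>, which is excluded on \<open>V\<close>. So the
      absolute value equals \<open>s - norm w\<close>.\<close>
    then have "norm w \<le> s - (s + \<alpha> * c - norm v) / 2"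
      using V[OF v] by (auto simp: abs_if field_simps split: if_splits)
    then show ?thesis by simp
  qed simp
  have S_small: "norm (S v) \<le> max 0 (s - (s + \<alpha> * c - norm v) / 2)" if "v \<in> V" for v
    by (rule small[OF S(1)[OF that] that S(2)[OF that]])
  have S_in: "S v \<in> ball 0 s" if "v \<in> V" for v
  proof -
    have "max 0 (s - (s + \<alpha> * c - norm v) / 2) < s" using V[OF that] s by simp
    then have "norm (S v) < s" by (rule le_less_trans[OF S_small[OF that]])
    then show ?thesis by simp
  qed
  have iter_in: "(T v ^^ n) 0 \<in> cball 0 s'" if "v \<in> V" for v n
    using T_in[OF that] s s' by (intro funpow_closed) auto
  \<comment> \<open>Holomorphy of \<open>S\<close> comes from its Picard iterates, which are
    holomorphic in \<open>v\<close> and converge geometrically, uniformly on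
    \<open>V\<close>.\<close>
  have "cfrechet_differentiable_at (\<lambda>v. (T v ^^ n) 0) v" if v: "v \<in> V" for v n
  proof (induction n)
    case 0
    then show ?case by (simp add: cfrechet_differentiable_const)
  next
    case (Suc n)
    have "(T v ^^ n) 0 \<in> ball 0 R" using iter_in[OF v, of n] s' by simp
    then have "cfrechet_differentiable_at (\<lambda>v. F ((T v ^^ n) 0)) v"
      by (intro cfrechet_differentiable_compose[OF Suc] F)
    then show ?case
      unfolding funpow.simps o_def T_def by (intro cfrechet_differentiable_intros)
  qed
  moreover have "uniform_limit V (\<lambda>n v. (T v ^^ n) 0) S sequentially"
    unfolding uniform_limit_iff
  proof (intro allI impI)
    fix e :: real assume e: "e > 0"
    have est: "dist ((T v ^^ n) 0) (S v) \<le> (1 / 2) ^ n * s'" if v: "v \<in> V" for v n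
    proof (induction n)
      case 0
      then show ?case using S(1)[OF v] by simp
    next
      case (Suc n)
      have "dist ((T v ^^ Suc n) 0) (S v) = dist (T v ((T v ^^ n) 0)) (T v (S v))"
        using S(2)[OF v] by simp
      also have "\<dots> \<le> 1 / 2 * dist ((T v ^^ n) 0) (S v)" by (rule T_lip[OF iter_in[OF v] S(1)[OF v]])
      finally show ?case using Suc by simp
    qed
    have "(\<lambda>n. (1 / 2) ^ n * s') \<longlonglongrightarrow> 0" by (intro tendsto_mult_left_zero LIMSEQ_realpow_zero) auto
    then have "\<forall>\<^sub>F n in sequentially. (1 / 2) ^ n * s' < e" using e by (rule order_tendstoD(2))
    then show "\<forall>\<^sub>F n in sequentially. \<forall>v\<in>V. dist ((T v ^^ n) 0) (S v) < e"
      by eventually_elim (use est in \<open>blast intro: le_less_trans\<close>)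
  qed
  moreover have "open V" by (simp add: V_def)
  ultimately have "cfrechet_differentiable_at S v" if "v \<in> V" for v
    using holomorphic_uniform_limit[of V "\<lambda>n v. (T v ^^ n) 0" S v] that by blast
  then have "S \<in> Hol V (ball 0 s)" using S_in by (intro HolI)
  moreover have "w - \<alpha> *\<^sub>R F w = v \<longleftrightarrow> w = S v" if "v \<in> V" "w \<in> ball 0 s" for v w
    using uniq[of v w] S(2)[of v] that s' by (auto simp: T_def algebra_simps)
  ultimately show ?thesis using \<alpha> S_small unfolding V_def by blast
qed

text \<open>The equation \<open>F y = z\<close> says that \<open>y - \<alpha> F y\<close> equals
  \<open>y - \<alpha> z\<close>, that is, \<open>y = S (y - \<alpha> z)\<close>. For
  \<open>norm z < c\<close> the right side stays strictly inside \<open>ball 0 s\<close>, so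
  Earle--Hamilton applies. It serves both the homogeneous polynomials and the Abel equation.\<close>

proposition inward_inverse:
  fixes F :: "'a::complex_banach \<Rightarrow> 'a"
  assumes F: "\<And>x. x \<in> ball 0 R \<Longrightarrow> cfrechet_differentiable_at F x"
    and M: "\<And>x. x \<in> ball 0 R \<Longrightarrow> norm (F x) \<le> M"
    and s: "0 < s" "s < R" and c: "c > 0"
    and inward: "\<And>u \<phi>. norm u = 1 \<Longrightarrow> \<phi> \<in> dual_ball \<Longrightarrow> \<phi> u = 1 \<Longrightarrow> Re (\<phi> (F (s *\<^sub>R u))) \<le> - c"
  shows "\<exists>Y. Y \<in> Hol (ball 0 c) (ball 0 s) \<and> (\<forall>z\<in>ball 0 c. \<forall>y\<in>ball 0 s. F y = z \<longleftrightarrow> y = Y z)"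
proof -
  have "\<exists>\<alpha> S. \<alpha> > 0 \<and> S \<in> Hol (ball 0 (s + \<alpha> * c)) (ball 0 s)
    \<and> (\<forall>v\<in>ball 0 (s + \<alpha> * c). norm (S v) \<le> max 0 (s - (s + \<alpha> * c - norm v) / 2)
      \<and> (\<forall>w\<in>ball 0 s. w - \<alpha> *\<^sub>R F w = v \<longleftrightarrow> w = S v))"
    by (rule inward_resolvent; fact)
  then obtain \<alpha> S where \<alpha>: "\<alpha> > 0" and S: "S \<in> Hol (ball 0 (s + \<alpha> * c)) (ball 0 s)"
    and S_small: "\<And>v. v \<in> ball 0 (s + \<alpha> * c) \<Longrightarrow> norm (S v) \<le> max 0 (s - (s + \<alpha> * c - norm v) / 2)"
    and S_iff: "\<And>v w. v \<in> ball 0 (s + \<alpha> * c) \<Longrightarrow> w \<in> ball 0 s \<Longrightarrow> w - \<alpha> *\<^sub>R F w = v \<longleftrightarrow> w = S v"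
    by blast
  define f where "f z x = S (x - \<alpha> *\<^sub>R z)" for z x
  have shift_le: "norm (x - \<alpha> *\<^sub>R z) < s + \<alpha> * c'" if "x \<in> ball 0 s" "norm z \<le> c'" for x z :: 'a and c'
  proof -
    have "norm (x - \<alpha> *\<^sub>R z) \<le> norm x + \<alpha> * norm z" using norm_triangle_ineq4[of x "\<alpha> *\<^sub>R z"] \<alpha> by simp
    also have "\<dots> < s + \<alpha> * c'" using that \<alpha> by (intro add_less_le_mono mult_left_mono) auto
    finally show ?thesis .
  qed
  have shift: "x - \<alpha> *\<^sub>R z \<in> ball 0 (s + \<alpha> * c)" if "x \<in> ball 0 s" "z \<in> ball 0 c" for x z :: 'a
    using shift_le[OF that(1), of z c] that by simp
  \<comment> \<open>The radius of the image depends on \<open>z\<close> only through the bound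
    \<open>c'\<close> of its norm; this uniformity yields holomorphy in \<open>z\<close>
    below.\<close>
  have f_Hol: "f z \<in> Hol (ball 0 s) (cball 0 (max 0 (s - \<alpha> * (c - c') / 2)))"
    if z: "z \<in> ball 0 c" "norm z \<le> c'" for z c'
  proof (rule HolI)
    fix x :: 'a assume x: "x \<in> ball 0 s"
    show "cfrechet_differentiable_at (f z) x"
      unfolding f_def
      by (rule cfrechet_differentiable_compose[of "\<lambda>x. x - \<alpha> *\<^sub>R z", OF _ HolD[OF S shift[OF x z(1)]]])
        (intro cfrechet_differentiable_intros)
    have "norm (f z x) \<le> max 0 (s - (s + \<alpha> * c - norm (x - \<alpha> *\<^sub>R z)) / 2)"
      unfolding f_def by (rule S_small[OF shift[OF x z(1)]])
    also have "\<dots> \<le> max 0 (s - \<alpha> * (c - c') / 2)"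
    proof (rule max.mono[OF order_refl])
      have "s - (s + a - n) / 2 \<le> s - (a - b) / 2" if "n < s + b" for a b n :: real
        using that by (simp add: field_simps)
      from this[OF shift_le[OF x z(2)], of "\<alpha> * c"]
      show "s - (s + \<alpha> * c - norm (x - \<alpha> *\<^sub>R z)) / 2 \<le> s - \<alpha> * (c - c') / 2"
        by (simp only: right_diff_distrib)
    qed
    finally show "f z x \<in> cball 0 (max 0 (s - \<alpha> * (c - c') / 2))" by simp
  qed
  have \<theta>: "0 \<le> max 0 (s - \<alpha> * (c - c') / 2)" "max 0 (s - \<alpha> * (c - c') / 2) < s" if "c' < c" for c'
    using that \<alpha> s by auto
  have "\<exists>!y. y \<in> ball 0 s \<and> f z y = y" if z: "z \<in> ball 0 c" for z
    using z by (intro Earle_Hamilton[OF f_Hol[OF z order_refl]] \<theta>) auto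
  then obtain Y where Y: "\<And>z. z \<in> ball 0 c \<Longrightarrow> Y z \<in> ball 0 s" "\<And>z. z \<in> ball 0 c \<Longrightarrow> f z (Y z) = Y z"
    and uniq: "\<And>z y. z \<in> ball 0 c \<Longrightarrow> y \<in> ball 0 s \<Longrightarrow> f z y = y \<Longrightarrow> y = Y z" by metis
  have Y_iff: "F y = z \<longleftrightarrow> y = Y z" if "z \<in> ball 0 c" "y \<in> ball 0 s" for y z
  proof -
    have "F y = z \<longleftrightarrow> y - \<alpha> *\<^sub>R F y = y - \<alpha> *\<^sub>R z" using \<alpha> by simp
    also have "\<dots> \<longleftrightarrow> y = f z y" unfolding f_def by (rule S_iff[OF shift[OF that(2,1)] that(2)])
    also have "\<dots> \<longleftrightarrow> y = Y z" using uniq[OF that] Y(2)[OF that(1)] by metis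
    finally show ?thesis .
  qed
  have "cfrechet_differentiable_at Y z0" if z0: "z0 \<in> ball 0 c" for z0
  proof -
    \<comment> \<open>On \<open>ball 0 c'\<close> all maps \<open>f z\<close> share the radius
      \<open>\<theta>'\<close> and thus one contraction rate, so their iterates at 0 converge
      uniformly to \<open>Y\<close>.\<close>
    obtain c' where c': "norm z0 < c'" "c' < c" using dense[of "norm z0" c] z0 by auto
    define \<theta>' where "\<theta>' = max 0 (s - \<alpha> * (c - c') / 2)"
    have \<theta>': "0 \<le> \<theta>'" "\<theta>' < s" using \<theta>[OF c'(2)] by (auto simp: \<theta>'_def)
    define k where "k = (s - \<theta>') / (2 * s)"
    have k0: "1 + k > 1" using \<theta>' by (simp add: k_def)
    have U: "z \<in> ball 0 c" if "z \<in> ball 0 c'" for z :: 'a using that c' by auto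
    have fH: "f z \<in> Hol (ball 0 s) (cball 0 \<theta>')" if "z \<in> ball 0 c'" for z
      using f_Hol[OF U[OF that], of c'] that by (simp add: \<theta>'_def)
    have iter_in: "(f z ^^ n) 0 \<in> ball 0 s" if "z \<in> ball 0 c'" for z n
      using Hol_mem[OF fH[OF that]] \<theta>' s by (intro funpow_closed) force+
    show ?thesis
    proof (rule holomorphic_uniform_limit[of "ball 0 c'" "\<lambda>n z. (f z ^^ n) 0"])
      show "cfrechet_differentiable_at (\<lambda>z. (f z ^^ n) 0) z" if z: "z \<in> ball 0 c'" for n z
      proof (induction n)
        case 0
        then show ?case by (simp add: cfrechet_differentiable_const)
      next
        case (Suc n)
        have "cfrechet_differentiable_at (\<lambda>z. (f z ^^ n) 0 - \<alpha> *\<^sub>R z) z"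
          by (intro cfrechet_differentiable_intros Suc)
        then have "cfrechet_differentiable_at (\<lambda>z. S ((f z ^^ n) 0 - \<alpha> *\<^sub>R z)) z"
          by (rule cfrechet_differentiable_compose[of "\<lambda>z. (f z ^^ n) 0 - \<alpha> *\<^sub>R z",
                OF _ HolD[OF S shift[OF iter_in[OF z] U[OF z]]]])
        moreover have "(f w ^^ Suc n) 0 = S ((f w ^^ n) 0 - \<alpha> *\<^sub>R w)" for w
          using f_def[of w "(f w ^^ n) 0"] by simp
        ultimately show ?case by simp
      qed
      show "uniform_limit (ball 0 c') (\<lambda>n z. (f z ^^ n) 0) Y sequentially"
        unfolding uniform_limit_iff
      proof (intro allI impI)
        fix e :: real assume e: "e > 0"
        have est: "dist ((f z ^^ n) 0) (Y z) \<le> s / (s - \<theta>') * \<theta>' / (1 + k) ^ n" if z: "z \<in> ball 0 c'" for z n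
        proof -
          have fp: "(f z ^^ n) (Y z) = Y z" using Y(2)[OF U[OF z]] by (induction n) auto
          have Y\<theta>: "Y z \<in> cball 0 \<theta>'" using Hol_mem[OF fH[OF z] Y(1)[OF U[OF z]]] Y(2)[OF U[OF z]] by simp
          have "norm ((f z ^^ n) 0 - (f z ^^ n) (Y z)) \<le> s / (s - \<theta>') / (1 + k) ^ n * norm (0 - Y z)"
            using Y\<theta> \<theta>' by (intro Earle_Hamilton_contraction[OF fH[OF z] \<theta>' k_def]) auto
          also have "\<dots> \<le> s / (s - \<theta>') / (1 + k) ^ n * \<theta>'"
            using Y\<theta> \<theta>' k0 by (intro mult_left_mono) auto
          finally show ?thesis unfolding fp by (simp add: dist_norm)
        qed
        have "(\<lambda>n. s / (s - \<theta>') * \<theta>' / (1 + k) ^ n) \<longlonglongrightarrow> 0"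
          using k0 LIMSEQ_divide_realpow_zero by blast
        then have "\<forall>\<^sub>F n in sequentially. s / (s - \<theta>') * \<theta>' / (1 + k) ^ n < e"
          using e by (rule order_tendstoD(2))
        then show "\<forall>\<^sub>F n in sequentially. \<forall>z\<in>ball 0 c'. dist ((f z ^^ n) 0) (Y z) < e"
          by eventually_elim (use est in \<open>blast intro: le_less_trans\<close>)
      qed
    qed (use c' in auto)
  qed
  then have "Y \<in> Hol (ball 0 c) (ball 0 s)" using Y(1) by (intro HolI)
  then show ?thesis using Y_iff by blast
qed

subsection \<open>The numerical range\<close>

text \<open>The bound \<open>L(h) \<le> \<omega>\<close> unfolded into real inequalities, so that no
  infinite suprema have to be handled; the functional norms \<open>u\<close>, not its multiple by
  \<open>s\<close>.\<close>

definition numrange_le :: "real \<Rightarrow> ('a::complex_banach \<Rightarrow> 'a) \<Rightarrow> bool"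
  where "numrange_le \<omega> h \<longleftrightarrow> (\<forall>\<eta>>0. \<forall>\<^sub>F s in at_left 1. \<forall>u. \<forall>\<phi>\<in>dual_ball.
    norm u = 1 \<longrightarrow> \<phi> u = 1 \<longrightarrow> Re (\<phi> (h (s *\<^sub>R u))) \<le> \<omega> + \<eta>)"

text \<open>A bound at every radius, not only near 1, with a correction vanishing as
  \<open>s\<close> tends to 1. Multiplying it by \<open>s\<close> passes from functionals norming
  \<open>u\<close> to the duality map at \<open>s\<close> times \<open>u\<close>.\<close>

definition numrange_growth :: "real \<Rightarrow> real \<Rightarrow> ('a::complex_banach \<Rightarrow> 'a) \<Rightarrow> bool"
  where "numrange_growth \<omega> \<sigma> h \<longleftrightarrow> (\<forall>u. \<forall>\<phi>\<in>dual_ball. \<forall>s\<in>{0<..<1}.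
    norm u = 1 \<longrightarrow> \<phi> u = 1 \<longrightarrow> Re (\<phi> (h (s *\<^sub>R u))) \<le> \<omega> * s + \<sigma> * (1 - s\<^sup>2))"

lemma numrange_growthD:
  assumes "numrange_growth \<omega> \<sigma> h" "\<phi> \<in> dual_ball" "0 < s" "s < 1" "norm u = 1" "\<phi> u = 1"
  shows "Re (\<phi> (h (s *\<^sub>R u))) \<le> \<omega> * s + \<sigma> * (1 - s\<^sup>2)"
  using assms unfolding numrange_growth_def by simp

section \<open>Conditions (i) and (ii) in terms of norming functionals\<close>

lemma duality_map_norm_one:
  assumes "norm x = 1"
  shows "\<phi> \<in> duality_map x \<longleftrightarrow> \<phi> \<in> dual_ball \<and> \<phi> x = 1"
  using duality_map_unit_sphere[OF assms, of 1 \<phi>] by simp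

lemma numerical_radius_le_iff: "numerical_radius h \<le> ereal \<omega> \<longleftrightarrow> numrange_le \<omega> h"
proof
  assume L: "numerical_radius h \<le> ereal \<omega>"
  show "numrange_le \<omega> h"
    unfolding numrange_le_def
  proof (intro allI impI)
    fix \<eta> :: real assume "\<eta> > 0"
    then have "ereal \<omega> < ereal (\<omega> + \<eta>)" by simp
    then have "\<forall>\<^sub>F s in at_left 1. Sup {ereal (Re (\<phi> (h (s *\<^sub>R x)))) | x \<phi>.
        x \<in> frontier unit_ball \<and> \<phi> \<in> duality_map x} < ereal (\<omega> + \<eta>)"
      using L unfolding numerical_radius_def Limsup_le_iff by blast
    then show "\<forall>\<^sub>F s in at_left 1. \<forall>u. \<forall>\<phi>\<in>dual_ball. norm u = 1 \<longrightarrow> \<phi> u = 1 \<longrightarrow>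
        Re (\<phi> (h (s *\<^sub>R u))) \<le> \<omega> + \<eta>"
    proof eventually_elim
      case (elim s)
      show ?case
      proof (intro allI ballI impI)
        fix u :: 'a and \<phi> :: "'a \<Rightarrow> complex"
        assume u: "\<phi> \<in> dual_ball" "norm u = 1" "\<phi> u = 1"
        then have "\<phi> \<in> duality_map u" by (simp add: duality_map_norm_one)
        then have "ereal (Re (\<phi> (h (s *\<^sub>R u)))) \<le> Sup {ereal (Re (\<phi> (h (s *\<^sub>R x)))) | x \<phi>.
            x \<in> frontier unit_ball \<and> \<phi> \<in> duality_map x}"
          using u by (intro Sup_upper) auto
        then have "ereal (Re (\<phi> (h (s *\<^sub>R u)))) < ereal (\<omega> + \<eta>)" using elim by (rule le_less_trans)
        then show "Re (\<phi> (h (s *\<^sub>R u))) \<le> \<omega> + \<eta>" by simp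
      qed
    qed
  qed
next
  assume N: "numrange_le \<omega> h"
  show "numerical_radius h \<le> ereal \<omega>"
    unfolding numerical_radius_def Limsup_le_iff
  proof (intro allI impI)
    fix y :: ereal assume "ereal \<omega> < y"
    \<comment> \<open>The number \<open>y\<close> may be infinite, so a real number below it takes
      over as the bound.\<close>
    then obtain r where r: "ereal \<omega> < ereal r" "ereal r < y" using ereal_dense2 by blast
    then have "r - \<omega> > 0" by simp
    then have "\<forall>\<^sub>F s in at_left 1. \<forall>u. \<forall>\<phi>\<in>dual_ball. norm u = 1 \<longrightarrow> \<phi> u = 1 \<longrightarrow>
        Re (\<phi> (h (s *\<^sub>R u))) \<le> \<omega> + (r - \<omega>)"
      using N unfolding numrange_le_def by blast
    then show "\<forall>\<^sub>F s in at_left 1. Sup {ereal (Re (\<phi> (h (s *\<^sub>R x)))) | x \<phi>.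
        x \<in> frontier unit_ball \<and> \<phi> \<in> duality_map x} < y"
    proof eventually_elim
      case (elim s)
      have "Sup {ereal (Re (\<phi> (h (s *\<^sub>R x)))) | x \<phi>. x \<in> frontier unit_ball \<and> \<phi> \<in> duality_map x}
          \<le> ereal r"
      proof (rule Sup_least)
        fix e assume "e \<in> {ereal (Re (\<phi> (h (s *\<^sub>R x)))) | x \<phi>. x \<in> frontier unit_ball \<and> \<phi> \<in> duality_map x}"
        then obtain x \<phi> where x: "norm x = 1" "\<phi> \<in> duality_map x"
          and e: "e = ereal (Re (\<phi> (h (s *\<^sub>R x))))" by auto
        then have "\<phi> \<in> dual_ball" "\<phi> x = 1" by (simp_all add: duality_map_norm_one)
        then have "Re (\<phi> (h (s *\<^sub>R x))) \<le> \<omega> + (r - \<omega>)" using elim x(1) by blast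
        then show "e \<le> ereal r" by (simp add: e)
      qed
      then show ?case using r(2) by (rule le_less_trans)
    qed
  qed
qed

lemma numrange_growth_imp_dissipative:
  assumes "numrange_growth \<omega> \<sigma> h"
  shows "dissipative \<omega> h"
  unfolding dissipative_def
\<comment> \<open>The estimate is available at all radii, and 1/2 merely keeps \<open>x\<close> away
  from 0 for the normalisation. The absolute value of \<open>\<sigma>\<close> absorbs the factor
  \<open>norm x < 1\<close> whatever the sign of \<open>\<sigma>\<close>.\<close>
proof (rule exI[of _ "1/2::real"], rule conjI, simp, rule exI[of _ "\<bar>\<sigma>\<bar>"], intro ballI impI)
  fix x :: 'a and \<phi> :: "'a \<Rightarrow> complex"
  assume x: "1 - 1 / 2 < norm x \<and> norm x < 1" and \<phi>: "\<phi> \<in> duality_map x"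
  define u where "u = (1 / norm x) *\<^sub>R x"
  have u: "norm u = 1" "norm x *\<^sub>R u = x" using x by (auto simp: u_def)
  have "norm x > 0" using x by linarith
  then obtain \<psi> where \<psi>: "\<psi> \<in> dual_ball" "\<psi> u = 1" and eq: "\<phi> = (\<lambda>y. norm x *\<^sub>R \<psi> y)"
    using duality_map_unit_sphere[OF u(1), of "norm x" \<phi>] \<phi> unfolding u(2) by blast
  have 1: "Re (\<psi> (h x)) \<le> \<omega> * norm x + \<sigma> * (1 - (norm x)\<^sup>2)"
    using numrange_growthD[OF assms \<psi>(1) \<open>norm x > 0\<close> _ u(1) \<psi>(2)] x u(2) by simp
  have sq: "0 \<le> 1 - (norm x)\<^sup>2" using x by (simp add: power_le_one)
  have "Re (\<phi> (h x)) = norm x * Re (\<psi> (h x))" by (simp add: eq)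
  also have "\<dots> \<le> norm x * (\<omega> * norm x + \<sigma> * (1 - (norm x)\<^sup>2))"
    using 1 by (intro mult_left_mono) auto
  also have "\<dots> = \<omega> * (norm x)\<^sup>2 + (norm x * \<sigma>) * (1 - (norm x)\<^sup>2)"
    by (simp add: algebra_simps power2_eq_square)
  also have "\<dots> \<le> \<omega> * (norm x)\<^sup>2 + \<bar>\<sigma>\<bar> * (1 - (norm x)\<^sup>2)"
  proof -
    have "norm x * \<sigma> \<le> norm x * \<bar>\<sigma>\<bar>" by (intro mult_left_mono) auto
    also have "\<dots> \<le> 1 * \<bar>\<sigma>\<bar>" using x by (intro mult_right_mono) auto
    finally have "norm x * \<sigma> \<le> \<bar>\<sigma>\<bar>" by simp
    then show ?thesis using mult_right_mono[OF _ sq] by simp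
  qed
  finally show "Re (\<phi> (h x)) \<le> \<omega> * (norm x)\<^sup>2 + \<bar>\<sigma>\<bar> * (1 - (norm x)\<^sup>2)" .
qed

lemma dissipative_imp_numrange_le:
  assumes "dissipative \<omega> h"
  shows "numrange_le \<omega> h"
proof -
  obtain \<epsilon> \<sigma> where \<epsilon>: "\<epsilon> > 0" and diss: "\<And>x \<phi>. x \<in> unit_ball \<Longrightarrow> 1 - \<epsilon> < norm x \<Longrightarrow>
      \<phi> \<in> duality_map x \<Longrightarrow> Re (\<phi> (h x)) \<le> \<omega> * (norm x)\<^sup>2 + \<sigma> * (1 - (norm x)\<^sup>2)"
  proof -
    assume *: "\<And>\<epsilon> \<sigma>. \<lbrakk>\<epsilon> > 0; \<And>x \<phi>. x \<in> unit_ball \<Longrightarrow> 1 - \<epsilon> < norm x \<Longrightarrow>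
      \<phi> \<in> duality_map x \<Longrightarrow> Re (\<phi> (h x)) \<le> \<omega> * (norm x)\<^sup>2 + \<sigma> * (1 - (norm x)\<^sup>2)\<rbrakk> \<Longrightarrow> thesis"
    obtain \<epsilon> \<sigma> where "\<epsilon> > 0" "\<forall>x\<in>unit_ball. 1 - \<epsilon> < norm x \<and> norm x < 1 \<longrightarrow>
      (\<forall>\<phi>\<in>duality_map x. Re (\<phi> (h x)) \<le> \<omega> * (norm x)\<^sup>2 + \<sigma> * (1 - (norm x)\<^sup>2))"
      using assms unfolding dissipative_def by blast
    then show thesis by (intro *[of \<epsilon> \<sigma>]) simp_all
  qed
  show ?thesis
    unfolding numrange_le_def
  proof (intro allI impI)
    fix \<eta> :: real assume "\<eta> > 0"
    \<comment> \<open>This is the dissipativity bound at norm \<open>s\<close> divided by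
      \<open>s\<close>, the factor between a duality functional there and its normalised
      version.\<close>
    have "((\<lambda>s. \<omega> * s + \<sigma> * (1 - s\<^sup>2) / s) \<longlongrightarrow> \<omega> * 1 + \<sigma> * (1 - 1\<^sup>2) / 1) (at_left (1::real))"
      by (intro tendsto_intros) auto
    then have "\<forall>\<^sub>F s in at_left (1::real). \<omega> * s + \<sigma> * (1 - s\<^sup>2) / s < \<omega> + \<eta>"
      using \<open>\<eta> > 0\<close> by (intro order_tendstoD(2)) auto
    moreover have "\<forall>\<^sub>F s in at_left (1::real). max 0 (1 - \<epsilon>) < s \<and> s < 1"
      using \<epsilon> by (intro eventually_at_leftI[of "max 0 (1 - \<epsilon>)"]) auto
    ultimately show "\<forall>\<^sub>F s in at_left 1. \<forall>u. \<forall>\<phi>\<in>dual_ball. norm u = 1 \<longrightarrow> \<phi> u = 1 \<longrightarrow>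
        Re (\<phi> (h (s *\<^sub>R u))) \<le> \<omega> + \<eta>"
    proof eventually_elim
      case (elim s)
      show ?case
      proof (intro allI ballI impI)
        fix u :: 'a and \<psi> :: "'a \<Rightarrow> complex"
        assume u: "\<psi> \<in> dual_ball" "norm u = 1" "\<psi> u = 1"
        have s: "0 < s" "s < 1" "1 - \<epsilon> < s" using elim by auto
        have "(\<lambda>y. s *\<^sub>R \<psi> y) \<in> duality_map (s *\<^sub>R u)"
          using duality_map_unit_sphere[OF u(2) s(1)] u by blast
        then have "Re (s *\<^sub>R \<psi> (h (s *\<^sub>R u))) \<le> \<omega> * (norm (s *\<^sub>R u))\<^sup>2 + \<sigma> * (1 - (norm (s *\<^sub>R u))\<^sup>2)"
          using s u(2) by (intro diss) auto
        then have "s * Re (\<psi> (h (s *\<^sub>R u))) \<le> \<omega> * s\<^sup>2 + \<sigma> * (1 - s\<^sup>2)" using s u(2) by simp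
        also have "\<dots> = s * (\<omega> * s + \<sigma> * (1 - s\<^sup>2) / s)"
          using s by (simp add: field_simps power2_eq_square)
        finally have "Re (\<psi> (h (s *\<^sub>R u))) \<le> \<omega> * s + \<sigma> * (1 - s\<^sup>2) / s"
          using s by simp
        then show "Re (\<psi> (h (s *\<^sub>R u))) \<le> \<omega> + \<eta>" using elim by linarith
      qed
    qed
  qed
qed

text \<open>On the unit circle \<open>k \<zeta>\<close> and \<open>f \<zeta> / \<zeta>\<close> have the same real part, while \<open>k\<close> is holomorphic at
  the origin. So the bound near the sphere spreads to the whole disc by the maximum principle.\<close>

lemma numrange_disc:
  fixes h :: "'a::complex_banach \<Rightarrow> 'a"
  assumes h: "h \<in> Hol unit_ball UNIV" and N: "numrange_le \<omega> h"
    and \<phi>: "\<phi> \<in> dual_ball" and u: "norm u = 1" "\<phi> u = 1"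
  defines "f \<equiv> \<lambda>\<zeta>. \<phi> (h (\<zeta> *\<^sub>C u))"
  defines "k \<equiv> \<lambda>\<zeta>. (if \<zeta> = 0 then deriv f 0 else (f \<zeta> - f 0) / \<zeta>) + cnj (f 0) * \<zeta>"
  shows "f holomorphic_on ball 0 1" "k holomorphic_on ball 0 1"
    and "\<And>\<zeta>. \<zeta> \<in> ball 0 1 \<Longrightarrow> Re (k \<zeta>) \<le> \<omega>"
proof -
  show fh: "f holomorphic_on ball 0 1"
    unfolding f_def using HolD[OF h] u(1) dual_ball_clinear[OF \<phi>]
    by (intro holomorphic_along_ray) (auto simp: norm_scaleC)
  \<comment> \<open>The difference quotient has a removable singularity at 0, filled by the
    derivative.\<close>
  have "(\<lambda>\<zeta>. if \<zeta> = 0 then deriv f 0 else (f \<zeta> - f 0) / \<zeta>) holomorphic_on ball 0 1"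
    using pole_lemma_open[OF fh open_ball, of 0] unfolding diff_zero .
  then show kh: "k holomorphic_on ball 0 1"
    unfolding k_def by (rule holomorphic_on_add) (intro holomorphic_intros)
  fix \<zeta>0 :: complex assume \<zeta>0: "\<zeta>0 \<in> ball 0 1"
  show "Re (k \<zeta>0) \<le> \<omega>"
  proof (rule field_le_epsilon)
    fix \<eta> :: real assume \<eta>: "\<eta> > 0"
    \<comment> \<open>On a circle of radius \<open>s < 1\<close> the real parts of
      \<open>f 0 / \<zeta>\<close> and \<open>cnj (f 0) * \<zeta>\<close> differ by at most
      \<open>cmod (f 0) * (1 / s - s)\<close>; this error disappears as \<open>s\<close> tends to
      1.\<close>
    let ?b = "\<lambda>s. (\<omega> + \<eta>) / s + cmod (f 0) * (1 / s - s)"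
    have "((\<lambda>s. ?b s) \<longlongrightarrow> (\<omega> + \<eta>) / 1 + cmod (f 0) * (1 / 1 - 1)) (at_left (1::real))"
      by (intro tendsto_intros) auto
    then have lim: "(?b \<longlongrightarrow> \<omega> + \<eta>) (at_left 1)" by simp
    show "Re (k \<zeta>0) \<le> \<omega> + \<eta>"
    proof (rule tendsto_lowerbound[OF lim])
      have "\<forall>\<^sub>F s in at_left (1::real). cmod \<zeta>0 < s \<and> s < 1"
        using \<zeta>0 by (intro eventually_at_leftI[of "cmod \<zeta>0"]) auto
      moreover have "\<forall>\<^sub>F s in at_left 1. \<forall>u. \<forall>\<phi>\<in>dual_ball. norm u = 1 \<longrightarrow> \<phi> u = 1 \<longrightarrow>
          Re (\<phi> (h (s *\<^sub>R u))) \<le> \<omega> + \<eta>"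
        using N \<eta> unfolding numrange_le_def by blast
      ultimately show "\<forall>\<^sub>F s in at_left 1. Re (k \<zeta>0) \<le> ?b s"
      proof eventually_elim
        case (elim s)
        then have s: "0 < s" "s < 1" "cmod \<zeta>0 < s" using norm_ge_zero[of \<zeta>0] by linarith+
        have sub: "cball 0 s \<subseteq> ball (0::complex) 1" using s by auto
        show ?case
        proof (rule maximum_real_frontier[of k "cball 0 s"])
          show "k holomorphic_on interior (cball 0 s)"
            using kh sub interior_subset by (blast intro: holomorphic_on_subset)
          show "continuous_on (closure (cball 0 s)) k"
            using kh sub by (auto intro: holomorphic_on_imp_continuous_on holomorphic_on_subset)
          show "bounded (cball (0::complex) s)" by simp
          show "\<zeta>0 \<in> cball 0 s" using s by simp
          fix \<zeta> assume "\<zeta> \<in> frontier (cball (0::complex) s)"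
          then have \<zeta>: "cmod \<zeta> = s" by simp
          define e where "e = \<zeta> / s"
          have e: "cmod e = 1" "\<zeta> = s * e" using \<zeta> s by (auto simp: e_def norm_divide)
          have ee: "e * cnj e = 1" using e(1) by (simp add: complex_norm_square[symmetric])
          have nz: "\<zeta> \<noteq> 0" "e \<noteq> 0" using \<zeta> s e by auto
          have inv: "x / \<zeta> = (cnj e * x) / s" for x
          proof -
            have "x / \<zeta> = (e * cnj e) * x / (s * e)" using ee e(2) by simp
            also have "\<dots> = (cnj e * x) / s" using nz by simp
            finally show ?thesis .
          qed
          \<comment> \<open>The hypothesis concerns real multiples of unit vectors; it is used at
            the rotated vector \<open>e\<close> times \<open>u\<close>, normed by
            \<open>cnj e\<close> times \<open>\<phi>\<close>.\<close>
          have "Re (cnj e * \<phi> (h (s *\<^sub>R (e *\<^sub>C u)))) \<le> \<omega> + \<eta>"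
          proof -
            have "(\<lambda>y. cnj e * \<phi> y) \<in> dual_ball" by (rule dual_ball_rotate[OF \<phi>]) (simp add: e)
            moreover have "norm (e *\<^sub>C u) = 1" using e u by (simp add: norm_scaleC)
            moreover have "cnj e * \<phi> (e *\<^sub>C u) = 1"
              using ee u by (simp add: functional_scaleC[OF dual_ball_clinear[OF \<phi>]] mult.commute)
            ultimately show ?thesis
              using bspec[OF spec[OF elim(2), of "e *\<^sub>C u"], of "\<lambda>y. cnj e * \<phi> y"] by simp
          qed
          moreover have "s *\<^sub>R (e *\<^sub>C u) = \<zeta> *\<^sub>C u" by (simp add: e scaleR_scaleC scaleC_scaleC)
          ultimately have f\<zeta>: "Re (cnj e * f \<zeta>) \<le> \<omega> + \<eta>" by (simp add: f_def)
          define b where "b = Re (cnj e * f 0)"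
          have "k \<zeta> = (cnj e * f \<zeta>) / s - (cnj e * f 0) / s + s * (cnj (f 0) * e)"
          proof -
            have "k \<zeta> = f \<zeta> / \<zeta> - f 0 / \<zeta> + cnj (f 0) * \<zeta>"
              using nz(1) by (simp add: k_def diff_divide_distrib)
            moreover have "cnj (f 0) * \<zeta> = s * (cnj (f 0) * e)" by (simp add: e(2))
            ultimately show ?thesis by (simp only: inv)
          qed
          moreover have "Re (cnj (f 0) * e) = b" by (simp add: b_def)
          ultimately have "Re (k \<zeta>) = Re (cnj e * f \<zeta>) / s - b / s + s * b"
            by (simp add: b_def Re_divide_of_real)
          also have "\<dots> = Re (cnj e * f \<zeta>) / s + (- b) * (1 / s - s)" by (simp add: algebra_simps)
          also have "\<dots> \<le> (\<omega> + \<eta>) / s + cmod (f 0) * (1 / s - s)"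
          proof (intro add_mono divide_right_mono mult_right_mono f\<zeta>)
            have "\<bar>b\<bar> \<le> cmod (f 0)"
              unfolding b_def using abs_Re_le_cmod[of "cnj e * f 0"] e(1) by (simp add: norm_mult)
            then show "- b \<le> cmod (f 0)" by linarith
            have "s * s \<le> 1" using s by (simp add: mult_le_one)
            then show "0 \<le> 1 / s - s" using s by (simp add: field_simps)
          qed (use s in auto)
          finally show "Re (k \<zeta>) \<le> ?b s" .
        qed
      qed
    qed simp
  qed
qed

text \<open>Solving the definition of \<open>k\<close> for \<open>f\<close> at a real
  \<open>s\<close> leaves the constant terms \<open>f 0\<close> and
  \<open>- s^2 * cnj (f 0)\<close>, whose real parts add up to \<open>(1 - s^2) * Re (f 0)\<close>.
  This is where \<open>\<sigma> = norm (h 0)\<close> originates.\<close>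

lemma numrange_le_imp_growth:
  fixes h :: "'a::complex_banach \<Rightarrow> 'a"
  assumes h: "h \<in> Hol unit_ball UNIV" and N: "numrange_le \<omega> h"
  shows "numrange_growth \<omega> (norm (h 0)) h"
  unfolding numrange_growth_def
proof (intro allI ballI impI)
  fix u :: 'a and \<phi> :: "'a \<Rightarrow> complex" and s :: real
  assume \<phi>: "\<phi> \<in> dual_ball" and s: "s \<in> {0<..<1}" and u: "norm u = 1" "\<phi> u = 1"
  define f where "f \<zeta> = \<phi> (h (\<zeta> *\<^sub>C u))" for \<zeta>
  define k where "k \<zeta> = (if \<zeta> = 0 then deriv f 0 else (f \<zeta> - f 0) / \<zeta>) + cnj (f 0) * \<zeta>" for \<zeta>
  have "Re (k s) \<le> \<omega>"
    using numrange_disc(3)[OF h N \<phi> u, of "of_real s"] s unfolding k_def f_def by simp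
  moreover have "f s = s * k s + (f 0 - of_real (s\<^sup>2) * cnj (f 0))"
    using s by (simp add: k_def field_simps power2_eq_square)
  then have "Re (f s) = Re (s * k s + (f 0 - of_real (s\<^sup>2) * cnj (f 0)))" by (rule arg_cong)
  then have "Re (f s) = s * Re (k s) + (1 - s\<^sup>2) * Re (f 0)"
    by (simp add: left_diff_distrib del: of_real_power)
  moreover have "s * Re (k s) \<le> s * \<omega>" using s calculation(1) by (intro mult_left_mono) auto
  moreover have "(1 - s\<^sup>2) * Re (f 0) \<le> (1 - s\<^sup>2) * norm (h 0)"
  proof (rule mult_left_mono)
    show "Re (f 0) \<le> norm (h 0)"
      using dual_ball_norm[OF \<phi>, of "h 0"] complex_Re_le_cmod[of "f 0"] by (simp add: f_def)
    show "0 \<le> 1 - s\<^sup>2" using s by (simp add: power_le_one)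
  qed
  ultimately show "Re (\<phi> (h (s *\<^sub>R u))) \<le> \<omega> * s + norm (h 0) * (1 - s\<^sup>2)"
    by (simp add: f_def scaleR_scaleC mult.commute)
qed

text \<open>The map \<open>w \<mapsto> w / (2 * A - w)\<close> sends the half-plane
  \<open>Re w < A\<close> into the unit disc and fixes 0, so Schwarz's lemma applies to its
  composition with \<open>F\<close>.\<close>

lemma Borel_Caratheodory_disc:
  assumes F: "F holomorphic_on ball 0 1" "F 0 = 0" and A: "\<And>z. z \<in> ball 0 1 \<Longrightarrow> Re (F z) < A"
    and z: "z \<in> ball 0 1"
  shows "cmod (F z) * (1 - cmod z) \<le> 2 * A * cmod z"
proof -
  have A0: "A > 0" using A[of 0] F(2) by simp
  have lt: "cmod (F w) < cmod (2 * A - F w)" if "w \<in> ball 0 1" for w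
  proof -
    have "(cmod (F w))\<^sup>2 < (cmod (2 * A - F w))\<^sup>2"
      using mult_strict_left_mono[OF A[OF that] A0] unfolding cmod_power2
      by (simp add: power2_eq_square algebra_simps)
    then show ?thesis by (rule power_less_imp_less_base) simp
  qed
  have nz: "2 * A - F w \<noteq> 0" if "w \<in> ball 0 1" for w using lt[OF that] by force
  define G where "G w = F w / (2 * A - F w)" for w
  have "cmod (G z) \<le> cmod z"
  proof (rule Schwarz_Lemma(1))
    show "G holomorphic_on ball 0 1"
      unfolding G_def using nz F(1) by (intro holomorphic_intros) auto
    show "cmod (G w) < 1" if "cmod w < 1" for w
      unfolding G_def norm_divide using lt[of w] that nz[of w] by simp
  qed (use z F in \<open>auto simp: G_def\<close>)
  then have "cmod (F z) \<le> cmod z * cmod (2 * A - F z)"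
    unfolding G_def norm_divide using nz[OF z] by (simp add: field_simps)
  also have "\<dots> \<le> cmod z * (2 * A + cmod (F z))"
    using norm_triangle_ineq4[of "2 * complex_of_real A" "F z"] A0
    by (intro mult_left_mono) (auto simp: norm_mult)
  finally show ?thesis by (simp add: algebra_simps)
qed

text \<open>Borel--Caratheodory turns the one-sided bound on \<open>Re k\<close> into a bound on the
  modulus. It is uniform in \<open>u\<close> and \<open>\<phi>\<close> because \<open>k 0\<close> is
  \<open>\<phi> (D u)\<close> for the derivative \<open>D\<close> of \<open>h\<close> at 0. Since
  \<open>\<phi>\<close> must norm \<open>u\<close>, this is not yet a norm bound for
  \<open>h\<close>.\<close>

lemma numrange_le_imp_bounded:
  fixes h :: "'a::complex_banach \<Rightarrow> 'a"
  assumes h: "h \<in> Hol unit_ball UNIV" and N: "numrange_le \<omega> h" and \<rho>: "\<rho> < 1"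
  shows "\<exists>K>0. \<forall>u. \<forall>\<phi>\<in>dual_ball. \<forall>\<zeta>. norm u = 1 \<longrightarrow> \<phi> u = 1 \<longrightarrow> cmod \<zeta> \<le> \<rho> \<longrightarrow> cmod (\<phi> (h (\<zeta> *\<^sub>C u))) \<le> K"
proof -
  obtain D where D: "bounded_clinear D" "(h has_derivative D) (at 0)"
    using HolD[OF h, of 0] by (auto elim: cfrechet_differentiableE)
  define d where "d = onorm D"
  have d0: "d \<ge> 0" unfolding d_def by (rule onorm_pos_le[OF bounded_clinear_imp_linear[OF D(1)]])
  \<comment> \<open>Chosen strictly above \<open>Re (k z - k 0)\<close>, given
    \<open>Re (k z) \<le> \<omega>\<close> and \<open>cmod (k 0) \<le> d\<close>.\<close>
  define A where "A = \<bar>\<omega>\<bar> + d + 1"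
  define K where "K = 2 * norm (h 0) + (d + 2 * A * \<bar>\<rho>\<bar> / (1 - \<rho>)) + 1"
  have A0: "A > 0" using d0 by (simp add: A_def)
  have "K > 0" using d0 A0 \<rho> by (simp add: K_def add_nonneg_pos)
  moreover have "cmod (\<phi> (h (\<zeta> *\<^sub>C u))) \<le> K"
    if \<phi>: "\<phi> \<in> dual_ball" and u: "norm u = 1" "\<phi> u = 1" and \<zeta>: "cmod \<zeta> \<le> \<rho>" for u \<phi> \<zeta>
  proof -
    define f where "f \<zeta> = \<phi> (h (\<zeta> *\<^sub>C u))" for \<zeta>
    define k where "k \<zeta> = (if \<zeta> = 0 then deriv f 0 else (f \<zeta> - f 0) / \<zeta>) + cnj (f 0) * \<zeta>" for \<zeta>
    have kh: "k holomorphic_on ball 0 1" and k\<omega>: "\<And>\<zeta>. \<zeta> \<in> ball 0 1 \<Longrightarrow> Re (k \<zeta>) \<le> \<omega>"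
      using numrange_disc[OF h N \<phi> u] unfolding k_def f_def by blast+
    have f0: "cmod (f 0) \<le> norm (h 0)" using dual_ball_norm[OF \<phi>] by (simp add: f_def)
    have "(f has_field_derivative \<phi> (D u)) (at 0)"
      using has_field_derivative_along_line[of h D 0 0 u \<phi>] D dual_ball_clinear[OF \<phi>]
      unfolding f_def by simp
    then have "k 0 = \<phi> (D u)" by (simp add: k_def DERIV_imp_deriv)
    then have "cmod (k 0) \<le> norm (D u)" using dual_ball_norm[OF \<phi>] by simp
    also have "\<dots> \<le> d"
      using onorm[OF bounded_clinear_imp_linear[OF D(1)], of u] u(1) by (simp add: d_def)
    finally have k0: "cmod (k 0) \<le> d" .
    have \<zeta>1: "\<zeta> \<in> ball 0 1" using \<zeta> \<rho> by simp
    have "cmod (k \<zeta> - k 0) * (1 - cmod \<zeta>) \<le> 2 * A * cmod \<zeta>"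
    proof (rule Borel_Caratheodory_disc[OF _ _ _ \<zeta>1])
      show "(\<lambda>z. k z - k 0) holomorphic_on ball 0 1" by (intro holomorphic_intros kh)
      show "Re (k z - k 0) < A" if "z \<in> ball 0 1" for z
        using k\<omega>[OF that] k0 abs_Re_le_cmod[of "k 0"] by (simp add: A_def)
    qed simp
    then have "cmod (k \<zeta> - k 0) \<le> 2 * A * cmod \<zeta> / (1 - cmod \<zeta>)" using \<zeta>1 by (simp add: pos_le_divide_eq)
    also have "\<dots> \<le> 2 * A * \<bar>\<rho>\<bar> / (1 - \<rho>)"
      using \<zeta> \<rho> A0 by (intro frac_le mult_left_mono) auto
    finally have "cmod (k \<zeta>) \<le> d + 2 * A * \<bar>\<rho>\<bar> / (1 - \<rho>)"
      using k0 norm_triangle_sub[of "k \<zeta>" "k 0"] by linarith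
    then have k\<zeta>: "cmod \<zeta> * cmod (k \<zeta>) \<le> 1 * (d + 2 * A * \<bar>\<rho>\<bar> / (1 - \<rho>))"
      using \<zeta>1 by (intro mult_mono) auto
    have "f \<zeta> = f 0 + \<zeta> * k \<zeta> - \<zeta>\<^sup>2 * cnj (f 0)"
      by (cases "\<zeta> = 0") (simp_all add: k_def field_simps power2_eq_square)
    then have "cmod (f \<zeta>) \<le> cmod (f 0) + cmod \<zeta> * cmod (k \<zeta>) + (cmod \<zeta>)\<^sup>2 * cmod (f 0)"
      by (metis (no_types, lifting) norm_triangle_ineq norm_triangle_le_diff norm_mult norm_power
          complex_mod_cnj add_right_mono)
    moreover have "(cmod \<zeta>)\<^sup>2 * cmod (f 0) \<le> 1 * cmod (f 0)"
      using \<zeta>1 by (intro mult_right_mono) (auto simp: power_le_one)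
    ultimately have "cmod (f \<zeta>) \<le> K" using f0 k\<zeta> unfolding K_def by simp
    then show ?thesis by (simp add: f_def)
  qed
  ultimately show ?thesis by blast
qed

subsection \<open>Taylor polynomials\<close>

text \<open>The functional \<open>\<phi>\<close> applied to the n-th homogeneous Taylor polynomial
  of \<open>h\<close> at 0, evaluated at \<open>x\<close>. The scalar version comes first because
  the vector-valued polynomial is yet to be constructed from it.\<close>

definition ray_coeff :: "('a::complex_banach \<Rightarrow> 'b::complex_banach) \<Rightarrow> ('b \<Rightarrow> complex) \<Rightarrow> 'a \<Rightarrow> nat \<Rightarrow> complex"
  where "ray_coeff h \<phi> x n = (deriv ^^ n) (\<lambda>\<zeta>. \<phi> (h (\<zeta> *\<^sub>C x))) 0 / fact n"

lemma ray_holomorphic: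
  assumes h: "\<And>x. x \<in> ball 0 R \<Longrightarrow> cfrechet_differentiable_at h x" and \<phi>: "\<phi> \<in> dual_ball"
    and r: "r * norm x \<le> R" "x \<noteq> 0"
  shows "(\<lambda>\<zeta>. \<phi> (h (\<zeta> *\<^sub>C x))) holomorphic_on ball 0 r"
proof (rule holomorphic_along_ray[where f=h])
  fix \<zeta> :: complex assume "\<zeta> \<in> ball 0 r"
  then have "norm (\<zeta> *\<^sub>C x) < r * norm x" using r(2) by (simp add: norm_scaleC)
  then show "cfrechet_differentiable_at h (\<zeta> *\<^sub>C x)" using r(1) by (intro h) simp
qed (rule dual_ball_clinear[OF \<phi>])

lemma ray_coeff_scale:
  assumes h: "\<And>x. x \<in> ball 0 R \<Longrightarrow> cfrechet_differentiable_at h x" and \<phi>: "\<phi> \<in> dual_ball"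
    and R: "R > 0"
  shows "ray_coeff h \<phi> (c *\<^sub>C x) n = c ^ n * ray_coeff h \<phi> x n"
proof (cases "x = 0")
  case True
  have "(deriv ^^ n) (\<lambda>\<zeta>::complex. \<phi> (h 0)) 0 = 0" if "n > 0"
    using that by (cases n) (simp_all add: higher_deriv_const del: funpow.simps)
  then show ?thesis using True by (cases "n = 0") (simp_all add: ray_coeff_def)
next
  case False
  define f where "f \<zeta> = \<phi> (h (\<zeta> *\<^sub>C x))" for \<zeta>
  define r where "r = R / norm x"
  have r: "r > 0" "r * norm x \<le> R" using R False by (simp_all add: r_def)
  have f: "f holomorphic_on ball 0 r"
    unfolding f_def by (rule ray_holomorphic[OF h \<phi> r(2) False])
  have "(deriv ^^ n) (\<lambda>w. f (c * w)) 0 = c ^ n * (deriv ^^ n) f (c * 0)"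
  proof (rule higher_deriv_compose_linear[OF f])
    \<comment> \<open>Dividing by \<open>cmod c + 1\<close> instead of \<open>cmod c\<close> also
      covers \<open>c = 0\<close>.\<close>
    show "open (ball (0::complex) (r / (cmod c + 1)))" by simp
    have pos: "cmod c + 1 > 0" by (simp add: add_nonneg_pos)
    show "0 \<in> ball (0::complex) (r / (cmod c + 1))" using r(1) pos by simp
    show "c * w \<in> ball 0 r" if "w \<in> ball 0 (r / (cmod c + 1))" for w
    proof -
      have "cmod (c * w) \<le> (cmod c + 1) * cmod w" by (simp add: norm_mult mult_right_mono)
      also have "\<dots> < r" using that pos by (simp add: pos_less_divide_eq mult.commute)
      finally show ?thesis by simp
    qed
  qed simp
  moreover have "f (c * w) = \<phi> (h (w *\<^sub>C (c *\<^sub>C x)))" for w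
    by (simp add: f_def scaleC_scaleC mult.commute)
  moreover have "ray_coeff h \<phi> x n = (deriv ^^ n) f 0 / fact n"
    by (simp add: ray_coeff_def f_def[abs_def])
  ultimately show ?thesis by (simp add: ray_coeff_def)
qed

text \<open>In the second bound the tail beyond degree \<open>n\<close> is compared with a geometric
  series of ratio \<open>t \<le> 1 / 2\<close>. It exhibits the n-th coefficient as a limit of
  rescaled remainders at a rate depending on \<open>f\<close> only through \<open>M\<close>.\<close>

lemma taylor_coeff_bounds:
  fixes f :: "complex \<Rightarrow> complex"
  defines "c \<equiv> \<lambda>n. (deriv ^^ n) f 0 / fact n"
  assumes f: "f holomorphic_on ball 0 r" and r: "r > 1" and M: "\<And>z. cmod z = 1 \<Longrightarrow> cmod (f z) \<le> M"
  shows "cmod (c n) \<le> M"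
    and "0 < t \<Longrightarrow> t \<le> 1 / 2 \<Longrightarrow>
      cmod ((f (of_real t) - (\<Sum>k<n. c k * of_real t ^ k)) / of_real t ^ n - c n) \<le> 2 * M * t"
proof -
  have sub: "cball 0 1 \<subseteq> ball (0::complex) r" using r by auto
  have bound: "cmod (c n) \<le> M" for n
  proof -
    have "cmod ((deriv ^^ n) f 0) \<le> fact n * M / 1 ^ n"
    proof (rule Cauchy_inequality)
      show "f holomorphic_on ball 0 1" using f sub by (force intro: holomorphic_on_subset)
      show "continuous_on (cball 0 1) f"
        using f sub by (blast intro: holomorphic_on_imp_continuous_on holomorphic_on_subset)
    qed (use M in auto)
    then show ?thesis by (simp add: c_def norm_divide field_simps)
  qed
  show "cmod (c n) \<le> M" by (rule bound)
  assume t: "0 < t" "t \<le> 1 / 2"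
  have M0: "M \<ge> 0" using bound[of 0] norm_ge_zero order_trans by blast
  have "(\<lambda>k. c k * (of_real t - 0) ^ k) sums f (of_real t)"
    unfolding c_def by (rule holomorphic_power_series[OF f]) (use t r in auto)
  then have tail: "(\<lambda>i. c (i + Suc n) * of_real t ^ (i + Suc n)) sums
      (f (of_real t) - (\<Sum>k<Suc n. c k * of_real t ^ k))"
    by (intro sums_split_initial_segment) simp
  have geo: "(\<lambda>i. M * t ^ Suc n * t ^ i) sums (M * t ^ Suc n * (1 / (1 - t)))"
    using t by (intro sums_mult geometric_sums) auto
  have "cmod (f (of_real t) - (\<Sum>k<Suc n. c k * of_real t ^ k)) \<le> M * t ^ Suc n * (1 / (1 - t))"
    unfolding sums_unique[OF tail] sums_unique[OF geo]
  proof (rule norm_suminf_le)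
    show "cmod (c (i + Suc n) * of_real t ^ (i + Suc n)) \<le> M * t ^ Suc n * t ^ i" for i
      using mult_right_mono[OF bound[of "i + Suc n"], of "t ^ (i + Suc n)"] t
      by (simp add: norm_mult norm_power power_add mult_ac)
    show "summable (\<lambda>i. M * t ^ Suc n * t ^ i)" using geo by (rule sums_summable)
  qed
  also have "\<dots> \<le> M * t ^ Suc n * 2"
    using t M0 by (intro mult_left_mono) (auto simp: field_simps)
  finally have "cmod (f (of_real t) - (\<Sum>k<Suc n. c k * of_real t ^ k)) / t ^ n \<le> (M * t ^ Suc n * 2) / t ^ n"
    using t by (intro divide_right_mono) auto
  also have "\<dots> = 2 * M * t" using t by simp
  finally have "cmod ((f (of_real t) - (\<Sum>k<Suc n. c k * of_real t ^ k)) / of_real t ^ n) \<le> 2 * M * t"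
    using t by (simp add: norm_divide norm_power)
  moreover have "(f (of_real t) - (\<Sum>k<Suc n. c k * of_real t ^ k)) / of_real t ^ n
      = (f (of_real t) - (\<Sum>k<n. c k * of_real t ^ k)) / of_real t ^ n - c n"
    using t by (simp add: diff_divide_distrib add_divide_distrib)
  ultimately show "cmod ((f (of_real t) - (\<Sum>k<n. c k * of_real t ^ k)) / of_real t ^ n - c n) \<le> 2 * M * t"
    by simp
qed

text \<open>The n-th polynomial is the limit of the Taylor remainders of \<open>h (t x)\<close>
  below degree \<open>n\<close>, divided by \<open>t ^ n\<close>, as \<open>t\<close> tends to 0.
  Scalar error bounds uniform over \<open>dual_ball\<close> make the convergence uniform in norm, so
  the limit is holomorphic; no vector-valued contour integral occurs.\<close>

lemma taylor_polynomial_exists: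
  fixes h :: "'a::complex_banach \<Rightarrow> 'a"
  assumes h: "\<And>x. x \<in> ball 0 R \<Longrightarrow> cfrechet_differentiable_at h x"
    and M: "\<And>x. x \<in> ball 0 R \<Longrightarrow> norm (h x) \<le> M" and R: "R > 0"
  shows "\<exists>P. \<forall>x\<in>ball 0 R. cfrechet_differentiable_at P x \<and> (\<forall>\<phi>\<in>dual_ball. \<phi> (P x) = ray_coeff h \<phi> x n)"
proof (induction n rule: less_induct)
  case (less n)
  have "\<forall>k. \<exists>P. k < n \<longrightarrow> (\<forall>x\<in>ball 0 R. cfrechet_differentiable_at P x
      \<and> (\<forall>\<phi>\<in>dual_ball. \<phi> (P x) = ray_coeff h \<phi> x k))"
    using less by blast
  then obtain P where P: "\<And>k x. k < n \<Longrightarrow> x \<in> ball 0 R \<Longrightarrow> cfrechet_differentiable_at (P k) x"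
    "\<And>k x \<phi>. k < n \<Longrightarrow> x \<in> ball 0 R \<Longrightarrow> \<phi> \<in> dual_ball \<Longrightarrow> \<phi> (P k x) = ray_coeff h \<phi> x k"
    by metis
  have M0: "M \<ge> 0" using M[of 0] R by (auto intro: order_trans[OF norm_ge_zero])
  define t where "t j = 1 / (real j + 2)" for j :: nat
  have t: "0 < t j" "t j \<le> 1 / 2" for j by (auto simp: t_def field_simps)
  define g where "g j x = (1 / t j ^ n) *\<^sub>R (h (t j *\<^sub>R x) - (\<Sum>k<n. t j ^ k *\<^sub>R P k x))" for j x
  have t_in: "t j *\<^sub>R x \<in> ball 0 R" if "x \<in> ball 0 R" for j and x :: 'a
  proof -
    have "t j * norm x \<le> 1 * norm x" using t[of j] by (intro mult_right_mono) auto
    then show ?thesis using that t[of j] by simp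
  qed
  have g_diff: "cfrechet_differentiable_at (g j) x" if "x \<in> ball 0 R" for j x
  proof -
    have "cfrechet_differentiable_at (\<lambda>x. h (t j *\<^sub>R x)) x"
      by (rule cfrechet_differentiable_compose[of "\<lambda>x. t j *\<^sub>R x", OF _ h[OF t_in[OF that]]])
        (intro cfrechet_differentiable_intros)
    then show ?thesis
      unfolding g_def using P(1)[OF _ that]
      by (intro cfrechet_differentiable_scaleR cfrechet_differentiable_diff cfrechet_differentiable_sum) auto
  qed
  have g_close: "cmod (\<phi> (g j x) - ray_coeff h \<phi> x n) \<le> 2 * M * t j"
    if x: "x \<in> ball 0 R" and \<phi>: "\<phi> \<in> dual_ball" for j x \<phi>
  proof -
    note bl = dual_ball_linear[OF \<phi>]
    define f where "f \<zeta> = \<phi> (h (\<zeta> *\<^sub>C x))" for \<zeta>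
    have "\<exists>r>1. f holomorphic_on ball 0 r"
    proof (cases "x = 0")
      case True
      then have "f = (\<lambda>\<zeta>. \<phi> (h 0))" by (auto simp: f_def)
      then show ?thesis by (intro exI[of _ 2]) simp
    next
      case False
      then have "R / norm x > 1" using x by simp
      moreover have "f holomorphic_on ball 0 (R / norm x)"
        unfolding f_def using False by (intro ray_holomorphic[OF h \<phi>]) auto
      ultimately show ?thesis by blast
    qed
    then obtain r where r: "r > 1" "f holomorphic_on ball 0 r" by blast
    have fM: "cmod (f z) \<le> M" if "cmod z = 1" for z
    proof -
      have "z *\<^sub>C x \<in> ball 0 R" using x that by (simp add: norm_scaleC)
      then show ?thesis unfolding f_def using M dual_ball_norm[OF \<phi>] order_trans by blast
    qed
    have "\<phi> (g j x) = (1 / t j ^ n) *\<^sub>R (\<phi> (h (t j *\<^sub>R x)) - (\<Sum>k<n. t j ^ k *\<^sub>R \<phi> (P k x)))"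
      unfolding g_def using bl
      by (simp add: bounded_linear.linear linear_scale linear_diff linear_sum)
    also have "\<dots> = (f (of_real (t j)) - (\<Sum>k<n. (deriv ^^ k) f 0 / fact k * of_real (t j) ^ k)) / of_real (t j) ^ n"
      using P(2)[OF _ x \<phi>]
      by (simp add: ray_coeff_def f_def[abs_def] scaleR_scaleC scaleR_conv_of_real scaleC_complex_def mult.commute)
    finally show ?thesis
      using taylor_coeff_bounds(2)[OF r(2,1) fM t(1)[of j] t(2)[of j], of n] by (simp add: ray_coeff_def f_def[abs_def])
  qed
  have t0: "(\<lambda>j. C * t j) \<longlonglongrightarrow> 0" for C
    unfolding t_def by real_asymp
  have g_cauchy: "norm (g i x - g j x) \<le> 2 * M * t i + 2 * M * t j" if x: "x \<in> ball 0 R" for i j x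
  proof (rule norm_le_dual_ball)
    fix \<phi> :: "'a \<Rightarrow> complex" assume \<phi>: "\<phi> \<in> dual_ball"
    have "\<phi> (g i x - g j x) = (\<phi> (g i x) - ray_coeff h \<phi> x n) - (\<phi> (g j x) - ray_coeff h \<phi> x n)"
      using dual_ball_linear[OF \<phi>] by (simp add: linear_simps)
    also have "cmod \<dots> \<le> 2 * M * t i + 2 * M * t j"
      by (rule order_trans[OF norm_triangle_ineq4 add_mono[OF g_close[OF x \<phi>] g_close[OF x \<phi>]]])
    finally show "cmod (\<phi> (g i x - g j x)) \<le> 2 * M * t i + 2 * M * t j" .
  qed
  have "uniformly_Cauchy_on (ball 0 R) g"
  proof (rule uniformly_Cauchy_onI)
    fix e :: real assume e: "e > 0"
    have "\<forall>\<^sub>F j in sequentially. 2 * M * t j < e / 2" using e by (intro order_tendstoD(2)[OF t0]) auto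
    then obtain N where N: "\<And>j. j \<ge> N \<Longrightarrow> 2 * M * t j < e / 2" unfolding eventually_sequentially by blast
    have "dist (g i x) (g j x) < e" if "x \<in> ball 0 R" "i \<ge> N" "j \<ge> N" for x i j
      using g_cauchy[OF that(1), of i j] N[OF that(2)] N[OF that(3)] by (simp add: dist_norm)
    then show "\<exists>N. \<forall>x\<in>ball 0 R. \<forall>m\<ge>N. \<forall>n\<ge>N. dist (g m x) (g n x) < e" by blast
  qed
  then obtain Q where Q: "uniform_limit (ball 0 R) g Q sequentially"
    using Cauchy_uniformly_convergent uniformly_convergent_on_def by blast
  have "cfrechet_differentiable_at Q x" if "x \<in> ball 0 R" for x
    by (rule holomorphic_uniform_limit[OF open_ball g_diff Q that])
  moreover have "\<phi> (Q x) = ray_coeff h \<phi> x n" if x: "x \<in> ball 0 R" and \<phi>: "\<phi> \<in> dual_ball" for x \<phi>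
  proof (rule LIMSEQ_unique)
    show "(\<lambda>j. \<phi> (g j x)) \<longlonglongrightarrow> \<phi> (Q x)"
      by (rule bounded_linear.tendsto[OF dual_ball_linear[OF \<phi>] tendsto_uniform_limitI[OF Q x]])
    have "(\<lambda>j. \<phi> (g j x) - ray_coeff h \<phi> x n) \<longlonglongrightarrow> 0"
      by (rule tendsto_norm_zero_cancel, rule tendsto_sandwich[OF _ _ tendsto_const t0[of "2 * M"]])
        (use g_close[OF x \<phi>] in auto)
    then show "(\<lambda>j. \<phi> (g j x)) \<longlonglongrightarrow> ray_coeff h \<phi> x n" by (simp add: LIM_zero_iff)
  qed
  ultimately show ?case by blast
qed

text \<open>Continuity at 0 bounds \<open>h\<close> on a small ball, and homogeneity transports the
  polynomial from there to \<open>ball 0 2\<close>, a neighbourhood of the closed unit ball. The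
  resulting bound grows like \<open>(2 / R) ^ n\<close>, too fast for summation, but its finiteness
  admits the polynomial to \<open>inward_inverse\<close>.\<close>

lemma taylor_polynomials:
  fixes h :: "'a::complex_banach \<Rightarrow> 'a"
  assumes h: "h \<in> Hol unit_ball UNIV"
  shows "\<exists>Q B. (\<forall>x\<in>ball 0 2. cfrechet_differentiable_at Q x \<and> norm (Q x) \<le> B
      \<and> (\<forall>\<zeta>. cmod \<zeta> \<le> 1 \<longrightarrow> Q (\<zeta> *\<^sub>C x) = (\<zeta> ^ n) *\<^sub>C Q x))
    \<and> (\<forall>x\<in>ball 0 2. \<forall>\<phi>\<in>dual_ball. \<phi> (Q x) = ray_coeff h \<phi> x n)"
proof -
  have "isCont h 0" by (rule cfrechet_differentiable_imp_isCont[OF HolD[OF h]]) simp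
  then obtain R0 where R0: "R0 > 0" "\<And>x. dist x 0 < R0 \<Longrightarrow> dist (h x) (h 0) < 1"
    unfolding continuous_at_eps_delta by (metis zero_less_one)
  define R where "R = min 1 R0"
  have R: "R > 0" "R \<le> 1" "R \<le> R0" using R0 by (auto simp: R_def)
  define M where "M = norm (h 0) + 1"
  have hR: "cfrechet_differentiable_at h x" if "x \<in> ball 0 R" for x
    using that R by (intro HolD[OF h]) auto
  have hM: "norm (h x) \<le> M" if "x \<in> ball 0 R" for x
    using R0(2)[of x] that R norm_triangle_sub[of "h x" "h 0"] by (simp add: M_def dist_norm)
  obtain P where P: "\<And>x. x \<in> ball 0 R \<Longrightarrow> cfrechet_differentiable_at P x"
    "\<And>x \<phi>. x \<in> ball 0 R \<Longrightarrow> \<phi> \<in> dual_ball \<Longrightarrow> \<phi> (P x) = ray_coeff h \<phi> x n"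
    using taylor_polynomial_exists[OF hR hM R(1), of n] by blast
  define Q where "Q x = (2 / R) ^ n *\<^sub>R P ((R / 2) *\<^sub>R x)" for x
  have in_R: "(R / 2) *\<^sub>R x \<in> ball 0 R" if "x \<in> ball 0 2" for x :: 'a using that R by simp
  have Q\<phi>: "\<phi> (Q x) = ray_coeff h \<phi> x n" if "x \<in> ball 0 2" "\<phi> \<in> dual_ball" for x \<phi>
  proof -
    have "\<phi> (Q x) = (2 / R) ^ n *\<^sub>R ray_coeff h \<phi> ((R / 2) *\<^sub>R x) n"
      unfolding Q_def using P(2)[OF in_R[OF that(1)] that(2)] dual_ball_linear[OF that(2)]
      by (simp add: bounded_linear.linear linear_scale)
    also have "ray_coeff h \<phi> ((R / 2) *\<^sub>R x) n = of_real (R / 2) ^ n * ray_coeff h \<phi> x n"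
      unfolding scaleR_scaleC by (rule ray_coeff_scale[OF hR that(2) R(1)])
    finally show ?thesis using R by (simp add: scaleR_conv_of_real power_divide)
  qed
  have diffQ: "cfrechet_differentiable_at Q x" if "x \<in> ball 0 2" for x
  proof -
    have "cfrechet_differentiable_at (\<lambda>x. P ((R / 2) *\<^sub>R x)) x"
      by (rule cfrechet_differentiable_compose[of "\<lambda>x. (R / 2) *\<^sub>R x", OF _ P(1)[OF in_R[OF that]]])
        (intro cfrechet_differentiable_intros)
    then show ?thesis unfolding Q_def by (rule cfrechet_differentiable_scaleR)
  qed
  have "norm (Q x) \<le> (2 / R) ^ n * M" if x: "x \<in> ball 0 2" for x
  proof -
    let ?y = "(R / 2) *\<^sub>R x"
    have "norm (P ?y) \<le> M"
    proof (rule norm_le_dual_ball)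
      fix \<phi> :: "'a \<Rightarrow> complex" assume \<phi>: "\<phi> \<in> dual_ball"
      define f where "f \<zeta> = \<phi> (h (\<zeta> *\<^sub>C ?y))" for \<zeta>
      have y: "norm ?y < R" using in_R[OF x] by simp
      have fM: "cmod (f z) \<le> M" if "cmod z = 1" for z
      proof -
        have "z *\<^sub>C ?y \<in> ball 0 R" using y that by (simp add: norm_scaleC)
        then show ?thesis unfolding f_def using hM dual_ball_norm[OF \<phi>] order_trans by blast
      qed
      have "\<exists>r>1. f holomorphic_on ball 0 r"
      proof (cases "?y = 0")
        case True
        then have "f = (\<lambda>\<zeta>. \<phi> (h 0))" by (auto simp: f_def)
        then show ?thesis by (intro exI[of _ 2]) simp
      next
        case False
        have "f holomorphic_on ball 0 (R / norm ?y)"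
          unfolding f_def using False by (intro ray_holomorphic[OF hR \<phi>]) auto
        moreover have "R / norm ?y > 1" using y False by (metis less_divide_eq_1_pos zero_less_norm_iff)
        ultimately show ?thesis by blast
      qed
      then obtain r where r: "r > 1" "f holomorphic_on ball 0 r" by blast
      then show "cmod (\<phi> (P ?y)) \<le> M"
        using taylor_coeff_bounds(1)[OF r(2,1) fM, of n] P(2)[OF in_R[OF x] \<phi>]
        by (simp only: ray_coeff_def f_def[abs_def])
    qed
    then show ?thesis unfolding Q_def using R by (simp add: mult_left_mono)
  qed
  moreover have "Q (\<zeta> *\<^sub>C x) = (\<zeta> ^ n) *\<^sub>C Q x" if x: "x \<in> ball 0 2" and \<zeta>: "cmod \<zeta> \<le> 1" for x \<zeta>
  proof -
    have "cmod \<zeta> * norm x \<le> 1 * norm x" using \<zeta> by (intro mult_right_mono) auto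
    then have \<zeta>x: "\<zeta> *\<^sub>C x \<in> ball 0 2" using x by (simp add: norm_scaleC)
    have "norm (Q (\<zeta> *\<^sub>C x) - (\<zeta> ^ n) *\<^sub>C Q x) \<le> 0"
    proof (rule norm_le_dual_ball)
      fix \<phi> :: "'a \<Rightarrow> complex" assume \<phi>: "\<phi> \<in> dual_ball"
      then show "cmod (\<phi> (Q (\<zeta> *\<^sub>C x) - (\<zeta> ^ n) *\<^sub>C Q x)) \<le> 0"
        using Q\<phi>[OF x \<phi>] Q\<phi>[OF \<zeta>x \<phi>] dual_ball_linear[OF \<phi>] ray_coeff_scale[OF hR \<phi> R(1), of \<zeta> x n]
        by (simp add: linear_simps functional_scaleC[OF dual_ball_clinear])
    qed
    then show ?thesis by simp
  qed
  ultimately show ?thesis using diffQ Q\<phi> by blast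
qed

text \<open>The quotient \<open>f z / z ^ n\<close> extends over 0 with value \<open>l\<close>; on
  circles approaching radius \<open>q\<close> it is bounded by \<open>B / q ^ n\<close> in the
  limit.\<close>

lemma monomial_coeff_bound:
  fixes f :: "complex \<Rightarrow> complex"
  assumes f: "f holomorphic_on ball 0 q" and B: "\<And>z. z \<in> ball 0 q \<Longrightarrow> cmod (f z) \<le> B"
    and q: "q > 0" and lim: "((\<lambda>z. f z / z ^ n) \<longlongrightarrow> l) (at 0)"
  shows "cmod l \<le> B / q ^ n"
proof -
  define g where "g z = (if z = 0 then l else f z / z ^ n)" for z
  have g: "g holomorphic_on ball 0 q"
  proof (rule no_isolated_singularity'[where K="{0}"])
    have "(g \<longlongrightarrow> l) (at 0)"
      by (rule Lim_transform_eventually[OF lim]) (auto simp: g_def eventually_at intro!: exI[of _ 1])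
    then show "(g \<longlongrightarrow> g z) (at z within ball 0 q)" if "z \<in> {0}" for z
      using that by (auto simp: g_def intro: tendsto_within_subset)
    have "(\<lambda>z. f z / z ^ n) holomorphic_on ball 0 q - {0}"
      by (intro holomorphic_intros holomorphic_on_subset[OF f]) auto
    then show "g holomorphic_on ball 0 q - {0}"
      by (rule holomorphic_transform) (auto simp: g_def)
  qed auto
  have bound: "cmod l * \<rho> ^ n \<le> B" if \<rho>: "0 < \<rho>" "\<rho> < q" for \<rho>
  proof -
    have sub: "cball 0 \<rho> \<subseteq> ball (0::complex) q" using \<rho> by auto
    \<comment> \<open>Cauchy's inequality of order 0 plays the role of the maximum
      principle.\<close>
    have "cmod ((deriv ^^ 0) g 0) \<le> fact 0 * (B / \<rho> ^ n) / \<rho> ^ 0"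
    proof (rule Cauchy_inequality)
      show "g holomorphic_on ball 0 \<rho>" using g sub by (force intro: holomorphic_on_subset)
      show "continuous_on (cball 0 \<rho>) g"
        using g sub by (blast intro: holomorphic_on_imp_continuous_on holomorphic_on_subset)
      show "cmod (g x) \<le> B / \<rho> ^ n" if "cmod (0 - x) = \<rho>" for x
        using that \<rho> B[of x] by (auto simp: g_def norm_divide norm_power intro!: divide_right_mono)
    qed (use \<rho> in auto)
    then show ?thesis using \<rho> by (simp add: g_def field_simps)
  qed
  have "cmod l * q ^ n \<le> B"
  proof (rule tendsto_upperbound)
    show "((\<lambda>\<rho>. cmod l * \<rho> ^ n) \<longlongrightarrow> cmod l * q ^ n) (at_left q)" by (intro tendsto_intros)
    show "\<forall>\<^sub>F \<rho> in at_left q. cmod l * \<rho> ^ n \<le> B"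
      using bound q by (auto simp: eventually_at_left[of 0])
  qed simp
  then show ?thesis using q by (simp add: pos_le_divide_eq)
qed

text \<open>The resolvent of \<open>\<tau> P\<close> expands along rays as \<open>\<zeta> u + \<tau> \<zeta>\<^sup>n P u + \<dots>\<close>, so a
  Cauchy estimate for the resolvent, which takes values in the unit ball, bounds \<open>P u\<close>.\<close>

lemma homogeneous_norm_bound:
  fixes P :: "'a::complex_banach \<Rightarrow> 'a"
  assumes P: "\<And>x. x \<in> ball 0 2 \<Longrightarrow> cfrechet_differentiable_at P x"
    and B: "\<And>x. x \<in> ball 0 2 \<Longrightarrow> norm (P x) \<le> B"
    and hom: "\<And>x \<zeta>. x \<in> ball 0 2 \<Longrightarrow> cmod \<zeta> \<le> 1 \<Longrightarrow> P (\<zeta> *\<^sub>C x) = (\<zeta> ^ n) *\<^sub>C P x" and n: "n \<ge> 2"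
    and C: "C > 0" "\<And>u \<phi>. norm u = 1 \<Longrightarrow> \<phi> \<in> dual_ball \<Longrightarrow> \<phi> u = 1 \<Longrightarrow> Re (\<phi> (P u)) \<le> C"
    and q: "0 < q" "q < 1" and u: "norm u = 1"
  shows "norm (P u) \<le> 2 * C / ((1 - q) * q ^ n)"
proof -
  \<comment> \<open>With \<open>\<tau> * C = 1 - q\<close> the map \<open>F\<close> has numerical
    range at most \<open>- q\<close> on the unit sphere, so its inverse exists on
    \<open>ball 0 q\<close>.\<close>
  define \<tau> where "\<tau> = (1 - q) / C"
  have \<tau>: "\<tau> > 0" using C q by (simp add: \<tau>_def)
  have B0: "B \<ge> 0" using B[of 0] by (auto intro: order_trans[OF norm_ge_zero])
  define F where "F y = \<tau> *\<^sub>R P y - y" for y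
  have "\<exists>Y. Y \<in> Hol (ball 0 q) (ball 0 1) \<and> (\<forall>z\<in>ball 0 q. \<forall>y\<in>ball 0 1. F y = z \<longleftrightarrow> y = Y z)"
  proof (rule inward_inverse)
    show "cfrechet_differentiable_at F x" if "x \<in> ball 0 2" for x
      unfolding F_def by (intro cfrechet_differentiable_intros P[OF that])
    show "norm (F x) \<le> \<tau> * B + 2" if "x \<in> ball 0 2" for x
    proof -
      have "norm (F x) \<le> \<tau> * norm (P x) + norm x"
        unfolding F_def using norm_triangle_ineq4[of "\<tau> *\<^sub>R P x" x] \<tau> by simp
      also have "\<dots> \<le> \<tau> * B + 2" using B[OF that] that \<tau> by (intro add_mono mult_left_mono) auto
      finally show ?thesis .
    qed
    show "Re (\<phi> (F (1 *\<^sub>R u))) \<le> - q" if "norm u = 1" "\<phi> \<in> dual_ball" "\<phi> u = 1" for u \<phi>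
    proof -
      have "Re (\<phi> (F (1 *\<^sub>R u))) = \<tau> * Re (\<phi> (P u)) - 1"
        unfolding F_def using dual_ball_linear[OF that(2)] that(3)
        by (simp add: bounded_linear.linear linear_diff linear_scale)
      also have "\<dots> \<le> \<tau> * C - 1" using C(2)[OF that] \<tau> by simp
      also have "\<dots> = - q" using C(1) by (simp add: \<tau>_def)
      finally show ?thesis .
    qed
  qed (use q in auto)
  then obtain Y where Y: "Y \<in> Hol (ball 0 q) (ball 0 1)"
    and Y_iff: "\<And>z y. z \<in> ball 0 q \<Longrightarrow> y \<in> ball 0 1 \<Longrightarrow> F y = z \<longleftrightarrow> y = Y z" by blast
  have P0: "P 0 = 0" using hom[of 0 0] n by (simp add: power_0_left)
  have Y0: "Y 0 = 0" using Y_iff[of 0 0] q P0 by (simp add: F_def)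
  \<comment> \<open>The minus sign makes \<open>y \<zeta>\<close> the solution of
    \<open>y = \<zeta> u + \<tau> P y\<close>, the resolvent of \<open>\<tau> P\<close> at the point
    \<open>\<zeta> u\<close>.\<close>
  define y where "y \<zeta> = Y ((- \<zeta>) *\<^sub>C u)" for \<zeta>
  have y_in: "(- \<zeta>) *\<^sub>C u \<in> ball 0 q" if "\<zeta> \<in> ball 0 q" for \<zeta> using that u by (simp add: norm_scaleC)
  have y1: "norm (y \<zeta>) < 1" if "\<zeta> \<in> ball 0 q" for \<zeta>
    unfolding y_def using Hol_mem[OF Y y_in[OF that]] by simp
  have y_eq: "y \<zeta> = \<zeta> *\<^sub>C u + \<tau> *\<^sub>R P (y \<zeta>)" if "\<zeta> \<in> ball 0 q" for \<zeta>
  proof -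
    have "F (y \<zeta>) = (- \<zeta>) *\<^sub>C u" using Y_iff[OF y_in[OF that], of "y \<zeta>"] y1[OF that] by (simp add: y_def)
    moreover have "(- \<zeta>) *\<^sub>C u = - (\<zeta> *\<^sub>C u)"
      by (metis add.right_inverse add_eq_0_iff scaleC_add_left scaleC_zero_left)
    ultimately show ?thesis by (simp add: F_def algebra_simps)
  qed
  \<comment> \<open>Lipschitz constant of \<open>Y\<close> on the ball of radius
    \<open>q / 2\<close>, from the Cauchy estimate with margin \<open>q - q / 2\<close>.\<close>
  define L where "L = 2 / q"
  have L: "norm (y \<zeta>) \<le> L * cmod \<zeta>" if \<zeta>: "cmod \<zeta> \<le> q / 2" for \<zeta>
  proof -
    have "norm (Y ((- \<zeta>) *\<^sub>C u) - Y 0) \<le> 1 / (q - q / 2) * norm ((- \<zeta>) *\<^sub>C u - 0)"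
    proof (rule holomorphic_ball_lipschitz[where R=q])
      show "norm (Y x) \<le> 1" if "x \<in> ball 0 q" for x using Hol_mem[OF Y that] by simp
    qed (use HolD[OF Y] \<zeta> q u in \<open>auto simp: norm_scaleC\<close>)
    then show ?thesis using u by (simp add: y_def Y0 L_def norm_scaleC)
  qed
  \<comment> \<open>Degree at least 2 makes \<open>P\<close> quadratically small at 0, so that
    dividing \<open>y \<zeta>\<close> by \<open>\<zeta>\<close> leaves exactly \<open>u\<close> in
    the limit.\<close>
  have P_small: "norm (P x) \<le> B * (norm x)\<^sup>2" if x: "norm x \<le> 1" for x
  proof (cases "x = 0")
    case False
    define v where "v = (1 / norm x) *\<^sub>R x"
    have v: "norm v = 1" "of_real (norm x) *\<^sub>C v = x" using False by (auto simp: v_def scaleR_scaleC[symmetric])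
    have "P x = (of_real (norm x) ^ n) *\<^sub>C P v" using hom[of v "of_real (norm x)"] v x by simp
    then have "norm (P x) = norm x ^ n * norm (P v)" by (simp add: norm_scaleC norm_power)
    also have "\<dots> \<le> (norm x)\<^sup>2 * B"
      using B[of v] v x n by (intro mult_mono power_decreasing) auto
    finally show ?thesis by (simp add: mult.commute)
  qed (simp add: P0)
  define w where "w \<zeta> = (1 / \<zeta>) *\<^sub>C y \<zeta>" for \<zeta>
  have "((\<lambda>\<zeta>. w \<zeta> - u) \<longlongrightarrow> 0) (at 0)"
  proof (rule Lim_null_comparison)
    show "((\<lambda>\<zeta>. \<tau> * B * L\<^sup>2 * cmod \<zeta>) \<longlongrightarrow> 0) (at 0)" by (intro tendsto_eq_intros) auto
    have "norm (w \<zeta> - u) \<le> \<tau> * B * L\<^sup>2 * cmod \<zeta>" if \<zeta>: "\<zeta> \<noteq> 0" "cmod \<zeta> < q / 2" for \<zeta>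
    proof -
      have \<zeta>q: "\<zeta> \<in> ball 0 q" using \<zeta> q by simp
      have "w \<zeta> = (1 / \<zeta>) *\<^sub>C (\<zeta> *\<^sub>C u + \<tau> *\<^sub>R P (y \<zeta>))"
        unfolding w_def using y_eq[OF \<zeta>q] by simp
      also have "\<dots> = u + (1 / \<zeta>) *\<^sub>C (\<tau> *\<^sub>R P (y \<zeta>))"
        using \<zeta> by (simp add: scaleC_add_right scaleC_scaleC scaleC_one)
      finally have "norm (w \<zeta> - u) = \<tau> * norm (P (y \<zeta>)) / cmod \<zeta>"
        using \<tau> by (simp add: norm_scaleC norm_divide)
      also have "\<dots> \<le> \<tau> * (B * (L * cmod \<zeta>)\<^sup>2) / cmod \<zeta>"
      proof (intro divide_right_mono mult_left_mono)
        have "norm (P (y \<zeta>)) \<le> B * (norm (y \<zeta>))\<^sup>2" using y1[OF \<zeta>q] by (intro P_small) simp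
        also have "\<dots> \<le> B * (L * cmod \<zeta>)\<^sup>2"
          using L[of \<zeta>] \<zeta> B0 by (intro mult_left_mono power_mono) auto
        finally show "norm (P (y \<zeta>)) \<le> B * (L * cmod \<zeta>)\<^sup>2" .
      qed (use \<tau> in auto)
      also have "\<dots> = \<tau> * B * L\<^sup>2 * cmod \<zeta>" using \<zeta> by (simp add: power2_eq_square)
      finally show ?thesis .
    qed
    then show "\<forall>\<^sub>F \<zeta> in at 0. norm (w \<zeta> - u) \<le> \<tau> * B * L\<^sup>2 * cmod \<zeta>"
      using q by (auto simp: eventually_at intro!: exI[of _ "q / 2"])
  qed
  then have w: "(w \<longlongrightarrow> u) (at 0)" by (simp add: LIM_zero_iff)
  have Pw: "((\<lambda>\<zeta>. P (w \<zeta>)) \<longlongrightarrow> P u) (at 0)"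
    by (rule isCont_tendsto_compose[OF cfrechet_differentiable_imp_isCont[OF P] w]) (use u in simp)
  have w2: "\<forall>\<^sub>F \<zeta> in at 0. w \<zeta> \<in> ball 0 2"
    by (rule topological_tendstoD[OF w]) (use u in auto)
  have ev: "\<forall>\<^sub>F \<zeta> in at 0. \<zeta> \<noteq> 0 \<and> cmod \<zeta> < q"
    using q by (auto simp: eventually_at intro!: exI[of _ q])
  have "norm (\<tau> *\<^sub>R P u) \<le> 2 / q ^ n"
  proof (rule norm_le_dual_ball)
    fix \<phi> :: "'a \<Rightarrow> complex" assume \<phi>: "\<phi> \<in> dual_ball"
    note bl = dual_ball_linear[OF \<phi>] and cl = dual_ball_clinear[OF \<phi>]
    \<comment> \<open>The resolvent without its linear term. Homogeneity identifies its quotient by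
      \<open>\<zeta> ^ n\<close> with \<open>\<phi> (\<tau> P (w \<zeta>))\<close>, and its modulus
      is at most 2, one unit from each term.\<close>
    define f where "f \<zeta> = \<phi> (y \<zeta>) - \<phi> (\<zeta> *\<^sub>C u)" for \<zeta>
    show "cmod (\<phi> (\<tau> *\<^sub>R P u)) \<le> 2 / q ^ n"
    proof (rule monomial_coeff_bound[OF _ _ q(1)])
      have "(\<lambda>\<zeta>. \<phi> (Y (\<zeta> *\<^sub>C (- u)))) holomorphic_on ball 0 q"
        using HolD[OF Y] u by (intro holomorphic_along_ray cl) (auto simp: norm_scaleC)
      moreover have "(- \<zeta>) *\<^sub>C u = \<zeta> *\<^sub>C (- u)" for \<zeta>
        by (metis add.right_inverse add_eq_0_iff scaleC_add_left scaleC_minus_right scaleC_zero_left)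
      ultimately have "(\<lambda>\<zeta>. \<phi> (y \<zeta>)) holomorphic_on ball 0 q" by (simp add: y_def)
      then show "f holomorphic_on ball 0 q"
        unfolding f_def functional_scaleC[OF cl] by (intro holomorphic_intros)
      show "cmod (f \<zeta>) \<le> 2" if "\<zeta> \<in> ball 0 q" for \<zeta>
      proof -
        have "cmod (f \<zeta>) \<le> norm (y \<zeta>) + norm (\<zeta> *\<^sub>C u)"
          unfolding f_def using dual_ball_norm[OF \<phi>, of "y \<zeta>"] dual_ball_norm[OF \<phi>, of "\<zeta> *\<^sub>C u"]
            norm_triangle_ineq4[of "\<phi> (y \<zeta>)" "\<phi> (\<zeta> *\<^sub>C u)"] by linarith
        then show ?thesis using y1[OF that] that q u by (simp add: norm_scaleC)
      qed
      have "((\<lambda>\<zeta>. \<phi> (\<tau> *\<^sub>R P (w \<zeta>))) \<longlongrightarrow> \<phi> (\<tau> *\<^sub>R P u)) (at 0)"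
        by (intro bounded_linear.tendsto[OF bl] tendsto_scaleR tendsto_const Pw)
      then show "((\<lambda>\<zeta>. f \<zeta> / \<zeta> ^ n) \<longlongrightarrow> \<phi> (\<tau> *\<^sub>R P u)) (at 0)"
      proof (rule Lim_transform_eventually)
        show "\<forall>\<^sub>F \<zeta> in at 0. \<phi> (\<tau> *\<^sub>R P (w \<zeta>)) = f \<zeta> / \<zeta> ^ n"
          using w2 ev
        proof eventually_elim
          case (elim \<zeta>)
          then have \<zeta>: "\<zeta> \<in> ball 0 q" "cmod \<zeta> \<le> 1" using q by auto
          have "y \<zeta> = \<zeta> *\<^sub>C w \<zeta>" using elim by (simp add: w_def scaleC_scaleC scaleC_one)
          then have "P (y \<zeta>) = (\<zeta> ^ n) *\<^sub>C P (w \<zeta>)" using hom[OF elim(1) \<zeta>(2)] by simp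
          moreover have "f \<zeta> = \<phi> (\<tau> *\<^sub>R P (y \<zeta>))"
          proof -
            have "f \<zeta> = \<phi> (y \<zeta> - \<zeta> *\<^sub>C u)" unfolding f_def using bl by (simp add: linear_simps)
            moreover have "y \<zeta> - \<zeta> *\<^sub>C u = \<tau> *\<^sub>R P (y \<zeta>)" using y_eq[OF \<zeta>(1)] by (metis add_diff_cancel_left')
            ultimately show ?thesis by simp
          qed
          ultimately have "f \<zeta> = \<zeta> ^ n * \<phi> (\<tau> *\<^sub>R P (w \<zeta>))"
            by (simp add: scaleC_scaleR[symmetric] functional_scaleC[OF cl])
          then show ?case using elim by simp
        qed
      qed
    qed
  qed
  then have "\<tau> * norm (P u) \<le> 2 / q ^ n" using \<tau> by simp
  then show ?thesis using C q by (simp add: \<tau>_def field_simps)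
qed

text \<open>The n-th term of the Taylor series is at most a constant times
  \<open>(r / q^2) ^ n\<close>: one factor \<open>q^-n\<close> stems from the coefficients along
  rays, the other from \<open>homogeneous_norm_bound\<close>.\<close>

proposition numrange_le_imp_unit_radius:
  fixes h :: "'a::complex_banach \<Rightarrow> 'a"
  assumes h: "h \<in> Hol unit_ball UNIV" and N: "numrange_le \<omega> h"
  shows "unit_radius_of_boundedness h"
  unfolding unit_radius_of_boundedness_def
proof
  fix r :: real assume r: "r \<in> {0<..<1}"
  \<comment> \<open>Any \<open>q < 1\<close> with \<open>q^2 > r\<close> would do; for the mean of 1
    and \<open>r\<close> the difference \<open>q^2 - r\<close> is a perfect square.\<close>
  define q where "q = (1 + r) / 2"
  have q: "0 < q" "q < 1" using r by (auto simp: q_def)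
  have "q\<^sup>2 - r = ((1 - r) / 2)\<^sup>2" by (simp add: q_def power2_eq_square field_simps)
  also have "\<dots> > 0" using r by simp
  finally have rq: "r / q\<^sup>2 < 1" using q by simp
  obtain K where K: "K > 0" and bound: "\<And>u \<phi> \<zeta>. norm u = 1 \<Longrightarrow> \<phi> \<in> dual_ball \<Longrightarrow> \<phi> u = 1 \<Longrightarrow> cmod \<zeta> \<le> q
      \<Longrightarrow> cmod (\<phi> (h (\<zeta> *\<^sub>C u))) \<le> K"
    using numrange_le_imp_bounded[OF h N q(2)] by blast
  have "\<forall>n. \<exists>Q B. (\<forall>x\<in>ball 0 2. cfrechet_differentiable_at Q x \<and> norm (Q x) \<le> B
      \<and> (\<forall>\<zeta>. cmod \<zeta> \<le> 1 \<longrightarrow> Q (\<zeta> *\<^sub>C x) = (\<zeta> ^ n) *\<^sub>C Q x))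
    \<and> (\<forall>x\<in>ball 0 2. \<forall>\<phi>\<in>dual_ball. \<phi> (Q x) = ray_coeff h \<phi> x n)"
    using taylor_polynomials[OF h] by blast
  then obtain Q B where Q: "\<And>n x. x \<in> ball 0 2 \<Longrightarrow> cfrechet_differentiable_at (Q n) x"
    "\<And>n x. x \<in> ball 0 2 \<Longrightarrow> norm (Q n x) \<le> B n"
    "\<And>n x \<zeta>. x \<in> ball 0 2 \<Longrightarrow> cmod \<zeta> \<le> 1 \<Longrightarrow> Q n (\<zeta> *\<^sub>C x) = (\<zeta> ^ n) *\<^sub>C Q n x"
    and Q\<phi>: "\<And>n x \<phi>. x \<in> ball 0 2 \<Longrightarrow> \<phi> \<in> dual_ball \<Longrightarrow> \<phi> (Q n x) = ray_coeff h \<phi> x n"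
    by metis
  have hol: "(\<lambda>\<zeta>. \<phi> (h (\<zeta> *\<^sub>C u))) holomorphic_on ball 0 1"
    if "\<phi> \<in> dual_ball" "norm u = 1" for \<phi> :: "'a \<Rightarrow> complex" and u
    by (rule ray_holomorphic[of 1 h, OF HolD[OF h] that(1)]) (use that in auto)
  have coeff: "Re (\<phi> (Q n u)) \<le> K / q ^ n" if u: "norm u = 1" "\<phi> \<in> dual_ball" "\<phi> u = 1" for u \<phi> n
  proof -
    define f where "f \<zeta> = \<phi> (h (\<zeta> *\<^sub>C u))" for \<zeta>
    have f: "f holomorphic_on ball 0 1" unfolding f_def by (rule hol[OF u(2,1)])
    have sub: "cball 0 q \<subseteq> ball (0::complex) 1" using q by auto
    have "cmod ((deriv ^^ n) f 0) \<le> fact n * K / q ^ n"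
    proof (rule Cauchy_inequality)
      show "f holomorphic_on ball 0 q" using f sub by (force intro: holomorphic_on_subset)
      show "continuous_on (cball 0 q) f"
        using f sub by (blast intro: holomorphic_on_imp_continuous_on holomorphic_on_subset)
    qed (use q bound[OF u] in \<open>auto simp: f_def\<close>)
    then have "cmod (ray_coeff h \<phi> u n) \<le> K / q ^ n"
      by (simp add: ray_coeff_def f_def[abs_def] norm_divide field_simps)
    then show ?thesis
      using Q\<phi>[of u \<phi> n] u complex_Re_le_cmod[of "\<phi> (Q n u)"] by simp
  qed
  have Qn: "norm (Q n u) \<le> 2 * K / (1 - q) * (1 / q\<^sup>2) ^ n" if n: "n \<ge> 2" and u: "norm u = 1" for n u
  proof -
    have "norm (Q n u) \<le> 2 * (K / q ^ n) / ((1 - q) * q ^ n)"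
    proof (rule homogeneous_norm_bound[where P="Q n" and B="B n" and n=n])
      show "0 < K / q ^ n" using K q by simp
      show "Re (\<phi> (Q n u)) \<le> K / q ^ n" if "norm u = 1" "\<phi> \<in> dual_ball" "\<phi> u = 1" for u \<phi>
        by (rule coeff[OF that])
    qed (use Q n q u in auto)
    also have "\<dots> = 2 * K / (1 - q) * (1 / q\<^sup>2) ^ n"
      by (simp add: power_divide power2_eq_square power_mult_distrib)
    finally show ?thesis .
  qed
  \<comment> \<open>The resolvent argument starts at degree 2. The two lowest terms keep their
    qualitative bounds, which does not affect summability.\<close>
  define b where "b n = (if n < 2 then B n else 2 * K / (1 - q) * (1 / q\<^sup>2) ^ n) * r ^ n" for n
  have "summable (\<lambda>n. 2 * K / (1 - q) * (r / q\<^sup>2) ^ n)"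
    using r q rq by (intro summable_mult summable_geometric) auto
  then have summ: "summable b"
    by (rule summable_cong[THEN iffD1, rotated])
      (auto simp: b_def power_divide eventually_sequentially intro!: exI[of _ 2])
  \<comment> \<open>Here \<open>\<phi>\<close> ranges over the whole \<open>dual_ball\<close>: the
    terms are now bounded in norm and no longer only through functionals norming
    \<open>u\<close>.\<close>
  have hx: "norm (h x) \<le> suminf b" if x: "norm x \<le> r" "x \<noteq> 0" for x
  proof (rule norm_le_dual_ball)
    fix \<phi> :: "'a \<Rightarrow> complex" assume \<phi>: "\<phi> \<in> dual_ball"
    define u where "u = (1 / norm x) *\<^sub>R x"
    have u: "norm u = 1" "of_real (norm x) *\<^sub>C u = x"
      using x by (auto simp: u_def scaleR_scaleC[symmetric])
    have u2: "u \<in> ball 0 2" using u by simp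
    have "(\<lambda>n. ray_coeff h \<phi> u n * (of_real (norm x) - 0) ^ n) sums \<phi> (h (of_real (norm x) *\<^sub>C u))"
      unfolding ray_coeff_def
      by (rule holomorphic_power_series[OF hol[OF \<phi> u(1)]]) (use x r in auto)
    then have sums: "(\<lambda>n. \<phi> (Q n u) * of_real (norm x) ^ n) sums \<phi> (h x)"
      using Q\<phi>[OF u2 \<phi>] u(2) by simp
    show "cmod (\<phi> (h x)) \<le> suminf b"
      unfolding sums_unique[OF sums]
    proof (rule norm_suminf_le[OF _ summ])
      fix n
      have "norm (Q n u) \<le> (if n < 2 then B n else 2 * K / (1 - q) * (1 / q\<^sup>2) ^ n)"
        using Qn[OF _ u(1), of n] Q(2)[OF u2, of n] by auto
      then have "norm (Q n u) * norm x ^ n \<le> b n"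
        unfolding b_def using x by (intro mult_mono power_mono) (auto intro: order_trans[OF norm_ge_zero])
      moreover have "cmod (\<phi> (Q n u)) * norm x ^ n \<le> norm (Q n u) * norm x ^ n"
        by (intro mult_right_mono dual_ball_norm[OF \<phi>]) simp
      ultimately show "cmod (\<phi> (Q n u) * of_real (norm x) ^ n) \<le> b n"
        by (simp add: norm_mult norm_power)
    qed
  qed
  show "bdd_above ((\<lambda>x. norm (h x)) ` cball 0 r)"
  proof (rule bdd_aboveI2)
    fix x :: 'a assume "x \<in> cball 0 r"
    then show "norm (h x) \<le> max (norm (h 0)) (suminf b)" using hx[of x] by (cases "x = 0") auto
  qed
qed

subsection \<open>Abel averages\<close>

lemma abel_average_solution:
  "\<exists>!y. abel_solution \<omega> h \<alpha> x y \<Longrightarrow> abel_solution \<omega> h \<alpha> x (abel_average \<omega> h \<alpha> x)"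
  unfolding abel_average_def by (rule theI')

lemma abel_average_eq:
  "\<exists>!y. abel_solution \<omega> h \<alpha> x y \<Longrightarrow> abel_solution \<omega> h \<alpha> x y \<Longrightarrow> abel_average \<omega> h \<alpha> x = y"
  unfolding abel_average_def by (rule the1_equality)

text \<open>For small \<open>\<alpha>\<close> the equation reads
  \<open>y = \<alpha> h y + (1 - \<alpha> \<omega>) x\<close> and is contractive near
  \<open>x\<close>, where continuity bounds \<open>h\<close>. Unique solvability later identifies
  the solution found here with the Abel average.\<close>

lemma abel_average_near:
  fixes h :: "'a::complex_banach \<Rightarrow> 'a"
  assumes h: "h \<in> Hol unit_ball UNIV" and x: "x \<in> unit_ball"
  shows "\<exists>C. \<forall>\<^sub>F \<alpha> in at_right 0. \<exists>y. abel_solution \<omega> h \<alpha> x y \<and> norm (y - x) \<le> C * \<alpha>"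
proof -
  have "isCont h x" by (rule cfrechet_differentiable_imp_isCont[OF HolD[OF h x]])
  then obtain d where d: "d > 0" "\<And>y. dist y x < d \<Longrightarrow> dist (h y) (h x) < 1"
    unfolding continuous_at_eps_delta by (metis zero_less_one)
  obtain e where e: "e > 0" "ball x e \<subseteq> unit_ball" using x open_contains_ball open_ball by metis
  define r where "r = min d e / 2"
  have r: "r > 0" "2 * r \<le> d" "2 * r \<le> e" using d e by (auto simp: r_def)
  define M where "M = norm (h x) + 1"
  have U: "y \<in> unit_ball" if "y \<in> ball x (2 * r)" for y using that r e by (auto simp: subset_iff)
  have hM: "norm (h y) \<le> M" if "y \<in> ball x (2 * r)" for y
    using d(2)[of y] that r norm_triangle_sub[of "h y" "h x"] by (simp add: M_def dist_norm norm_minus_commute)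
  have sub: "cball x r \<subseteq> ball x (2 * r)" using r by auto
  have lip: "norm (h y - h z) \<le> M / r * norm (y - z)" if "y \<in> cball x r" "z \<in> cball x r" for y z
  proof (rule holomorphic_bounded_imp_lipschitz[of "ball x (2 * r)" h M "cball x r" r])
    show "ball w r \<subseteq> ball x (2 * r)" if "w \<in> cball x r" for w
    proof
      fix v assume "v \<in> ball w r"
      then show "v \<in> ball x (2 * r)" using that dist_triangle[of x v w] by simp
    qed
  qed (use HolD[OF h U] hM r that in auto)
  \<comment> \<open>Bounds \<open>h y - \<omega> x\<close> near \<open>x\<close>; times
    \<open>\<alpha>\<close> it is the distance by which \<open>T\<close> moves points away from
    \<open>x\<close>.\<close>
  define C where "C = M + \<bar>\<omega>\<bar>"
  have "((\<lambda>\<alpha>. \<alpha> * (M / r)) \<longlongrightarrow> 0 * (M / r)) (at_right (0::real))" by (intro tendsto_intros)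
  then have "\<forall>\<^sub>F \<alpha> in at_right (0::real). \<alpha> * (M / r) < 1" by (rule order_tendstoD(2)) simp
  moreover have "((\<lambda>\<alpha>. C * \<alpha>) \<longlongrightarrow> C * 0) (at_right (0::real))" by (intro tendsto_intros)
  then have "\<forall>\<^sub>F \<alpha> in at_right (0::real). C * \<alpha> < r" by (rule order_tendstoD(2)) (use r in simp)
  moreover have "\<forall>\<^sub>F \<alpha> in at_right (0::real). \<alpha> > 0" by (simp add: eventually_at_right_less)
  ultimately have "\<forall>\<^sub>F \<alpha> in at_right 0. \<exists>y. abel_solution \<omega> h \<alpha> x y \<and> norm (y - x) \<le> C * \<alpha>"
  proof eventually_elim
    case (elim \<alpha>)
    define T where "T y = \<alpha> *\<^sub>R h y + (1 - \<alpha> * \<omega>) *\<^sub>R x" for y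
    have Tx: "norm (T y - x) \<le> C * \<alpha>" if "y \<in> cball x r" for y
    proof -
      have "T y - x = \<alpha> *\<^sub>R (h y - \<omega> *\<^sub>R x)" by (simp add: T_def algebra_simps)
      then have "norm (T y - x) = \<alpha> * norm (h y - \<omega> *\<^sub>R x)" using elim by simp
      also have "\<dots> \<le> \<alpha> * (M + \<bar>\<omega>\<bar> * 1)"
      proof (intro mult_left_mono order_trans[OF norm_triangle_ineq4] add_mono)
        show "norm (h y) \<le> M" using hM that sub by blast
        show "norm (\<omega> *\<^sub>R x) \<le> \<bar>\<omega>\<bar> * 1" using x by (simp add: mult_left_le)
      qed (use elim in auto)
      finally show ?thesis by (simp add: C_def mult.commute)
    qed
    have "\<exists>!y\<in>cball x r. T y = y"
    proof (rule Banach_fix[OF _ _ _ elim(1)])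
      show "complete (cball x r)" by (simp add: complete_eq_closed)
      show "cball x r \<noteq> {}" using r by auto
      show "0 \<le> \<alpha> * (M / r)" using elim r by (simp add: M_def add_nonneg_nonneg)
      show "T ` cball x r \<subseteq> cball x r"
        using Tx elim by (force simp: dist_norm norm_minus_commute)
      show "dist (T y) (T z) \<le> \<alpha> * (M / r) * dist y z" if "y \<in> cball x r" "z \<in> cball x r" for y z
        using mult_left_mono[OF lip[OF that], of \<alpha>] elim
        by (simp add: T_def dist_norm scaleR_diff_right[symmetric])
    qed
    then obtain y where y: "y \<in> cball x r" "T y = y" by blast
    then have "abel_solution \<omega> h \<alpha> x y"
      using U sub unfolding abel_solution_def T_def by (auto simp: algebra_simps subset_iff)
    then show ?case using Tx[OF y(1)] y(2) by auto
  qed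
  then show ?thesis by blast
qed

text \<open>By the Abel equation the difference quotient equals \<open>h\<close> at the Abel average
  minus \<open>\<omega> x\<close>, so the second limit follows from the first by continuity of
  \<open>h\<close>.\<close>

lemma abel_average_limits:
  fixes h :: "'a::complex_banach \<Rightarrow> 'a"
  assumes h: "h \<in> Hol unit_ball UNIV" and pc: "pseudo_contractive \<omega> h" and x: "x \<in> unit_ball"
  shows "((\<lambda>\<alpha>. abel_average \<omega> h \<alpha> x) \<longlongrightarrow> x) (at_right 0)"
    and "((\<lambda>\<alpha>. (1 / \<alpha>) *\<^sub>R (abel_average \<omega> h \<alpha> x - x)) \<longlongrightarrow> h x - \<omega> *\<^sub>R x) (at_right 0)"
proof -
  obtain \<delta> where \<delta>: "\<delta> > 0" and Hol: "\<And>\<alpha>. \<alpha> \<in> {0<..<\<delta>} \<Longrightarrow> abel_average_in_Hol \<omega> h \<alpha>"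
    using pc unfolding pseudo_contractive_def by blast
  obtain C where C: "\<forall>\<^sub>F \<alpha> in at_right 0. \<exists>y. abel_solution \<omega> h \<alpha> x y \<and> norm (y - x) \<le> C * \<alpha>"
    using abel_average_near[OF h x] by blast
  have ev: "\<forall>\<^sub>F \<alpha> in at_right 0. \<alpha> \<in> {0<..<\<delta>}"
    using \<delta> by (rule eventually_at_right_real)
  have sol: "\<forall>\<^sub>F \<alpha> in at_right 0. \<alpha> > 0 \<and> abel_solution \<omega> h \<alpha> x (abel_average \<omega> h \<alpha> x)
      \<and> norm (abel_average \<omega> h \<alpha> x - x) \<le> C * \<alpha>"
    using C ev
  proof eventually_elim
    case (elim \<alpha>)
    then obtain y where y: "abel_solution \<omega> h \<alpha> x y" "norm (y - x) \<le> C * \<alpha>" by blast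
    have "abel_average \<omega> h \<alpha> x = y"
      using Hol[OF elim(2)] x y(1) unfolding abel_average_in_Hol_def by (blast intro: abel_average_eq)
    then show ?case using y elim by simp
  qed
  have "((\<lambda>\<alpha>. abel_average \<omega> h \<alpha> x - x) \<longlongrightarrow> 0) (at_right 0)"
  proof (rule Lim_null_comparison)
    show "\<forall>\<^sub>F \<alpha> in at_right 0. norm (abel_average \<omega> h \<alpha> x - x) \<le> C * \<alpha>"
      using sol by eventually_elim simp
    show "((\<lambda>\<alpha>. C * \<alpha>) \<longlongrightarrow> 0) (at_right 0)" by (intro tendsto_eq_intros) auto
  qed
  then show lim: "((\<lambda>\<alpha>. abel_average \<omega> h \<alpha> x) \<longlongrightarrow> x) (at_right 0)" by (simp add: LIM_zero_iff)
  have "((\<lambda>\<alpha>. h (abel_average \<omega> h \<alpha> x) - \<omega> *\<^sub>R x) \<longlongrightarrow> h x - \<omega> *\<^sub>R x) (at_right 0)"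
    by (intro tendsto_diff tendsto_const
        isCont_tendsto_compose[OF cfrechet_differentiable_imp_isCont[OF HolD[OF h x]] lim])
  then show "((\<lambda>\<alpha>. (1 / \<alpha>) *\<^sub>R (abel_average \<omega> h \<alpha> x - x)) \<longlongrightarrow> h x - \<omega> *\<^sub>R x) (at_right 0)"
  proof (rule Lim_transform_eventually)
    show "\<forall>\<^sub>F \<alpha> in at_right 0. h (abel_average \<omega> h \<alpha> x) - \<omega> *\<^sub>R x
        = (1 / \<alpha>) *\<^sub>R (abel_average \<omega> h \<alpha> x - x)"
      using sol
    proof eventually_elim
      case (elim \<alpha>)
      let ?y = "abel_average \<omega> h \<alpha> x"
      have "?y - \<alpha> *\<^sub>R h ?y = (1 - \<alpha> * \<omega>) *\<^sub>R x" using elim by (simp add: abel_solution_def)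
      then have "?y - x = \<alpha> *\<^sub>R (h ?y - \<omega> *\<^sub>R x)" by (simp add: algebra_simps)
      then show ?case using elim by simp
    qed
  qed
qed

text \<open>The difference quotient of a self-map of the ball has numerical radius at most zero, so the
  growth estimate applies to \<open>(\<Phi>\<^sub>\<alpha> - I) / \<alpha>\<close> and survives the limit \<open>\<alpha> \<rightarrow> 0\<close>.\<close>

lemma pseudo_contractive_imp_growth:
  fixes h :: "'a::complex_banach \<Rightarrow> 'a"
  assumes h: "h \<in> Hol unit_ball UNIV" and pc: "pseudo_contractive \<omega> h"
  shows "numrange_growth \<omega> (norm (h 0)) h"
  unfolding numrange_growth_def
proof (intro allI ballI impI)
  fix u :: 'a and \<phi> :: "'a \<Rightarrow> complex" and s :: real
  assume \<phi>: "\<phi> \<in> dual_ball" and s: "s \<in> {0<..<1}" and u: "norm u = 1" "\<phi> u = 1"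
  obtain \<delta> where \<delta>: "\<delta> > 0" and Hol: "\<And>\<alpha>. \<alpha> \<in> {0<..<\<delta>} \<Longrightarrow> abel_average_in_Hol \<omega> h \<alpha>"
    using pc unfolding pseudo_contractive_def by blast
  define g where "g \<alpha> x = (1 / \<alpha>) *\<^sub>R (abel_average \<omega> h \<alpha> x - x)" for \<alpha> x
  have g_le: "Re (\<phi> (g \<alpha> (s *\<^sub>R u))) \<le> norm (g \<alpha> 0) * (1 - s\<^sup>2)" if \<alpha>: "\<alpha> \<in> {0<..<\<delta>}" for \<alpha>
  proof -
    have A: "abel_average \<omega> h \<alpha> \<in> Hol unit_ball unit_ball"
      using Hol[OF \<alpha>] unfolding abel_average_in_Hol_def by blast
    have "g \<alpha> \<in> Hol unit_ball UNIV"
      by (rule HolI) (auto simp: g_def[abs_def] intro!: cfrechet_differentiable_scaleR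
          cfrechet_differentiable_diff cfrechet_differentiable_ident HolD[OF A])
    moreover have "numrange_le 0 (g \<alpha>)"
      unfolding numrange_le_def
    proof (intro allI impI)
      fix \<eta> :: real assume "\<eta> > 0"
      \<comment> \<open>The parameter \<open>\<alpha>\<close> is fixed here: a self-map of the ball
        has real part at most 1 under \<open>\<psi>\<close>, while the identity contributes exactly
        \<open>s\<close>.\<close>
      have "((\<lambda>s. (1 - s) / \<alpha>) \<longlongrightarrow> (1 - 1) / \<alpha>) (at_left (1::real))" using \<alpha> by (intro tendsto_intros) auto
      then have "\<forall>\<^sub>F s in at_left (1::real). (1 - s) / \<alpha> < \<eta>"
        using \<open>\<eta> > 0\<close> by (intro order_tendstoD(2)) auto
      moreover have "\<forall>\<^sub>F s in at_left (1::real). s \<in> {0<..<1}" by (rule eventually_at_left_real) simp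
      ultimately show "\<forall>\<^sub>F s in at_left 1. \<forall>u. \<forall>\<phi>\<in>dual_ball. norm u = 1 \<longrightarrow> \<phi> u = 1 \<longrightarrow>
          Re (\<phi> (g \<alpha> (s *\<^sub>R u))) \<le> 0 + \<eta>"
      proof eventually_elim
        case (elim s)
        show ?case
        proof (intro allI ballI impI)
          fix v :: 'a and \<psi> :: "'a \<Rightarrow> complex"
          assume v: "\<psi> \<in> dual_ball" "norm v = 1" "\<psi> v = 1"
          let ?y = "abel_average \<omega> h \<alpha> (s *\<^sub>R v)"
          have "s *\<^sub>R v \<in> unit_ball" using elim v by simp
          then have "norm ?y < 1" using Hol_mem[OF A] by simp
          then have "Re (\<psi> ?y) \<le> 1"
            using dual_ball_norm[OF v(1), of ?y] complex_Re_le_cmod[of "\<psi> ?y"] by linarith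
          moreover have "Re (\<psi> (g \<alpha> (s *\<^sub>R v))) = (Re (\<psi> ?y) - s) / \<alpha>"
            unfolding g_def using dual_ball_linear[OF v(1)] v(3)
            by (simp add: bounded_linear.linear linear_scale linear_diff diff_divide_distrib)
          ultimately have "Re (\<psi> (g \<alpha> (s *\<^sub>R v))) \<le> (1 - s) / \<alpha>"
            using \<alpha> by (auto intro: divide_right_mono)
          then show "Re (\<psi> (g \<alpha> (s *\<^sub>R v))) \<le> 0 + \<eta>" using elim by simp
        qed
      qed
    qed
    ultimately have "numrange_growth 0 (norm (g \<alpha> 0)) (g \<alpha>)" by (rule numrange_le_imp_growth)
    from numrange_growthD[OF this \<phi> _ _ u, of s] s show ?thesis by simp
  qed
  have lim: "((\<lambda>\<alpha>. g \<alpha> x) \<longlongrightarrow> h x - \<omega> *\<^sub>R x) (at_right 0)" if "x \<in> unit_ball" for x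
    unfolding g_def by (rule abel_average_limits(2)[OF h pc that])
  \<comment> \<open>The limit of the bounds for \<open>g \<alpha>\<close>; the subtracted identity
    contributes \<open>\<omega> * s\<close> at \<open>s\<close> times \<open>u\<close> and nothing
    at 0.\<close>
  have "Re (\<phi> (h (s *\<^sub>R u) - \<omega> *\<^sub>R s *\<^sub>R u)) \<le> norm (h 0 - \<omega> *\<^sub>R 0) * (1 - s\<^sup>2)"
  proof (rule tendsto_le)
    show "((\<lambda>\<alpha>. Re (\<phi> (g \<alpha> (s *\<^sub>R u)))) \<longlongrightarrow> Re (\<phi> (h (s *\<^sub>R u) - \<omega> *\<^sub>R s *\<^sub>R u))) (at_right 0)"
      using s u by (intro tendsto_Re bounded_linear.tendsto[OF dual_ball_linear[OF \<phi>]] lim) auto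
    show "((\<lambda>\<alpha>. norm (g \<alpha> 0) * (1 - s\<^sup>2)) \<longlongrightarrow> norm (h 0 - \<omega> *\<^sub>R 0) * (1 - s\<^sup>2)) (at_right 0)"
      by (intro tendsto_intros lim) auto
    have "\<forall>\<^sub>F \<alpha> in at_right 0. \<alpha> \<in> {0<..<\<delta>}" using \<delta> by (rule eventually_at_right_real)
    then show "\<forall>\<^sub>F \<alpha> in at_right 0. Re (\<phi> (g \<alpha> (s *\<^sub>R u))) \<le> norm (g \<alpha> 0) * (1 - s\<^sup>2)"
      by eventually_elim (rule g_le)
  qed simp
  then show "Re (\<phi> (h (s *\<^sub>R u))) \<le> \<omega> * s + norm (h 0) * (1 - s\<^sup>2)"
    using dual_ball_linear[OF \<phi>] u(2)
    by (simp add: bounded_linear.linear linear_scale linear_diff)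
qed

text \<open>For both signs of \<open>\<alpha>\<close> the Abel equation reads \<open>F y = - (1/\<alpha> - \<omega>) x\<close> with
  \<open>F = h - I/\<alpha>\<close>, and \<open>F\<close> points inwards on spheres near the unit sphere as soon as
  \<open>1/\<alpha> - \<omega> > 0\<close>.\<close>

lemma growth_imp_abel_average_in_Hol:
  fixes h :: "'a::complex_banach \<Rightarrow> 'a"
  assumes h: "h \<in> Hol unit_ball UNIV" and growth: "numrange_growth \<omega> \<sigma> h"
    and urb: "unit_radius_of_boundedness h" and \<alpha>: "\<alpha> \<noteq> 0" "1 / \<alpha> > \<omega>"
  shows "abel_average_in_Hol \<omega> h \<alpha>"
proof -
  define c where "c = 1 / \<alpha> - \<omega>"
  have c: "c > 0" "\<alpha> * c = 1 - \<alpha> * \<omega>" using \<alpha> by (simp_all add: c_def right_diff_distrib)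
  define F where "F y = h y - (1 / \<alpha>) *\<^sub>R y" for y
  have sol_iff: "abel_solution \<omega> h \<alpha> x y \<longleftrightarrow> y \<in> unit_ball \<and> F y = - (c *\<^sub>R x)" for x y
  proof -
    have "F y = - (c *\<^sub>R x) \<longleftrightarrow> \<alpha> *\<^sub>R F y = \<alpha> *\<^sub>R (- (c *\<^sub>R x))"
      using \<alpha>(1) by (simp only: scaleR_cancel_left) simp
    also have "\<alpha> *\<^sub>R F y = \<alpha> *\<^sub>R h y - y" using \<alpha> by (simp add: F_def scaleR_diff_right)
    also have "\<alpha> *\<^sub>R (- (c *\<^sub>R x)) = - ((1 - \<alpha> * \<omega>) *\<^sub>R x)" using c by simp
    also have "\<alpha> *\<^sub>R h y - y = - ((1 - \<alpha> * \<omega>) *\<^sub>R x) \<longleftrightarrow> y - \<alpha> *\<^sub>R h y = (1 - \<alpha> * \<omega>) *\<^sub>R x"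
      by (metis minus_diff_eq minus_minus)
    finally show ?thesis by (auto simp: abel_solution_def)
  qed
  \<comment> \<open>The inward margin of \<open>F\<close> on the sphere of radius \<open>s\<close>.
    It tends to \<open>c\<close> as \<open>s\<close> tends to 1, so for \<open>norm x < 1\<close>
    the point \<open>- c x\<close> eventually lies in \<open>ball 0 (cs s)\<close>.\<close>
  define cs where "cs s = c * s - \<sigma> * (1 - s\<^sup>2)" for s :: real
  have local: "\<exists>Y. Y \<in> Hol (ball 0 (cs s)) (ball 0 s) \<and> (\<forall>z\<in>ball 0 (cs s). \<forall>y\<in>ball 0 s. F y = z \<longleftrightarrow> y = Y z)"
    if s: "0 < s" "s < 1" "cs s > 0" for s
  proof -
    define R where "R = (1 + s) / 2"
    have R: "s < R" "R < 1" "0 < R" using s by (auto simp: R_def)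
    obtain M where M: "\<And>x. x \<in> cball 0 R \<Longrightarrow> norm (h x) \<le> M"
      using urb R unfolding unit_radius_of_boundedness_def bdd_above_def by fastforce
    show ?thesis
    proof (rule inward_inverse[where R=R])
      show "cfrechet_differentiable_at F x" if "x \<in> ball 0 R" for x
        unfolding F_def using that R
        by (intro cfrechet_differentiable_diff cfrechet_differentiable_scaleR
            cfrechet_differentiable_ident HolD[OF h]) auto
      show "norm (F x) \<le> M + \<bar>1 / \<alpha>\<bar> * R" if "x \<in> ball 0 R" for x
      proof -
        have "norm (F x) \<le> norm (h x) + \<bar>1 / \<alpha>\<bar> * norm x"
          unfolding F_def using norm_triangle_ineq4[of "h x" "(1 / \<alpha>) *\<^sub>R x"] by simp
        also have "\<dots> \<le> M + \<bar>1 / \<alpha>\<bar> * R"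
          using that by (intro add_mono M mult_left_mono) auto
        finally show ?thesis .
      qed
      show "Re (\<phi> (F (s *\<^sub>R u))) \<le> - cs s" if u: "norm u = 1" "\<phi> \<in> dual_ball" "\<phi> u = 1" for u \<phi>
      proof -
        have "Re (\<phi> (F (s *\<^sub>R u))) = Re (\<phi> (h (s *\<^sub>R u))) - s / \<alpha>"
          unfolding F_def using dual_ball_linear[OF u(2)] u(3)
          by (simp add: bounded_linear.linear linear_scale linear_diff)
        also have "\<dots> \<le> \<omega> * s + \<sigma> * (1 - s\<^sup>2) - s / \<alpha>"
          using numrange_growthD[OF growth u(2) s(1,2) u(1,3)] by simp
        also have "\<dots> = - cs s" by (simp add: cs_def c_def algebra_simps)
        finally show ?thesis .
      qed
    qed (use s R in auto)
  qed
  have radius: "\<exists>s. m < s \<and> 0 < s \<and> s < 1 \<and> c * t < cs s" if "t < 1" "m < 1" for t m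
  proof -
    have "((\<lambda>s. cs s) \<longlongrightarrow> c * 1 - \<sigma> * (1 - 1\<^sup>2)) (at_left 1)"
      unfolding cs_def by (intro tendsto_intros)
    moreover have "c * t < c * 1 - \<sigma> * (1 - 1\<^sup>2)" using c that by simp
    ultimately have "\<forall>\<^sub>F s in at_left 1. c * t < cs s" by (rule order_tendstoD(1))
    moreover have "\<forall>\<^sub>F s in at_left (1::real). s \<in> {max m 0<..<1}"
      using that by (intro eventually_at_left_real) simp
    ultimately have "\<forall>\<^sub>F s in at_left (1::real). m < s \<and> 0 < s \<and> s < 1 \<and> c * t < cs s"
      by eventually_elim auto
    then show ?thesis using eventually_happens[of _ "at_left (1::real)"] by auto
  qed
  have unique: "\<exists>!y. abel_solution \<omega> h \<alpha> x y" if x: "x \<in> unit_ball" for x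
  proof -
    \<comment> \<open>Each radius gives uniqueness only within \<open>ball 0 s\<close>; that
      \<open>s\<close> may exceed any \<open>m < 1\<close> allows a ball containing two competing
      solutions.\<close>
    have *: "\<exists>s Y. m < s \<and> 0 < s \<and> s < 1 \<and> Y \<in> ball 0 s \<and> (\<forall>y\<in>ball 0 s. F y = - (c *\<^sub>R x) \<longleftrightarrow> y = Y)"
      if m: "m < 1" for m
    proof -
      obtain s where s: "m < s" "0 < s" "s < 1" "c * norm x < cs s" using radius[of "norm x" m] x m by auto
      have z: "- (c *\<^sub>R x) \<in> ball 0 (cs s)" using s c by simp
      have "cs s > 0" using s(4) c by (smt (verit) mult_nonneg_nonneg norm_ge_zero)
      then obtain Y where "Y \<in> Hol (ball 0 (cs s)) (ball 0 s)"
        "\<forall>z\<in>ball 0 (cs s). \<forall>y\<in>ball 0 s. F y = z \<longleftrightarrow> y = Y z"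
        using local[OF s(2,3)] by blast
      then show ?thesis using s z Hol_mem[of Y] by blast
    qed
    obtain s Y where sY: "s < 1" "Y \<in> ball 0 s" "F Y = - (c *\<^sub>R x)" using *[of 0] by auto
    show ?thesis
    proof (rule ex1I)
      show "abel_solution \<omega> h \<alpha> x Y" using sY by (simp add: sol_iff)
      fix y assume "abel_solution \<omega> h \<alpha> x y"
      then have y: "norm y < 1" "F y = - (c *\<^sub>R x)" by (simp_all add: sol_iff)
      obtain s' Y' where s': "max (norm y) (norm Y) < s'"
        "\<forall>y\<in>ball 0 s'. F y = - (c *\<^sub>R x) \<longleftrightarrow> y = Y'"
        using *[of "max (norm y) (norm Y)"] y sY by auto
      then have "y \<in> ball 0 s'" "Y \<in> ball 0 s'" by auto
      then have "y = Y'" "Y = Y'" using s'(2) y(2) sY(3) by blast+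
      then show "y = Y" by simp
    qed
  qed
  have "abel_average \<omega> h \<alpha> \<in> Hol unit_ball unit_ball"
  proof (rule HolI)
    fix x0 :: 'a assume x0: "x0 \<in> unit_ball"
    show "abel_average \<omega> h \<alpha> x0 \<in> unit_ball"
      using abel_average_solution[OF unique[OF x0]] by (simp add: abel_solution_def)
    \<comment> \<open>One radius \<open>s\<close> then serves all \<open>x\<close> in
      \<open>ball 0 t\<close>, so near \<open>x0\<close> the Abel average coincides with a single
      holomorphic \<open>Y\<close> after scaling.\<close>
    obtain t where t: "norm x0 < t" "t < 1" using x0 dense[of "norm x0" 1] by auto
    obtain s where s: "0 < s" "s < 1" "c * t < cs s" using radius[of t 0] t by auto
    have "0 < t" using t norm_ge_zero[of x0] by linarith
    then have "cs s > 0" using s(3) c by (smt (verit) mult_pos_pos)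
    then obtain Y where Y: "Y \<in> Hol (ball 0 (cs s)) (ball 0 s)"
      "\<And>z y. z \<in> ball 0 (cs s) \<Longrightarrow> y \<in> ball 0 s \<Longrightarrow> F y = z \<longleftrightarrow> y = Y z"
      using local[OF s(1,2)] by blast
    have z: "- (c *\<^sub>R x) \<in> ball 0 (cs s)" if "x \<in> ball 0 t" for x :: 'a
    proof -
      have "c * norm x \<le> c * t" using that c(1) by (intro mult_left_mono) auto
      also note s(3)
      finally show ?thesis using c(1) by simp
    qed
    have "cfrechet_differentiable_at (\<lambda>x. Y ((- c) *\<^sub>R x)) x0"
      by (rule cfrechet_differentiable_compose[of "\<lambda>x. (- c) *\<^sub>R x",
            OF cfrechet_differentiable_scaleR[OF cfrechet_differentiable_ident] HolD[OF Y(1)]])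
        (use z[of x0] t in simp)
    then show "cfrechet_differentiable_at (abel_average \<omega> h \<alpha>) x0"
    proof (rule cfrechet_differentiable_cong)
      fix x :: 'a assume x: "x \<in> ball 0 t"
      have "Y (- (c *\<^sub>R x)) \<in> ball 0 s" by (rule Hol_mem[OF Y(1) z[OF x]])
      then have "abel_solution \<omega> h \<alpha> x (Y (- (c *\<^sub>R x)))"
        using Y(2)[OF z[OF x]] s by (auto simp: sol_iff)
      then show "Y ((- c) *\<^sub>R x) = abel_average \<omega> h \<alpha> x"
        using abel_average_eq[OF unique] x t by (simp add: less_trans)
    qed (use t in auto)
  qed
  moreover have "\<alpha> * \<omega> \<noteq> 1" using c \<alpha> by (metis diff_self less_irrefl mult_eq_0_iff)
  ultimately show ?thesis using unique unfolding abel_average_in_Hol_def by blast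
qed

section \<open>The admissible parameters and the equivalence\<close>

lemma abel_average_in_Hol_zero: "abel_average_in_Hol \<omega> h 0"
proof -
  have iff: "abel_solution \<omega> h 0 x y \<longleftrightarrow> y \<in> unit_ball \<and> y = x" for x y
    by (simp add: abel_solution_def)
  have eq: "abel_average \<omega> h 0 x = x" if "x \<in> unit_ball" for x
    by (rule abel_average_eq) (use that in \<open>auto simp: iff\<close>)
  have "abel_average \<omega> h 0 \<in> Hol unit_ball unit_ball"
  proof (rule HolI)
    fix x :: 'a assume x: "x \<in> unit_ball"
    show "cfrechet_differentiable_at (abel_average \<omega> h 0) x"
      by (rule cfrechet_differentiable_cong[OF cfrechet_differentiable_ident open_ball x]) (simp add: eq)
    show "abel_average \<omega> h 0 x \<in> unit_ball" using x by (simp add: eq)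
  qed
  then show ?thesis by (auto simp: abel_average_in_Hol_def iff)
qed

text \<open>The condition \<open>1 / \<alpha> > \<omega>\<close> explains the shape of
  \<open>Q\<close>: for \<open>\<omega> < 0\<close> it holds for all positive
  \<open>\<alpha>\<close>, and for negative \<open>\<alpha>\<close> multiplication by
  \<open>\<alpha>\<close> reverses it into \<open>\<alpha> < 1 / \<omega>\<close>.\<close>

lemma inverse_gt_of_Q:
  assumes "\<alpha> \<in> Q \<omega>" "\<alpha> \<noteq> 0"
  shows "1 / \<alpha> > \<omega>"
proof -
  consider "\<omega> > 0" | "\<omega> = 0" | "\<omega> < 0" by linarith
  then show ?thesis
  proof cases
    case 3
    then consider "\<alpha> > 0" | "\<alpha> < 1 / \<omega>" using assms by (auto simp: Q_def)
    then show ?thesis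
    proof cases
      case 1
      then have "1 / \<alpha> > 0" by simp
      then show ?thesis using 3 by linarith
    next
      case 2
      then have "\<alpha> < 0" using 3 by (meson divide_neg_pos divide_pos_neg less_trans zero_less_one)
      then show ?thesis using 2 3 by (simp add: field_simps)
    qed
  qed (use assms in \<open>auto simp: Q_def field_simps\<close>)
qed

lemma Q_imp_pseudo_contractive:
  assumes "\<forall>\<alpha>\<in>Q \<omega>. abel_average_in_Hol \<omega> h \<alpha>"
  shows "pseudo_contractive \<omega> h"
proof -
  define \<delta> where "\<delta> = (if \<omega> > 0 then 1 / \<omega> else 1)"
  have "\<delta> > 0" "{0<..<\<delta>} \<subseteq> Q \<omega>" by (auto simp: \<delta>_def Q_def)
  then show ?thesis using assms unfolding pseudo_contractive_def by blast
qed

theorem theorem1p8: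
  fixes h :: "'a::complex_banach \<Rightarrow> 'a" and \<omega> :: real
  assumes "h \<in> Hol unit_ball UNIV"
  shows "(dissipative \<omega> h \<longleftrightarrow> numerical_radius h \<le> ereal \<omega>)
    \<and> (dissipative \<omega> h \<longleftrightarrow> unit_radius_of_boundedness h \<and> pseudo_contractive \<omega> h)
    \<and> (dissipative \<omega> h \<longleftrightarrow>
        unit_radius_of_boundedness h \<and> (\<forall>\<alpha>\<in>Q \<omega>. abel_average_in_Hol \<omega> h \<alpha>))
    \<and> (unit_radius_of_boundedness h \<and> pseudo_contractive \<omega> h \<longrightarrow>
        (\<forall>x\<in>unit_ball.
          ((\<lambda>\<alpha>. abel_average \<omega> h \<alpha> x) \<longlongrightarrow> x) (at_right 0)
          \<and> ((\<lambda>\<alpha>. (1 / \<alpha>) *\<^sub>R (abel_average \<omega> h \<alpha> x - x)) \<longlongrightarrow> h x - \<omega> *\<^sub>R x) (at_right 0)))"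
proof -
  have growth: "numrange_le \<omega> h \<Longrightarrow> numrange_growth \<omega> (norm (h 0)) h"
    by (rule numrange_le_imp_growth[OF assms])
  have i_ii: "dissipative \<omega> h \<longleftrightarrow> numrange_le \<omega> h"
    using dissipative_imp_numrange_le growth numrange_growth_imp_dissipative by blast
  have urb: "dissipative \<omega> h \<Longrightarrow> unit_radius_of_boundedness h"
    using i_ii numrange_le_imp_unit_radius[OF assms] by blast
  have abel: "abel_average_in_Hol \<omega> h \<alpha>" if "dissipative \<omega> h" "\<alpha> \<in> Q \<omega>" for \<alpha>
  proof (cases "\<alpha> = 0")
    case True
    then show ?thesis by (simp add: abel_average_in_Hol_zero)
  next
    case False
    show ?thesis
      using growth_imp_abel_average_in_Hol[OF assms growth urb False inverse_gt_of_Q[OF that(2) False]]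
        that(1) i_ii by blast
  qed
  \<comment> \<open>This closes the cycle: (i) yields (iv), (iv) yields (iii) by restriction to
    small positive parameters, and (iii) returns to (i) through the growth bound.\<close>
  have diss: "pseudo_contractive \<omega> h \<Longrightarrow> dissipative \<omega> h"
    by (rule numrange_growth_imp_dissipative[OF pseudo_contractive_imp_growth[OF assms]])
  show ?thesis
    using i_ii urb abel diss Q_imp_pseudo_contractive[of \<omega> h] abel_average_limits[OF assms]
    unfolding numerical_radius_le_iff by blast
qed

end
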